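(* Assume that $U_0,V_1,\dots,V_d$ satisfy both (A) and (B) below. (A) There are constants $c_0,c_1,c_2,q,K,b_0>0$ and $b_1\ge0$ such that for all $x,y\in\mathbb R^N$: - $\sum_{k=1}^d|V_k(x)-V_k(y)|\le c_1|x-y|$ and $\sum_{k=1}^d|V_k(x)|^2\le K$; - $\langle U_0(x),x\rangle\le-b_0|x|^2+b_1$; - $\langle U_0(x)-U_0(y),x-y\rangle\le c_0|x-y|^2$; - $|U_0(x)-U_0(y)|^2\le c_2(1+|x|^{2q}+|y|^{2q})|x-y|^2$. (B) There are a constant $\beta\ge1$ and a function $\lambda:\mathbb R^N\to(0,\infty)$ with $\inf_x\lambda(x)>0$ such that $-\beta\lambda(x)|v|^2\le v^T\nabla U_0(x)v\le-\lambda(x)|v|^2$ for all $x,v\in\mathbb R^N$; there is $\alpha>0$ with $\sum_{i,j=1}^N|\partial_j\partial_iU_0(x)|\le\alpha\lambda(x)$ for all $x$; and there are $\rho\in(0,\tfrac15)$ and $\hat K>0$ such that for all $x\in\mathbb R^N$: $\sum_{k=1}^d\|\nabla V_k(x)\|^2\le\frac{\rho}{N\beta^2}\lambda(x)$, $\sup_k|V_k(x)|\le\hat K$, and $$\sum_{k=1}^d\left(\Big(\sum_{m,m'=1}^N|\partial_m\partial_{m'}V_k(x)|^2\Big)^{1/2}+\alpha\|\nabla V_k(x)\|\right)\le\frac{\rho}{\hat K\beta^2}\lambda(x).$$ Let $\{Z^\delta_{t_n}\}_{n\in\mathbb N}$ be the split-step Euler approximation of $x_t$. Then there exists a constant $C>0$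 (independent of $f$, $x$, $\delta$) such that $$\sup_{n\in\mathbb N}\left|\mathbb E_x[f(x_{t_n})]-\mathbb E_x[f(Z^\delta_{t_n})]\right|\le C\,\|f\|_{\mathcal C^2_b}\,\delta^{1/2}\left(1+|x|^{2q+2}\right)$$ for every $x\in\mathbb R^N$, $f\in\mathcal C^2_b(\mathbb R^N)$ and every $\delta>0$ small enough (i.e. all $\delta\in(0,\delta_0)$ for some $\delta_0>0$).
   Context: Let $x_t\in\mathbb R^N$ solve the (It\^o) SDE $dx_t=U_0(x_t)\,dt+\sqrt2\sum_{k=1}^d V_k(x_t)\,dB^k_t$, $x_0=x$, where $U_0,V_1,\dots,V_d$ are smooth vector fields on $\mathbb R^N$ and $B^1,\dots,B^d$ are independent one-dimensional standard Brownian motions. The split-step Euler approximation with step $\delta>0$ is defined, with $t_n=n\delta$, by $Z^\delta_0=x$ and $$Z^\star_n=Z^\delta_{t_n}+U_0(Z^\star_n)\,\delta,\qquad Z^\delta_{t_{n+1}}=Z^\star_n+\sqrt2\sum_{k=1}^dV_k(Z^\star_n)\,(B^k_{t_{n+1}}-B^k_{t_n}).$$ For $\delta\in(0,\frac1{2c_0})$ the implicit equation for $Z^\star_n$ has a unique solution. $\mathbb E_x$ is expectation conditional on the process at hand starting at $x$. $\mathcal C^2_b(\mathbb R^N)$ is the space of real-valued twice continuously differentiable functions with bounded first and second derivatives (not necessarily bounded themselves), with seminorm $\|f\|_{\mathcal C^2_b}:=\sup_x(|\nabla f(x)|+\|\nabla^2f(x)\|)$; $\|\cdot\|$ is the Frobenius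 norm on matrices; $\nabla U_0,\nabla V_k$ are Jacobian matrices and $\partial_i\partial_jU_0$, $\partial_m\partial_{m'}V_k$ are componentwise second derivatives (vectors in $\mathbb R^N$). *)

theory Defs
  imports "HOL-Probability.Probability"
begin

section \<open>Derivatives on Euclidean space\<close>

definition partial_der ::
    "'n \<Rightarrow> (real^'n \<Rightarrow> 'b::real_normed_vector) \<Rightarrow> real^'n \<Rightarrow> 'b" where
  "partial_der i f x = frechet_derivative f (at x) (axis i 1)"

primrec C_k :: "nat \<Rightarrow> (real^'n \<Rightarrow> 'b::real_normed_vector) \<Rightarrow> bool" where
  "C_k 0 f \<longleftrightarrow> continuous_on UNIV f"
| "C_k (Suc k) f \<longleftrightarrow> f differentiable_on UNIV \<and> (\<forall>i. C_k k (partial_der i f))"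

definition smooth :: "(real^'n \<Rightarrow> 'b::real_normed_vector) \<Rightarrow> bool" where
  "smooth f \<longleftrightarrow> (\<forall>k. C_k k f)"

definition gradient :: "(real^'n \<Rightarrow> real) \<Rightarrow> real^'n \<Rightarrow> real^'n" where
  "gradient f x = (\<chi> i. partial_der i f x)"

definition hessian :: "(real^'n \<Rightarrow> real) \<Rightarrow> real^'n \<Rightarrow> real^'n^'n" where
  "hessian f x = (\<chi> i j. partial_der i (partial_der j f) x)"

text \<open>On the matrix type \<^typ>\<open>real^'n^'m\<close> the library norm is the Euclidean
  norm of the vector of row norms, that is, the Frobenius norm.  The function itself need not be
  bounded.\<close>

definition C2b :: "(real^'n \<Rightarrow> real) set" where
  "C2b = {f. C_k 2 f \<and> bounded (range (gradient f)) \<and> bounded (range (hessian f))}"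

definition C2b_seminorm :: "(real^'n \<Rightarrow> real) \<Rightarrow> real" where
  "C2b_seminorm f = (SUP x. norm (gradient f x) + norm (hessian f x))"


section \<open>Brownian motion and the stochastic differential equation\<close>

text \<open>A filtration indexed by \<open>[0,\<infinity>)\<close> is regarded as one indexed by all reals, extended by its
  value at 0 to negative times.  Neither completeness nor right-continuity is required.\<close>

definition filtered_prob_space :: "'a measure \<Rightarrow> (real \<Rightarrow> 'a measure) \<Rightarrow> bool" where
  "filtered_prob_space M F \<longleftrightarrow>
     prob_space M \<and> filtration (space M) F \<and> (\<forall>t. subalgebra M (F t))"

text \<open>A family of independent one-dimensional standard Brownian motions relative to the
  filtration: every increment has independent \<open>N(0, t - s)\<close> components and is, as a vector,
  independent of the past \<open>F s\<close>.  \<^const>\<open>normal_density\<close> takes the standard deviation.\<close>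

definition brownian_motions ::
    "'a measure \<Rightarrow> (real \<Rightarrow> 'a measure) \<Rightarrow> ('d::finite \<Rightarrow> real \<Rightarrow> 'a \<Rightarrow> real) \<Rightarrow> bool" where
  "brownian_motions M F B \<longleftrightarrow>
     (\<forall>k. \<forall>t\<ge>0. B k t \<in> borel_measurable (F t)) \<and>
     (\<forall>k. AE \<omega> in M. B k 0 \<omega> = 0) \<and>
     (\<forall>k. AE \<omega> in M. continuous_on {0..} (\<lambda>t. B k t \<omega>)) \<and>
     (\<forall>s t. 0 \<le> s \<and> s < t \<longrightarrow>
        (\<forall>k. distributed M lborel (\<lambda>\<omega>. B k t \<omega> - B k s \<omega>)
               (\<lambda>z. ennreal (normal_density 0 (sqrt (t - s)) z))) \<and>
        prob_space.indep_vars M (\<lambda>_. borel) (\<lambda>k \<omega>. B k t \<omega> - B k s \<omega>) UNIV \<and>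
        prob_space.indep_set M (sets (F s))
          {(\<lambda>\<omega>. \<chi> k. B k t \<omega> - B k s \<omega>) -` A \<inter> space M | A. A \<in> sets (borel :: (real^'d) measure)})"

definition progressive ::
    "(real \<Rightarrow> 'a measure) \<Rightarrow> (real \<Rightarrow> 'a \<Rightarrow> 'b::topological_space) \<Rightarrow> bool" where
  "progressive F H \<longleftrightarrow>
     (\<forall>t\<ge>0. (\<lambda>(s, \<omega>). H s \<omega>) \<in> borel_measurable (restrict_space borel {0..t} \<Otimes>\<^sub>M F t))"

text \<open>Simple integrands \<open>\<Sum>\<^sub>i\<^sub><\<^sub>n \<xi>\<^sub>i 1\<^bsub>(\<tau>\<^sub>i, \<tau>\<^sub>i\<^sub>+\<^sub>1]\<^esub>\<close> on \<open>[0,T]\<close>, with bounded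
  \<open>F \<tau>\<^sub>i\<close>-measurable coefficients.\<close>

definition simple_integrand ::
    "'a measure \<Rightarrow> (real \<Rightarrow> 'a measure) \<Rightarrow> real \<Rightarrow> nat \<Rightarrow> (nat \<Rightarrow> real) \<Rightarrow>
     (nat \<Rightarrow> 'a \<Rightarrow> 'b::euclidean_space) \<Rightarrow> bool" where
  "simple_integrand M F T n \<tau> \<xi> \<longleftrightarrow>
     0 \<le> \<tau> 0 \<and> \<tau> n \<le> T \<and>
     (\<forall>i<n. \<tau> i < \<tau> (Suc i) \<and> \<xi> i \<in> borel_measurable (F (\<tau> i)) \<and> bounded (\<xi> i ` space M))"

definition simple_process ::
    "nat \<Rightarrow> (nat \<Rightarrow> real) \<Rightarrow> (nat \<Rightarrow> 'a \<Rightarrow> 'b::euclidean_space) \<Rightarrow> real \<Rightarrow> 'a \<Rightarrow> 'b" where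
  "simple_process n \<tau> \<xi> s \<omega> = (\<Sum>i<n. indicator {\<tau> i <.. \<tau> (Suc i)} s *\<^sub>R \<xi> i \<omega>)"

definition simple_ito_integral ::
    "(real \<Rightarrow> 'a \<Rightarrow> real) \<Rightarrow> nat \<Rightarrow> (nat \<Rightarrow> real) \<Rightarrow> (nat \<Rightarrow> 'a \<Rightarrow> 'b::euclidean_space) \<Rightarrow> 'a \<Rightarrow> 'b" where
  "simple_ito_integral W n \<tau> \<xi> \<omega> = (\<Sum>i<n. (W (\<tau> (Suc i)) \<omega> - W (\<tau> i) \<omega>) *\<^sub>R \<xi> i \<omega>)"

text \<open>\<open>J\<close> is a version of the Ito integral of \<open>H\<close> against \<open>W\<close> over \<open>[0,T]\<close>: the
  \<open>L\<^sup>2(P)\<close>-limit of the integrals of simple processes converging to \<open>H\<close> in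
  \<open>L\<^sup>2(dt \<otimes> P)\<close>.  By the Ito isometry \<open>J\<close> is almost surely unique.  This is the integral
  for square-integrable integrands; it covers every integrand with bounded values.\<close>

definition is_ito_integral ::
    "'a measure \<Rightarrow> (real \<Rightarrow> 'a measure) \<Rightarrow> (real \<Rightarrow> 'a \<Rightarrow> real) \<Rightarrow> real \<Rightarrow>
     (real \<Rightarrow> 'a \<Rightarrow> 'b::euclidean_space) \<Rightarrow> ('a \<Rightarrow> 'b) \<Rightarrow> bool" where
  "is_ito_integral M F W T H J \<longleftrightarrow>
     progressive F H \<and> J \<in> borel_measurable M \<and>
     (\<exists>n \<tau> \<xi>.
        (\<forall>m::nat. simple_integrand M F T (n m) (\<tau> m) (\<xi> m)) \<and>
        (\<lambda>m. \<integral>\<^sup>+\<omega>. (\<integral>\<^sup>+s\<in>{0..T}.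
            ennreal ((norm (H s \<omega> - simple_process (n m) (\<tau> m) (\<xi> m) s \<omega>))\<^sup>2) \<partial>lborel) \<partial>M)
          \<longlonglongrightarrow> 0 \<and>
        (\<lambda>m. \<integral>\<^sup>+\<omega>. ennreal ((norm (J \<omega> - simple_ito_integral W (n m) (\<tau> m) (\<xi> m) \<omega>))\<^sup>2) \<partial>M)
          \<longlonglongrightarrow> 0)"

text \<open>Solutions, started at \<open>x\<close>, of \<open>dx\<^sub>t = U(x\<^sub>t) dt + \<surd>2 \<Sum>\<^sub>k V\<^sub>k(x\<^sub>t) dB\<^sup>k\<^sub>t\<close>.\<close>

definition sde_solution ::
    "'a measure \<Rightarrow> (real \<Rightarrow> 'a measure) \<Rightarrow> ('d::finite \<Rightarrow> real \<Rightarrow> 'a \<Rightarrow> real) \<Rightarrow>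
     ('b::euclidean_space \<Rightarrow> 'b) \<Rightarrow> ('d \<Rightarrow> 'b \<Rightarrow> 'b) \<Rightarrow> 'b \<Rightarrow> (real \<Rightarrow> 'a \<Rightarrow> 'b) \<Rightarrow> bool" where
  "sde_solution M F B U V x X \<longleftrightarrow>
     progressive F X \<and>
     (AE \<omega> in M. continuous_on {0..} (\<lambda>t. X t \<omega>)) \<and>
     (AE \<omega> in M. X 0 \<omega> = x) \<and>
     (\<forall>t\<ge>0. \<exists>J.
        (\<forall>k. is_ito_integral M F (B k) t (\<lambda>s \<omega>. V k (X s \<omega>)) (J k)) \<and>
        (AE \<omega> in M. X t \<omega> =
           x + (LINT s:{0..t}|lborel. U (X s \<omega>)) + sqrt 2 *\<^sub>R (\<Sum>k\<in>UNIV. J k \<omega>)))"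


section \<open>The split-step Euler approximation\<close>

definition implicit_step :: "('b::euclidean_space \<Rightarrow> 'b) \<Rightarrow> real \<Rightarrow> 'b \<Rightarrow> 'b" where
  "implicit_step U \<delta> z = (THE y. y = z + \<delta> *\<^sub>R U y)"

text \<open>\<open>split_step_euler U V B \<delta> x n\<close> is \<open>Z\<^sup>\<delta>\<close> at time \<open>t\<^sub>n = n \<delta>\<close>.\<close>

primrec split_step_euler ::
    "('b::euclidean_space \<Rightarrow> 'b) \<Rightarrow> ('d::finite \<Rightarrow> 'b \<Rightarrow> 'b) \<Rightarrow> ('d \<Rightarrow> real \<Rightarrow> 'a \<Rightarrow> real) \<Rightarrow>
     real \<Rightarrow> 'b \<Rightarrow> nat \<Rightarrow> 'a \<Rightarrow> 'b" where
  "split_step_euler U V B \<delta> x 0 \<omega> = x"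
| "split_step_euler U V B \<delta> x (Suc n) \<omega> =
     (let y = implicit_step U \<delta> (split_step_euler U V B \<delta> x n \<omega>)
      in y + sqrt 2 *\<^sub>R
           (\<Sum>k\<in>UNIV. (B k (real (Suc n) * \<delta>) \<omega> - B k (real n * \<delta>) \<omega>) *\<^sub>R V k y))"


section \<open>Assumptions on the coefficients\<close>

definition condition_A ::
    "(real^'n \<Rightarrow> real^'n) \<Rightarrow> ('d::finite \<Rightarrow> real^'n \<Rightarrow> real^'n) \<Rightarrow>
     real \<Rightarrow> real \<Rightarrow> real \<Rightarrow> real \<Rightarrow> real \<Rightarrow> real \<Rightarrow> real \<Rightarrow> bool" where
  "condition_A U V c\<^sub>0 c\<^sub>1 c\<^sub>2 q K b\<^sub>0 b\<^sub>1 \<longleftrightarrow>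
     c\<^sub>0 > 0 \<and> c\<^sub>1 > 0 \<and> c\<^sub>2 > 0 \<and> q > 0 \<and> K > 0 \<and> b\<^sub>0 > 0 \<and> b\<^sub>1 \<ge> 0 \<and>
     (\<forall>x y. (\<Sum>k\<in>UNIV. norm (V k x - V k y)) \<le> c\<^sub>1 * norm (x - y)) \<and>
     (\<forall>x. (\<Sum>k\<in>UNIV. (norm (V k x))\<^sup>2) \<le> K) \<and>
     (\<forall>x. U x \<bullet> x \<le> - b\<^sub>0 * (norm x)\<^sup>2 + b\<^sub>1) \<and>
     (\<forall>x y. (U x - U y) \<bullet> (x - y) \<le> c\<^sub>0 * (norm (x - y))\<^sup>2) \<and>
     (\<forall>x y. (norm (U x - U y))\<^sup>2
        \<le> c\<^sub>2 * (1 + norm x powr (2 * q) + norm y powr (2 * q)) * (norm (x - y))\<^sup>2)"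

definition condition_B ::
    "(real^'n \<Rightarrow> real^'n) \<Rightarrow> ('d::finite \<Rightarrow> real^'n \<Rightarrow> real^'n) \<Rightarrow>
     real \<Rightarrow> (real^'n \<Rightarrow> real) \<Rightarrow> real \<Rightarrow> real \<Rightarrow> real \<Rightarrow> bool" where
  "condition_B U V \<beta> lam \<alpha> \<rho> K' \<longleftrightarrow>
     \<beta> \<ge> 1 \<and> (\<forall>x. lam x > 0) \<and> (INF x. lam x) > 0 \<and>
     (\<forall>x v. - \<beta> * lam x * (norm v)\<^sup>2 \<le> v \<bullet> (jacobian U (at x) *v v) \<and>
            v \<bullet> (jacobian U (at x) *v v) \<le> - lam x * (norm v)\<^sup>2) \<and>
     \<alpha> > 0 \<and>
     (\<forall>x. (\<Sum>i\<in>UNIV. \<Sum>j\<in>UNIV. norm (partial_der j (partial_der i U) x)) \<le> \<alpha> * lam x) \<and>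
     0 < \<rho> \<and> \<rho> < 1 / 5 \<and> K' > 0 \<and>
     (\<forall>x. (\<Sum>k\<in>UNIV. (norm (jacobian (V k) (at x)))\<^sup>2) \<le> \<rho> / (real CARD('n) * \<beta>\<^sup>2) * lam x) \<and>
     (\<forall>x k. norm (V k x) \<le> K') \<and>
     (\<forall>x. (\<Sum>k\<in>UNIV.
            sqrt (\<Sum>m\<in>UNIV. \<Sum>m'\<in>UNIV. (norm (partial_der m (partial_der m' (V k)) x))\<^sup>2)
            + \<alpha> * norm (jacobian (V k) (at x)))
          \<le> \<rho> / (K' * \<beta>\<^sup>2) * lam x)"

end

theory Submission
  imports Defs
begin

text \<open>The functions \<open>f\<close> are Lipschitz with constant \<open>C2b_seminorm f\<close>, so it is
  enough to bound the strong error in mean square by \<open>\<delta>\<close>, uniformly in time.  Condition (B)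
  makes the dynamics contractive in mean square: with \<open>D x y = - \<langle>U x - U y, x - y\<rangle>\<close> the mean
  value theorem gives \<open>D x y \<ge> l \<bar>x - y\<bar>\<^sup>2\<close> and
  \<open>\<Sum>\<^sub>k \<bar>V\<^sub>k x - V\<^sub>k y\<bar>\<^sup>2 \<le> D x y / 5\<close>.  The split-step scheme becomes explicit in the variable
  \<open>y - \<delta> U y\<close>.  In this variable the squared error decreases in one step by a factor
  \<open>1 - l \<delta> / 4\<close>, up to local errors of order \<open>\<delta>\<^sup>2\<close>, and these sum up to \<open>O(\<delta>)\<close>.

  The local errors need moments of the solution that are bounded in time.  No Ito formula is
  required: given the continuous noise path \<open>y\<close>, the difference \<open>z = X - y\<close> solves the ordinary
  differential equation \<open>z' = U (z + y)\<close>, whose solutions are damped by monotonicity.  As the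
  diffusion coefficients are bounded, the increments of the noise are sub-Gaussian.\<close>

section \<open>Analytic preliminaries\<close>

text \<open>The balance of constants is decided within one step. In the variable
  \<open>y - \<delta> U y\<close> a surplus \<open>2 \<delta> D\<close> stands beside the squared
  error. The factor \<open>sqrt 2\<close> and the bound \<open>D / 5\<close> give the coupled noise
  the mean square \<open>2/5 \<delta> D\<close>, doubled to \<open>4/5 \<delta> D\<close> when the
  local noise error is split off; what is left of the surplus pays for the contraction. The two
  local errors differ in kind. Freezing the diffusion costs order \<delta>^2 in mean square, but
  this part is orthogonal to the past and adds no cross term. Freezing the drift is not orthogonal;
  it has order \<delta>^3, so that the weight 1/\<delta> in Young's inequality still leaves
  \<delta>^2. It requires fourth moments of \<open>U\<close>, hence the power 4q+4 of
  \<open>1 + norm x\<close>, which the final square root turns into 2q+2. The obstacle on the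
  probabilistic side is that an Ito integral is given only as an L^2 limit of simple integrals:
  isometry, orthogonality and higher moments are proved for finite sums of increments and then
  passed to the limit.\<close>

lemma
  fixes U :: "'b::euclidean_space \<Rightarrow> 'b"
  assumes cont: "continuous_on UNIV U"
    and mono: "\<And>x y. (U x - U y) \<bullet> (x - y) \<le> 0" and "\<delta> \<ge> 0"
  shows implicit_step_eq: "implicit_step U \<delta> z = z + \<delta> *\<^sub>R U (implicit_step U \<delta> z)"
    and implicit_step_nonexpansive:
      "norm (implicit_step U \<delta> z - implicit_step U \<delta> z') \<le> norm (z - z')"
proof -
  \<comment> \<open>The implicit equation is \<open>g y = z\<close>. Monotonicity makes
    \<open>g\<close> expand distances, hence injective. Surjectivity is topological: the range is
    open by invariance of domain, closed by expansion and nonempty, so it is the whole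
    space.\<close>
  define g where "g y = y - \<delta> *\<^sub>R U y" for y
  have expand: "norm (x - y) \<le> norm (g x - g y)" for x y
  proof -
    have g: "g x - g y = (x - y) - \<delta> *\<^sub>R (U x - U y)"
      by (simp add: g_def scaleR_diff_right)
    have "norm (x - y) * norm (x - y) = (x - y) \<bullet> (x - y)"
      by (simp only: dot_square_norm power2_eq_square)
    also have "\<dots> \<le> (x - y) \<bullet> (x - y) - \<delta> * ((U x - U y) \<bullet> (x - y))"
      using mono[of x y] \<open>\<delta> \<ge> 0\<close> by (simp add: mult_nonneg_nonpos)
    also have "\<dots> = (g x - g y) \<bullet> (x - y)"
      unfolding g by (simp only: inner_diff_left[of "x - y"] inner_scaleR_left)
    also have "\<dots> \<le> norm (g x - g y) * norm (x - y)"
      by (rule norm_cauchy_schwarz)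
    finally have "norm (x - y) * norm (x - y) \<le> norm (g x - g y) * norm (x - y)" .
    then show ?thesis
      by (cases "x = y") (simp_all only: diff_self norm_zero norm_ge_zero mult_le_cancel_right_pos zero_less_norm_iff right_minus_eq not_False_eq_True)
  qed
  have inj: "inj g"
  proof (rule injI)
    fix x y assume "g x = g y"
    then show "x = y" using expand[of x y] by simp
  qed
  have gcont: "continuous_on UNIV g"
    unfolding g_def by (intro continuous_intros cont)
  have "open (range g)"
    by (rule invariance_of_domain[OF gcont open_UNIV inj])
  moreover have "closed (range g)"
  proof -
    \<comment> \<open>Expansion turns the preimages of a convergent sequence into a Cauchy sequence,
      whose limit is mapped to \<open>w\<close>.\<close>
    have "w \<in> range g" if s: "\<And>n. s n \<in> range g" "s \<longlonglongrightarrow> w" for s w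
    proof -
      have "\<forall>n. \<exists>a. s n = g a"
        using s(1) by blast
      then obtain t where "\<forall>n. s n = g (t n)"
        by (rule choice[THEN exE])
      then have t: "s = (\<lambda>n. g (t n))"
        by blast
      have "Cauchy s"
        using s(2) LIMSEQ_imp_Cauchy by blast
      then have "Cauchy t"
        unfolding Cauchy_def dist_norm t by (meson expand le_less_trans)
      then obtain a where "t \<longlonglongrightarrow> a"
        using Cauchy_convergent_iff convergent_def by blast
      moreover have "isCont g a"
        using gcont by (simp add: continuous_on_eq_continuous_at)
      ultimately have "s \<longlonglongrightarrow> g a"
        unfolding t by (rule isCont_tendsto_compose[rotated])
      with s(2) have "w = g a"
        using LIMSEQ_unique by blast
      then show ?thesis by simp
    qed
    then show ?thesis
      unfolding closed_sequential_limits by blast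
  qed
  ultimately have "range g = UNIV"
    using clopen[of "range g"] by auto
  then have ex1: "\<exists>!y. y = z + \<delta> *\<^sub>R U y" for z
  proof -
    obtain y where "g y = z"
      using \<open>range g = UNIV\<close> by (metis UNIV_I imageE)
    then have "y = z + \<delta> *\<^sub>R U y"
      unfolding g_def diff_eq_eq .
    moreover have "y' = y" if "y' = z + \<delta> *\<^sub>R U y'" for y'
    proof -
      have "g y' = z"
        unfolding g_def diff_eq_eq by (rule that)
      with \<open>g y = z\<close> show ?thesis
        using injD[OF inj, of y' y] by simp
    qed
    ultimately show ?thesis by (rule ex1I)
  qed
  have eq: "implicit_step U \<delta> z = z + \<delta> *\<^sub>R U (implicit_step U \<delta> z)" for z
    unfolding implicit_step_def by (rule theI') (rule ex1)
  then show "implicit_step U \<delta> z = z + \<delta> *\<^sub>R U (implicit_step U \<delta> z)" .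
  have "g (implicit_step U \<delta> z) = z" for z
  proof -
    have "g y = z" if "y = z + \<delta> *\<^sub>R U y" for y
      unfolding g_def diff_eq_eq by (rule that)
    then show ?thesis using eq by blast
  qed
  then show "norm (implicit_step U \<delta> z - implicit_step U \<delta> z') \<le> norm (z - z')"
    using expand[of "implicit_step U \<delta> z" "implicit_step U \<delta> z'"] by simp
qed

text \<open>With \<open>R\<close> of the size of the typical value of \<open>a\<close>, a moment of
  order \<open>R ^ m\<close> yields a moment of real order \<open>p\<close> of size
  \<open>R powr p\<close>. The reason is t^p <= 1 + t^m for t = a / R, by cases at t = 1; this takes
  the place of Jensen's inequality.\<close>

lemma powr_le_normalized_even_power:
  fixes a R p :: real
  assumes "a \<ge> 0" "R > 0" "0 \<le> p" "p \<le> real m"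
  shows "a powr p \<le> R powr p * (1 + (a / R) ^ m)"
proof -
  have "(a / R) powr p \<le> 1 + (a / R) ^ m"
  proof (cases "a / R \<le> 1")
    case True
    then have "(a / R) powr p \<le> 1"
      using assms by (intro powr_le1) auto
    moreover have "0 \<le> (a / R) ^ m"
      using assms by simp
    ultimately show ?thesis by linarith
  next
    case False
    then have "(a / R) powr p \<le> (a / R) powr real m"
      using assms by (intro powr_mono) auto
    also have "\<dots> = (a / R) ^ m"
      using False by (simp add: powr_realpow)
    finally show ?thesis by simp
  qed
  moreover have "a powr p = R powr p * (a / R) powr p"
    using assms by (simp add: powr_divide)
  ultimately show ?thesis
    using powr_ge_zero[of R p] by (simp add: mult_left_mono)
qed

text \<open>The factor in front of \<open>a ^ k\<close> can be brought as near to 1 as desired, so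
  that adding the noise does not destroy the exponential damping of the drift part.\<close>

lemma power_add_le_eps:
  fixes e :: real
  assumes "e > 0" "k > 0"
  obtains C where "C > 0" "\<And>a b::real. a \<ge> 0 \<Longrightarrow> b \<ge> 0 \<Longrightarrow> (a + b) ^ k \<le> (1 + e) * a ^ k + C * b ^ k"
proof
  \<comment> \<open>\<open>h\<close> is the relative size of \<open>b\<close> that the factor
    \<open>1 + e\<close> tolerates. A larger \<open>b\<close> dominates \<open>a\<close>, which is
    then at most \<open>b / h\<close>.\<close>
  define h where "h = root k (1 + e) - 1"
  have hk: "(1 + h) ^ k = 1 + e"
    using assms by (simp add: h_def)
  have "h > 0"
    using assms by (simp add: h_def)
  show "(1 + 1 / h) ^ k > 0"
    using \<open>h > 0\<close> by (simp add: add_pos_pos)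
  fix a b :: real assume ab: "a \<ge> 0" "b \<ge> 0"
  show "(a + b) ^ k \<le> (1 + e) * a ^ k + (1 + 1 / h) ^ k * b ^ k"
  proof (cases "b \<le> h * a")
    case True
    have "(a + b) ^ k \<le> ((1 + h) * a) ^ k"
      using True ab by (intro power_mono) (auto simp: algebra_simps)
    then have "(a + b) ^ k \<le> (1 + e) * a ^ k"
      by (simp only: power_mult_distrib hk)
    moreover have "0 \<le> (1 + 1 / h) ^ k * b ^ k"
      using ab \<open>h > 0\<close> by simp
    ultimately show ?thesis by linarith
  next
    case False
    then have "a \<le> b / h"
      using \<open>h > 0\<close> by (simp add: field_simps)
    then have "(a + b) ^ k \<le> ((1 + 1 / h) * b) ^ k"
      using ab by (intro power_mono) (auto simp: algebra_simps)
    then have "(a + b) ^ k \<le> (1 + 1 / h) ^ k * b ^ k"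
      by (simp only: power_mult_distrib)
    moreover have "0 \<le> (1 + e) * a ^ k"
      using ab \<open>e > 0\<close> by simp
    ultimately show ?thesis by linarith
  qed
qed

text \<open>Each summand is at most the largest one. Convexity would give a smaller constant, but
  only its finiteness matters.\<close>

lemma sum_power_le_card:
  fixes a :: "'i \<Rightarrow> real"
  assumes "finite A" "A \<noteq> {}" and nonneg: "\<And>i. i \<in> A \<Longrightarrow> 0 \<le> a i"
  shows "(\<Sum>i\<in>A. a i) ^ n \<le> real (card A) ^ n * (\<Sum>i\<in>A. a i ^ n)"
proof -
  define m where "m = Max (a ` A)"
  have "m \<in> a ` A"
    unfolding m_def using assms(1,2) by (intro Max_in) auto
  then obtain j where j: "j \<in> A" "m = a j" by auto
  have "(\<Sum>i\<in>A. a i) \<le> (\<Sum>i\<in>A. m)"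
    unfolding m_def using assms(1) by (intro sum_mono Max_ge) auto
  then have "(\<Sum>i\<in>A. a i) ^ n \<le> (real (card A) * m) ^ n"
    using nonneg by (intro power_mono sum_nonneg) auto
  also have "\<dots> = real (card A) ^ n * a j ^ n"
    by (simp add: power_mult_distrib j)
  also have "\<dots> \<le> real (card A) ^ n * (\<Sum>i\<in>A. a i ^ n)"
    using j nonneg assms(1) by (intro mult_left_mono member_le_sum) auto
  finally show ?thesis .
qed

lemma add_power_le:
  fixes a b :: real
  assumes "0 \<le> a" "0 \<le> b"
  shows "(a + b) ^ n \<le> 2 ^ n * (a ^ n + b ^ n)"
  using sum_power_le_card[of "UNIV :: bool set" "\<lambda>i. if i then a else b" n] assms
  by (simp add: UNIV_bool add.commute)

lemma norm_add_sq_le_eps: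
  fixes a b :: "'a::real_inner"
  assumes "e > 0"
  shows "(norm (a + b))\<^sup>2 \<le> (1 + e) * (norm a)\<^sup>2 + (1 + 1 / e) * (norm b)\<^sup>2"
proof -
  \<comment> \<open>Expanding this square bounds the cross term \<open>2 * (a \<bullet> b)\<close>:
    the factors \<open>sqrt e\<close> and \<open>1 / sqrt e\<close> cancel in it and leave the
    weights \<open>e\<close> and \<open>1 / e\<close> on the squares.\<close>
  have "0 \<le> (norm (sqrt e *\<^sub>R a - (1 / sqrt e) *\<^sub>R b))\<^sup>2" by simp
  also have "\<dots> = e * (norm a)\<^sup>2 - 2 * (a \<bullet> b) + (1 / e) * (norm b)\<^sup>2"
    using assms by (simp add: power2_norm_eq_inner inner_diff inner_commute algebra_simps field_simps)
  finally show ?thesis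
    by (simp add: power2_norm_eq_inner inner_add inner_commute algebra_simps)
qed

lemma norm_add_sq_le: "(norm (a + b))\<^sup>2 \<le> 2 * (norm a)\<^sup>2 + 2 * (norm (b::'a::real_inner))\<^sup>2"
  using norm_add_sq_le_eps[of 1 a b] by simp

lemma norm_sum_sq_le:
  fixes f :: "'i \<Rightarrow> 'b::real_inner"
  assumes "finite A"
  shows "(norm (\<Sum>i\<in>A. f i))\<^sup>2 \<le> real (card A) * (\<Sum>i\<in>A. (norm (f i))\<^sup>2)"
proof -
  have "(norm (\<Sum>i\<in>A. f i))\<^sup>2 \<le> (\<Sum>i\<in>A. norm (f i))\<^sup>2"
    by (intro power_mono norm_sum) simp
  also have "\<dots> \<le> real (card A) * (\<Sum>i\<in>A. (norm (f i))\<^sup>2)"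
    using sum_squared_le_sum_of_squares[of "\<lambda>i. norm (f i)" A] assms by (simp add: mult.commute)
  finally show ?thesis .
qed

text \<open>The derivative-free consequences of (A) and (B) on which all estimates rest.
  \<open>V_le_U\<close> bounds the variation of the diffusion by the dissipation itself: since
  \<open>c\<close> may be large compared with \<open>l\<close>, the Lipschitz bound
  \<open>V_lip\<close> alone would give no contraction. \<open>K\<close> bounds the single fields
  and is later the \<open>K'\<close> of (B). The weights \<open>1 + norm x\<close> are at least 1,
  so powers of them can be enlarged freely.\<close>

locale contractive_coefficients =
  fixes U :: "'b::euclidean_space \<Rightarrow> 'b" and V :: "'d::finite \<Rightarrow> 'b \<Rightarrow> 'b"
    and l c q K :: real
  assumes pos: "l > 0" "c > 0" "q \<ge> 0" "K > 0"
    and U_cont: "continuous_on UNIV U"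
    and U_mono: "(U x - U y) \<bullet> (x - y) \<le> - l * (norm (x - y))\<^sup>2"
    and V_le_U: "(\<Sum>k\<in>UNIV. (norm (V k x - V k y))\<^sup>2) \<le> - (1 / 5) * ((U x - U y) \<bullet> (x - y))"
    and V_lip: "norm (V k x - V k y) \<le> c * norm (x - y)"
    and V_bd: "norm (V k x) \<le> K"
    and U_growth: "norm (U x) \<le> c * (1 + norm x) powr (q + 1)"
    and U_loc: "(norm (U x - U y))\<^sup>2
       \<le> c * ((1 + norm x) powr (2 * q) + (1 + norm y) powr (2 * q)) * (norm (x - y))\<^sup>2"
begin

lemma U_mono0: "(U x - U y) \<bullet> (x - y) \<le> 0"
proof -
  have "0 \<le> l * (norm (x - y))\<^sup>2"
    using pos by simp
  then show ?thesis
    using U_mono[of x y] by linarith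
qed

lemma U_measurable [measurable]: "U \<in> borel_measurable borel"
  by (rule borel_measurable_continuous_onI) (rule U_cont)

lemma V_cont: "continuous_on UNIV (V k)"
proof -
  have "c-lipschitz_on UNIV (V k)"
    using V_lip pos by (auto simp: lipschitz_on_def dist_norm)
  then show ?thesis by (rule lipschitz_on_continuous_on)
qed

lemma V_measurable [measurable]: "V k \<in> borel_measurable borel"
  by (rule borel_measurable_continuous_onI) (rule V_cont)

end

section \<open>From bounds on Jacobians to monotonicity\<close>

lemma matrix_vector_norm_le:
  fixes A :: "real^'n^'m"
  shows "norm (A *v x) \<le> norm A * norm x"
proof -
  have "(norm (A *v x))\<^sup>2 = (\<Sum>i\<in>UNIV. (A $ i \<bullet> x)\<^sup>2)"
    by (simp add: norm_vec_def L2_set_def sum_nonneg matrix_vector_mul_component)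
  also have "\<dots> \<le> (\<Sum>i\<in>UNIV. (norm (A $ i))\<^sup>2 * (norm x)\<^sup>2)"
    by (intro sum_mono) (metis Cauchy_Schwarz_ineq power2_norm_eq_inner)
  also have "\<dots> = (norm A * norm x)\<^sup>2"
    by (simp add: norm_vec_def[of A] L2_set_def sum_nonneg power_mult_distrib sum_distrib_right)
  finally show ?thesis
    by (rule power2_le_imp_le) simp
qed

lemma smooth_has_derivative_jacobian:
  fixes f :: "real^'n \<Rightarrow> real^'m"
  assumes "smooth f"
  shows "(f has_derivative (\<lambda>h. jacobian f (at x) *v h)) (at x)"
proof -
  have "C_k (Suc 0) f"
    using assms unfolding smooth_def by blast
  then have "f differentiable (at x)"
    by (simp add: differentiable_on_def)
  then show ?thesis using jacobian_works by blast
qed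

text \<open>Since \<open>lam\<close> need not be measurable, \<open>lam\<close> is never integrated along the segment: the second
  bound comes from the mean value theorem for
  \<open>t \<mapsto> \<Sum>\<^sub>k 2 \<langle>w\<^sub>k, V\<^sub>k (y + t v)\<rangle> + r \<langle>U (y + t v), v\<rangle>\<close> with \<open>w\<^sub>k = V\<^sub>k x - V\<^sub>k y\<close>.\<close>

lemma monotone_of_jacobian:
  fixes U :: "real^'n \<Rightarrow> real^'n" and V :: "'d::finite \<Rightarrow> real^'n \<Rightarrow> real^'n"
  assumes U: "\<And>x. (U has_derivative (\<lambda>h. JU x *v h)) (at x)"
    and V: "\<And>k x. (V k has_derivative (\<lambda>h. JV k x *v h)) (at x)"
    and JU: "\<And>x v. v \<bullet> (JU x *v v) \<le> - lam x * (norm v)\<^sup>2"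
    and JV: "\<And>x. (\<Sum>k\<in>UNIV. (norm (JV k x))\<^sup>2) \<le> r * lam x"
    and lam: "\<And>x. lam x \<ge> l" and "r \<ge> 0"
  shows "(U x - U y) \<bullet> (x - y) \<le> - l * (norm (x - y))\<^sup>2"
    and "(\<Sum>k\<in>UNIV. (norm (V k x - V k y))\<^sup>2) \<le> - r * ((U x - U y) \<bullet> (x - y))"
proof -
  define v where "v = x - y"
  have vec: "((\<lambda>t::real. y + t *\<^sub>R v) has_derivative (\<lambda>h. h *\<^sub>R v)) (at t)" for t
    by (auto intro!: derivative_eq_intros)
  have dU: "((\<lambda>t. U (y + t *\<^sub>R v)) has_derivative (\<lambda>h. h *\<^sub>R (JU (y + t *\<^sub>R v) *v v))) (at t)" for t :: real
    using has_derivative_compose[OF vec U] by (simp add: matrix_vector_mult_scaleR)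
  have dUr: "((\<lambda>t. U (y + t *\<^sub>R v) \<bullet> v) has_real_derivative ((JU (y + t *\<^sub>R v) *v v) \<bullet> v)) (at t)" for t :: real
    unfolding has_field_derivative_def
    by (rule has_derivative_eq_rhs[OF has_derivative_inner_left[OF dU]]) (auto simp: fun_eq_iff)
  have dV: "((\<lambda>t. V k (y + t *\<^sub>R v)) has_derivative (\<lambda>h. h *\<^sub>R (JV k (y + t *\<^sub>R v) *v v))) (at t)" for t :: real and k
    using has_derivative_compose[OF vec V] by (simp add: matrix_vector_mult_scaleR)
  have dVr: "((\<lambda>t. w \<bullet> V k (y + t *\<^sub>R v)) has_real_derivative (w \<bullet> (JV k (y + t *\<^sub>R v) *v v))) (at t)" for t :: real and k w
    unfolding has_field_derivative_def
    by (rule has_derivative_eq_rhs[OF has_derivative_inner_right[OF dV]]) (auto simp: fun_eq_iff)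
  show "(U x - U y) \<bullet> (x - y) \<le> - l * (norm (x - y))\<^sup>2"
  proof -
    have "\<exists>z::real. 0 < z \<and> z < 1 \<and>
       U (y + 1 *\<^sub>R v) \<bullet> v - U (y + 0 *\<^sub>R v) \<bullet> v = (1 - 0) * ((JU (y + z *\<^sub>R v) *v v) \<bullet> v)"
      by (rule MVT2) (auto intro: dUr)
    then obtain z :: real where "(U x - U y) \<bullet> v = (JU (y + z *\<^sub>R v) *v v) \<bullet> v"
      by (auto simp: v_def inner_diff_left)
    also have "\<dots> \<le> - lam (y + z *\<^sub>R v) * (norm v)\<^sup>2"
      using JU by (simp add: inner_commute)
    also have "\<dots> \<le> - l * (norm v)\<^sup>2"
      using lam by (intro mult_right_mono) auto
    finally show ?thesis by (simp add: v_def)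
  qed
  define w where "w k = V k x - V k y" for k
  let ?g = "\<lambda>t. (\<Sum>k\<in>UNIV. 2 * (w k \<bullet> V k (y + t *\<^sub>R v))) + r * (U (y + t *\<^sub>R v) \<bullet> v)"
  let ?g' = "\<lambda>t. (\<Sum>k\<in>UNIV. 2 * (w k \<bullet> (JV k (y + t *\<^sub>R v) *v v))) + r * ((JU (y + t *\<^sub>R v) *v v) \<bullet> v)"
  have "\<exists>z::real. 0 < z \<and> z < 1 \<and> ?g 1 - ?g 0 = (1 - 0) * ?g' z"
    by (rule MVT2) (auto intro!: DERIV_add DERIV_sum DERIV_cmult dUr dVr)
  then obtain z :: real where z: "?g 1 - ?g 0 = ?g' z" by auto
  \<comment> \<open>The mean value theorem was applied to a single function, so both Jacobians are
    taken at the same point \<open>p\<close> and \<open>lam p\<close> cancels between them.\<close>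
  define p where "p = y + z *\<^sub>R v"
  \<comment> \<open>\<open>?g 1 - ?g 0\<close> contains the sum of the |w_k|^2 twice. Young's
    inequality uses up one copy; the other is the quantity to be estimated.\<close>
  have two: "2 * (a \<bullet> b) \<le> (norm a)\<^sup>2 + (norm b)\<^sup>2" for a b :: "real^'n"
    using norm_cauchy_schwarz[of a b] sum_squares_bound[of "norm a" "norm b"] by linarith
  have "?g' z \<le> (\<Sum>k\<in>UNIV. (norm (w k))\<^sup>2 + (norm (JV k p *v v))\<^sup>2) + r * ((JU p *v v) \<bullet> v)"
    unfolding p_def[symmetric]
    by (intro add_mono sum_mono order_refl two)
  also have "\<dots> = (\<Sum>k\<in>UNIV. (norm (w k))\<^sup>2) + (\<Sum>k\<in>UNIV. (norm (JV k p *v v))\<^sup>2) + r * ((JU p *v v) \<bullet> v)"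
    by (simp add: sum.distrib)
  also have "(\<Sum>k\<in>UNIV. (norm (JV k p *v v))\<^sup>2) \<le> (\<Sum>k\<in>UNIV. (norm (JV k p))\<^sup>2) * (norm v)\<^sup>2"
    unfolding sum_distrib_right
    by (intro sum_mono) (metis matrix_vector_norm_le norm_ge_zero power_mono power_mult_distrib)
  also have "\<dots> \<le> r * lam p * (norm v)\<^sup>2"
    by (intro mult_right_mono JV) simp
  also have "r * ((JU p *v v) \<bullet> v) \<le> r * (- lam p * (norm v)\<^sup>2)"
    using JU[of v p] \<open>r \<ge> 0\<close> by (intro mult_left_mono) (simp_all add: inner_commute)
  finally have "?g' z \<le> (\<Sum>k\<in>UNIV. (norm (w k))\<^sup>2)" by simp
  moreover have "?g 1 - ?g 0 = 2 * (\<Sum>k\<in>UNIV. (norm (w k))\<^sup>2) + r * ((U x - U y) \<bullet> v)"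
  proof -
    have "(\<Sum>k\<in>UNIV. 2 * (w k \<bullet> V k x)) - (\<Sum>k\<in>UNIV. 2 * (w k \<bullet> V k y)) = 2 * (\<Sum>k\<in>UNIV. (norm (w k))\<^sup>2)"
      unfolding sum_subtractf[symmetric] sum_distrib_left
      by (intro sum.cong refl) (simp add: w_def power2_norm_eq_inner inner_diff_right right_diff_distrib)
    then show ?thesis
      by (simp add: v_def inner_diff_left algebra_simps)
  qed
  ultimately show "(\<Sum>k\<in>UNIV. (norm (V k x - V k y))\<^sup>2) \<le> - r * ((U x - U y) \<bullet> (x - y))"
    using z by (simp add: w_def v_def)
qed

section \<open>Brownian increments\<close>

lemma Int_stable_vimage_sets: "Int_stable {f -` A \<inter> \<Omega> | A. A \<in> sets N}"
proof (rule Int_stableI)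
  fix a b assume "a \<in> {f -` A \<inter> \<Omega> | A. A \<in> sets N}" "b \<in> {f -` A \<inter> \<Omega> | A. A \<in> sets N}"
  then obtain A A' where "a = f -` A \<inter> \<Omega>" "A \<in> sets N" "b = f -` A' \<inter> \<Omega>" "A' \<in> sets N"
    by auto
  then have "a \<inter> b = f -` (A \<inter> A') \<inter> \<Omega> \<and> A \<inter> A' \<in> sets N" by auto
  then show "a \<inter> b \<in> {f -` A \<inter> \<Omega> | A. A \<in> sets N}" by blast
qed

locale brownian_setting = prob_space M
  for M :: "'a measure" and F :: "real \<Rightarrow> 'a measure" and B :: "'d::finite \<Rightarrow> real \<Rightarrow> 'a \<Rightarrow> real" +
  assumes filtered: "filtered_prob_space M F" and brownian: "brownian_motions M F B"
begin

lemma space_F [simp]: "space (F t) = space M"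
  using filtered by (simp add: filtered_prob_space_def subalgebra_def)

lemma sets_F_le: "sets (F t) \<subseteq> sets M"
  using filtered by (simp add: filtered_prob_space_def subalgebra_def)

lemma sets_F_mono: "s \<le> t \<Longrightarrow> sets (F s) \<subseteq> sets (F t)"
  using filtered filtration.sets_F_mono[of "space M" F s t] by (simp add: filtered_prob_space_def)

lemma measurable_F_mono: "f \<in> measurable (F s) N \<Longrightarrow> s \<le> t \<Longrightarrow> f \<in> measurable (F t) N"
  by (rule measurable_from_subalg[of "F t" "F s"]) (simp_all add: subalgebra_def sets_F_mono)

lemma measurable_F_M: "f \<in> measurable (F s) N \<Longrightarrow> f \<in> measurable M N"
  by (rule measurable_from_subalg[of M "F s"]) (simp_all add: subalgebra_def sets_F_le)

lemma B_measurable_F: "0 \<le> s \<Longrightarrow> s \<le> t \<Longrightarrow> B k s \<in> borel_measurable (F t)"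
  by (rule measurable_F_mono[of _ s]) (use brownian in \<open>simp_all add: brownian_motions_def\<close>)

lemma B_measurable [measurable (raw)]: "0 \<le> s \<Longrightarrow> B k s \<in> borel_measurable M"
  by (rule measurable_F_M) (rule B_measurable_F, auto)

definition dB :: "'d \<Rightarrow> real \<Rightarrow> real \<Rightarrow> 'a \<Rightarrow> real" where
  "dB k s t \<omega> = B k t \<omega> - B k s \<omega>"

lemma dB_measurable_F: "0 \<le> s \<Longrightarrow> s \<le> t \<Longrightarrow> t \<le> u \<Longrightarrow> dB k s t \<in> borel_measurable (F u)"
  unfolding dB_def by (intro borel_measurable_diff B_measurable_F) auto

lemma dB_measurable [measurable (raw)]: "0 \<le> s \<Longrightarrow> 0 \<le> t \<Longrightarrow> dB k s t \<in> borel_measurable M"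
  unfolding dB_def by measurable

lemma dB_same [simp]: "dB k s s \<omega> = 0"
  by (simp add: dB_def)

lemma brownian_increments:
  assumes "0 \<le> s" "s < t"
  shows "distributed M lborel (dB k s t) (\<lambda>z. ennreal (normal_density 0 (sqrt (t - s)) z))"
    and "indep_vars (\<lambda>_. borel) (\<lambda>k. dB k s t) UNIV"
    and "indep_set (sets (F s))
      {(\<lambda>\<omega>. \<chi> k. dB k s t \<omega>) -` A \<inter> space M | A. A \<in> sets (borel :: (real^'d) measure)}"
proof -
  note st = brownian[unfolded brownian_motions_def, THEN conjunct2, THEN conjunct2, THEN conjunct2,
    THEN spec[of _ s], THEN spec[of _ t], THEN mp, OF conjI, OF assms]
  show "distributed M lborel (dB k s t) (\<lambda>z. ennreal (normal_density 0 (sqrt (t - s)) z))"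
    unfolding dB_def[abs_def] by (rule st[THEN conjunct1, THEN spec])
  show "indep_vars (\<lambda>_. borel) (\<lambda>k. dB k s t) UNIV"
    unfolding dB_def[abs_def] by (rule st[THEN conjunct2, THEN conjunct1])
  show "indep_set (sets (F s))
      {(\<lambda>\<omega>. \<chi> k. dB k s t \<omega>) -` A \<inter> space M | A. A \<in> sets (borel :: (real^'d) measure)}"
    unfolding dB_def by (rule st[THEN conjunct2, THEN conjunct2])
qed

lemma dB_distributed:
  "0 \<le> s \<Longrightarrow> s < t \<Longrightarrow> distributed M lborel (dB k s t) (\<lambda>z. ennreal (normal_density 0 (sqrt (t - s)) z))"
  by (rule brownian_increments(1))

lemma dB_vector_measurable:
  assumes "0 \<le> s" "0 \<le> t"
  shows "(\<lambda>\<omega>. \<chi> k. dB k s t \<omega>) \<in> borel_measurable M"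
proof (rule borel_measurable_euclidean_space[THEN iffD2], rule ballI)
  fix i :: "real^'d" assume "i \<in> Basis"
  then obtain k where "i = axis k 1" by (auto simp: Basis_vec_def)
  then show "(\<lambda>\<omega>. (\<chi> k. dB k s t \<omega>) \<bullet> i) \<in> borel_measurable M"
    using assms by (simp add: inner_axis dB_measurable)
qed

text \<open>Every later use of independence goes through this fact. The preimages under
  \<open>Y\<close> and under a function of the increments lie in the two families that are
  independent by assumption; subfamilies inherit this, and as they are closed under intersection it
  extends to the sigma-algebras they generate. The increments enter as one vector, so that
  \<open>f\<close> may combine different \<open>k\<close>.\<close>

lemma indep_var_past_increments:
  assumes "0 \<le> s" "s < t" and Y: "Y \<in> measurable (F s) N" and f: "f \<in> measurable borel N'"
  shows "indep_var N Y N' (\<lambda>\<omega>. f (\<chi> k. dB k s t \<omega>))"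
proof -
  let ?D = "\<lambda>\<omega>. \<chi> k. dB k s t \<omega>"
  let ?fD = "\<lambda>\<omega>. f (?D \<omega>)"
  let ?E = "{?D -` A \<inter> space M | A. A \<in> sets (borel :: (real^'d) measure)}"
  have ind: "indep_set (sets (F s)) ?E"
    by (rule brownian_increments(3)) fact+
  have fD: "?fD \<in> measurable M N'"
    using measurable_compose[OF dB_vector_measurable f] assms(1,2) by simp
  have sub1: "{Y -` A \<inter> space M |A. A \<in> sets N} \<subseteq> sets (F s)"
    using measurable_sets[OF Y] by (auto simp del: vimage_Int)
  have sub2: "{?fD -` A \<inter> space M |A. A \<in> sets N'} \<subseteq> ?E"
  proof safe
    fix A assume "A \<in> sets N'"
    then have "f -` A \<in> sets borel"
      using measurable_sets[OF f] by simp
    then show "\<exists>A'. ?fD -` A \<inter> space M = ?D -` A' \<inter> space M \<and> A' \<in> sets borel"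
      by (intro exI[of _ "f -` A"]) auto
  qed
  have "indep_set {Y -` A \<inter> space M |A. A \<in> sets N} {?fD -` A \<inter> space M |A. A \<in> sets N'}"
    unfolding indep_sets2_eq
  proof (intro conjI ballI)
    note i = ind[unfolded indep_sets2_eq]
    show "{Y -` A \<inter> space M |A. A \<in> sets N} \<subseteq> events"
      using sub1 sets_F_le by (rule order_trans)
    show "{?fD -` A \<inter> space M |A. A \<in> sets N'} \<subseteq> events"
      by (rule order_trans[OF sub2 i[THEN conjunct2, THEN conjunct1]])
    fix a b assume a: "a \<in> {Y -` A \<inter> space M |A. A \<in> sets N}"
      and b: "b \<in> {?fD -` A \<inter> space M |A. A \<in> sets N'}"
    show "prob (a \<inter> b) = prob a * prob b"
      by (rule i[THEN conjunct2, THEN conjunct2, THEN bspec, THEN bspec, OF subsetD[OF sub1 a] subsetD[OF sub2 b]])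
  qed
  then have "indep_set (sigma_sets (space M) {Y -` A \<inter> space M |A. A \<in> sets N})
     (sigma_sets (space M) {?fD -` A \<inter> space M |A. A \<in> sets N'})"
    by (rule indep_set_sigma_sets) (rule Int_stable_vimage_sets)+
  then show ?thesis
    unfolding indep_var_eq using measurable_F_M[OF Y] fD by simp
qed

lemma dB_integrable_power: 
  assumes "0 \<le> s" "s \<le> t"
  shows "integrable M (\<lambda>\<omega>. dB k s t \<omega> ^ n)"
proof (cases "s = t")
  case False
  then have st: "s < t" using assms by simp
  have "integrable lborel (\<lambda>z. normal_density 0 (sqrt (t - s)) z * (z - 0) ^ n)"
    using st by (intro integrable_normal_moment) simp
  then show ?thesis
    using distributed_integrable[OF dB_distributed[OF assms(1) st], of "\<lambda>z. z ^ n"] by simp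
qed (simp add: dB_def)

lemma dB_integrable: "0 \<le> s \<Longrightarrow> s \<le> t \<Longrightarrow> integrable M (dB k s t)"
  using dB_integrable_power[of s t k 1] by simp

lemma dB_mean: assumes "0 \<le> s" "s \<le> t" shows "expectation (dB k s t) = 0"
proof (cases "s = t")
  case False
  then have st: "s < t" using assms by simp
  show ?thesis
    using normal_distributed_expectation[OF _ dB_distributed[OF assms(1) st]] st by simp
qed (simp add: dB_def[abs_def])

lemma dB_variance: assumes "0 \<le> s" "s \<le> t" shows "expectation (\<lambda>\<omega>. (dB k s t \<omega>)\<^sup>2) = t - s"
proof (cases "s = t")
  case False
  then have st: "s < t" using assms by simp
  show ?thesis
    using normal_distributed_variance[OF _ dB_distributed[OF assms(1) st]] st
    by (simp add: dB_mean assms)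
qed (simp add: dB_def)

lemma dB_covariance:
  assumes "0 \<le> s" "s \<le> t"
  shows "integrable M (\<lambda>\<omega>. dB k s t \<omega> * dB k' s t \<omega>)"
    and "expectation (\<lambda>\<omega>. dB k s t \<omega> * dB k' s t \<omega>) = (if k = k' then t - s else 0)"
proof -
  have "integrable M (\<lambda>\<omega>. dB k s t \<omega> * dB k' s t \<omega>) \<and>
    expectation (\<lambda>\<omega>. dB k s t \<omega> * dB k' s t \<omega>) = (if k = k' then t - s else 0)"
  proof (cases "s = t \<or> k = k'")
    case True
    then show ?thesis
      using dB_integrable_power[OF assms, of k 2] dB_variance[OF assms, of k]
      by (auto simp: power2_eq_square)
  next
    case False
    then have st: "s < t" "k \<noteq> k'" using assms by auto
    have "indep_vars (\<lambda>_. borel) (\<lambda>k. dB k s t) UNIV"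
      by (rule brownian_increments(2)) (use assms st in auto)
    then have "indep_vars (\<lambda>_. borel) (\<lambda>k. dB k s t) {k, k'}"
      by (rule indep_vars_subset) simp
    then show ?thesis
      using indep_vars_integrable[of "{k, k'}" "\<lambda>k. dB k s t"]
        indep_vars_lebesgue_integral[of "{k, k'}" "\<lambda>k. dB k s t"] st(2)
      by (simp add: dB_integrable dB_mean assms)
  qed
  then show "integrable M (\<lambda>\<omega>. dB k s t \<omega> * dB k' s t \<omega>)"
    and "expectation (\<lambda>\<omega>. dB k s t \<omega> * dB k' s t \<omega>) = (if k = k' then t - s else 0)" by auto
qed

lemma
  fixes Y :: "'a \<Rightarrow> real"
  assumes "0 \<le> s" "s \<le> t" and Y: "Y \<in> borel_measurable (F s)" "integrable M Y"
  shows past_times_dB_integrable: "integrable M (\<lambda>\<omega>. Y \<omega> * dB k s t \<omega>)"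
    and past_times_dB_mean: "expectation (\<lambda>\<omega>. Y \<omega> * dB k s t \<omega>) = 0"
    and past_times_dB_dB_integrable: "integrable M (\<lambda>\<omega>. Y \<omega> * (dB k s t \<omega> * dB k' s t \<omega>))"
    and past_times_dB_dB_mean: "expectation (\<lambda>\<omega>. Y \<omega> * (dB k s t \<omega> * dB k' s t \<omega>)) =
      (if k = k' then (t - s) * expectation Y else 0)"
proof -
  have "integrable M (\<lambda>\<omega>. Y \<omega> * dB k s t \<omega>) \<and> expectation (\<lambda>\<omega>. Y \<omega> * dB k s t \<omega>) = 0 \<and>
    integrable M (\<lambda>\<omega>. Y \<omega> * (dB k s t \<omega> * dB k' s t \<omega>)) \<and>
    expectation (\<lambda>\<omega>. Y \<omega> * (dB k s t \<omega> * dB k' s t \<omega>)) = (if k = k' then (t - s) * expectation Y else 0)"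
  proof (cases "s = t")
    case False
    then have st: "s < t" using assms by simp
    have 1: "indep_var borel Y borel (dB k s t)"
      using indep_var_past_increments[OF assms(1) st Y(1), of "\<lambda>v. v $ k" borel] by simp
    have 2: "indep_var borel Y borel (\<lambda>\<omega>. dB k s t \<omega> * dB k' s t \<omega>)"
      using indep_var_past_increments[OF assms(1) st Y(1), of "\<lambda>v. v $ k * v $ k'" borel] by simp
    show ?thesis
      using indep_var_integrable[OF 1] indep_var_integrable[OF 2]
        indep_var_lebesgue_integral[OF 1] indep_var_lebesgue_integral[OF 2]
      by (auto simp: Y dB_integrable dB_mean assms dB_covariance)
  qed simp
  then show "integrable M (\<lambda>\<omega>. Y \<omega> * dB k s t \<omega>)" "expectation (\<lambda>\<omega>. Y \<omega> * dB k s t \<omega>) = 0"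
    "integrable M (\<lambda>\<omega>. Y \<omega> * (dB k s t \<omega> * dB k' s t \<omega>))"
    "expectation (\<lambda>\<omega>. Y \<omega> * (dB k s t \<omega> * dB k' s t \<omega>)) = (if k = k' then (t - s) * expectation Y else 0)"
    by auto
qed

section \<open>Exponential moments of one increment\<close>

lemma normal_density_mgf:
  assumes "\<sigma> > 0"
  shows "(\<integral>\<^sup>+z. ennreal (exp (a * z)) * ennreal (normal_density 0 \<sigma> z) \<partial>lborel) = ennreal (exp (a\<^sup>2 * \<sigma>\<^sup>2 / 2))"
proof -
  have "exp (a * z) * normal_density 0 \<sigma> z = exp (a\<^sup>2 * \<sigma>\<^sup>2 / 2) * normal_density (a * \<sigma>\<^sup>2) \<sigma> z" for z
  proof -
    \<comment> \<open>Completing the square: the tilt by \<open>exp (a * z)\<close> moves the mean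
      of the density to \<open>a * \<sigma>\<^sup>2\<close>.\<close>
    have "a * z + - (z - 0)\<^sup>2 / (2 * \<sigma>\<^sup>2) = a\<^sup>2 * \<sigma>\<^sup>2 / 2 + - (z - a * \<sigma>\<^sup>2)\<^sup>2 / (2 * \<sigma>\<^sup>2)"
      using assms by (simp add: field_simps power2_eq_square)
    then have "exp (a * z) * exp (- (z - 0)\<^sup>2 / (2 * \<sigma>\<^sup>2)) = exp (a\<^sup>2 * \<sigma>\<^sup>2 / 2) * exp (- (z - a * \<sigma>\<^sup>2)\<^sup>2 / (2 * \<sigma>\<^sup>2))"
      by (simp only: exp_add[symmetric])
    then show ?thesis
      unfolding normal_density_def by (simp only: mult.left_commute[of _ "1 / sqrt (2 * pi * \<sigma>\<^sup>2)"])
  qed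
  then have "(\<integral>\<^sup>+z. ennreal (exp (a * z)) * ennreal (normal_density 0 \<sigma> z) \<partial>lborel)
    = (\<integral>\<^sup>+z. ennreal (exp (a\<^sup>2 * \<sigma>\<^sup>2 / 2)) * ennreal (normal_density (a * \<sigma>\<^sup>2) \<sigma> z) \<partial>lborel)"
    by (simp only: ennreal_mult[symmetric] exp_ge_zero normal_density_nonneg)
  also have "\<dots> = ennreal (exp (a\<^sup>2 * \<sigma>\<^sup>2 / 2)) * (\<integral>\<^sup>+z. ennreal (normal_density (a * \<sigma>\<^sup>2) \<sigma> z) \<partial>lborel)"
    by (rule nn_integral_cmult) simp
  also have "(\<integral>\<^sup>+z. ennreal (normal_density (a * \<sigma>\<^sup>2) \<sigma> z) \<partial>lborel) = 1"
    using assms integral_normal_density[of \<sigma> "a * \<sigma>\<^sup>2"] integrable_normal_density[of \<sigma> "a * \<sigma>\<^sup>2"]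
    by (subst nn_integral_eq_integral) auto
  finally show ?thesis by simp
qed

text \<open>A conditional Gaussian bound without conditional expectations: by independence the pair
  of \<open>G\<close> and \<open>c\<close> and the increment have a product law, and Fubini's
  theorem integrates the increment out while \<open>c \<omega>\<close> is held fixed. The weight
  \<open>G\<close> will be the exponential of all earlier increments.\<close>

lemma exp_dB_bound:
  assumes "0 \<le> s" "s \<le> t" and G: "G \<in> borel_measurable (F s)" "\<And>\<omega>. G \<omega> \<ge> 0"
    and c: "c \<in> borel_measurable (F s)" "\<And>\<omega>. \<omega> \<in> space M \<Longrightarrow> \<bar>c \<omega>\<bar> \<le> K"
  shows "(\<integral>\<^sup>+\<omega>. ennreal (G \<omega> * exp (c \<omega> * dB k s t \<omega>)) \<partial>M)
    \<le> ennreal (exp (K\<^sup>2 * (t - s) / 2)) * (\<integral>\<^sup>+\<omega>. ennreal (G \<omega>) \<partial>M)"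
proof (cases "s = t")
  case False
  then have st: "s < t" using assms by simp
  let ?Y = "\<lambda>\<omega>. (G \<omega>, c \<omega>)"
  let ?P = "borel \<Otimes>\<^sub>M borel :: (real \<times> real) measure"
  have Y: "?Y \<in> measurable (F s) ?P"
    using G(1) c(1) by measurable
  \<comment> \<open>The zero pads the increment to a pair, because the two variables in
    \<open>indep_var\<close> take values in a common type.\<close>
  let ?D = "\<lambda>\<omega>. (dB k s t \<omega>, 0::real)"
  have iv: "indep_var ?P ?Y ?P ?D"
    using indep_var_past_increments[OF assms(1) st Y, of "\<lambda>v. (v $ k, 0)" ?P] by simp
  have mY [measurable]: "?Y \<in> measurable M ?P" using measurable_F_M[OF Y] .
  have mG [measurable]: "G \<in> borel_measurable M" using measurable_F_M[OF G(1)] .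
  have mD [measurable]: "dB k s t \<in> borel_measurable M" using assms by (intro dB_measurable) auto
  interpret D: prob_space "distr M ?P ?D" by (rule prob_space_distr) measurable
  let ?f = "\<lambda>p::(real \<times> real) \<times> (real \<times> real). ennreal (fst (fst p) * exp (snd (fst p) * fst (snd p)))"
  have "(\<integral>\<^sup>+\<omega>. ennreal (G \<omega> * exp (c \<omega> * dB k s t \<omega>)) \<partial>M)
    = (\<integral>\<^sup>+\<omega>. ?f (?Y \<omega>, ?D \<omega>) \<partial>M)" by simp
  also have "\<dots> = (\<integral>\<^sup>+p. ?f p \<partial>distr M (?P \<Otimes>\<^sub>M ?P) (\<lambda>\<omega>. (?Y \<omega>, ?D \<omega>)))"
    by (rule nn_integral_distr[symmetric]) measurable
  also have "\<dots> = (\<integral>\<^sup>+p. ?f p \<partial>(distr M ?P ?Y \<Otimes>\<^sub>M distr M ?P ?D))"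
    using iv unfolding indep_var_distribution_eq by simp
  also have "\<dots> = (\<integral>\<^sup>+y. \<integral>\<^sup>+z. ?f (y, z) \<partial>distr M ?P ?D \<partial>distr M ?P ?Y)"
    by (rule D.nn_integral_fst[symmetric]) measurable
  also have "\<dots> = (\<integral>\<^sup>+\<omega>. \<integral>\<^sup>+z. ?f (?Y \<omega>, z) \<partial>distr M ?P ?D \<partial>M)"
    by (rule nn_integral_distr) measurable
  also have "\<dots> = (\<integral>\<^sup>+\<omega>. ennreal (G \<omega>) * ennreal (exp ((c \<omega>)\<^sup>2 * (t - s) / 2)) \<partial>M)"
  proof (rule nn_integral_cong)
    fix \<omega>
    have "(\<integral>\<^sup>+z. ?f (?Y \<omega>, z) \<partial>distr M ?P ?D) = (\<integral>\<^sup>+\<omega>'. ennreal (G \<omega> * exp (c \<omega> * dB k s t \<omega>')) \<partial>M)"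
      by (subst nn_integral_distr) simp_all
    also have "\<dots> = (\<integral>\<^sup>+z. ennreal (normal_density 0 (sqrt (t - s)) z) * ennreal (G \<omega> * exp (c \<omega> * z)) \<partial>lborel)"
      by (rule distributed_nn_integral[OF dB_distributed[OF assms(1) st], symmetric]) measurable
    also have "\<dots> = (\<integral>\<^sup>+z. ennreal (G \<omega>) * (ennreal (exp (c \<omega> * z)) * ennreal (normal_density 0 (sqrt (t - s)) z)) \<partial>lborel)"
      using G(2) by (intro nn_integral_cong) (simp add: ennreal_mult mult_ac)
    also have "\<dots> = ennreal (G \<omega>) * ennreal (exp ((c \<omega>)\<^sup>2 * (t - s) / 2))"
      using st by (subst nn_integral_cmult) (auto simp: normal_density_mgf)
    finally show "(\<integral>\<^sup>+z. ?f (?Y \<omega>, z) \<partial>distr M ?P ?D) = \<dots>" .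
  qed
  also have "\<dots> \<le> (\<integral>\<^sup>+\<omega>. ennreal (exp (K\<^sup>2 * (t - s) / 2)) * ennreal (G \<omega>) \<partial>M)"
  proof (rule nn_integral_mono)
    fix \<omega> assume "\<omega> \<in> space M"
    then have "(c \<omega>)\<^sup>2 \<le> K\<^sup>2" using c(2)[of \<omega>] power_mono[of "\<bar>c \<omega>\<bar>" K 2] by simp
    then have "exp ((c \<omega>)\<^sup>2 * (t - s) / 2) \<le> exp (K\<^sup>2 * (t - s) / 2)"
      using st by (simp add: mult_right_mono)
    then show "ennreal (G \<omega>) * ennreal (exp ((c \<omega>)\<^sup>2 * (t - s) / 2)) \<le> ennreal (exp (K\<^sup>2 * (t - s) / 2)) * ennreal (G \<omega>)"
      by (simp add: mult.commute mult_left_mono ennreal_leI)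
  qed
  also have "\<dots> = ennreal (exp (K\<^sup>2 * (t - s) / 2)) * (\<integral>\<^sup>+\<omega>. ennreal (G \<omega>) \<partial>M)"
    by (rule nn_integral_cmult) measurable
  finally show ?thesis .
qed simp

end

section \<open>Elementary stochastic integrals\<close>

text \<open>A list of items \<open>(a, b, \<xi>)\<close> stands for the integrand \<open>\<Sum> 1\<^bsub>(a, b]\<^esub> \<xi>\<close>.  The
  intervals may overlap, which makes sums of integrands into concatenations; the isometry is
  bilinear in the items, so no common refinement of partitions is needed.\<close>

definition elem_proc :: "(real \<times> real \<times> ('a \<Rightarrow> 'b::euclidean_space)) list \<Rightarrow> real \<Rightarrow> 'a \<Rightarrow> 'b" where
  "elem_proc xs r \<omega> = (\<Sum>(a, b, \<xi>)\<leftarrow>xs. indicator {a<..b} r *\<^sub>R \<xi> \<omega>)"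

definition neg_items :: "(real \<times> real \<times> ('a \<Rightarrow> 'b::euclidean_space)) list \<Rightarrow> (real \<times> real \<times> ('a \<Rightarrow> 'b)) list" where
  "neg_items xs = map (\<lambda>(a, b, \<xi>). (a, b, \<lambda>\<omega>. - \<xi> \<omega>)) xs"

lemma elem_proc_simps [simp]:
  "elem_proc [] r \<omega> = 0"
  "elem_proc ((a, b, \<xi>) # xs) r \<omega> = indicator {a<..b} r *\<^sub>R \<xi> \<omega> + elem_proc xs r \<omega>"
  "elem_proc (xs @ ys) r \<omega> = elem_proc xs r \<omega> + elem_proc ys r \<omega>"
  by (simp_all add: elem_proc_def)

lemma elem_proc_neg [simp]: "elem_proc (neg_items xs) r \<omega> = - elem_proc xs r \<omega>"
  by (induction xs) (auto simp: neg_items_def)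

lemma integral_indicator_Ioc_Ioc:
  fixes a b c d :: real
  shows "integrable lborel (\<lambda>r. indicator {a<..b} r * indicator {c<..d} r :: real)"
    and "(\<integral>r. indicator {a<..b} r * indicator {c<..d} r \<partial>lborel) = max 0 (min b d - max a c)"
proof -
  have eq: "(\<lambda>r. indicator {a<..b} r * indicator {c<..d} r :: real) = indicator {max a c<..min b d}"
    by (auto simp: fun_eq_iff indicator_def)
  show "integrable lborel (\<lambda>r. indicator {a<..b} r * indicator {c<..d} r :: real)"
    unfolding eq by (cases "max a c \<le> min b d") (auto simp: integrable_indicator_iff)
  show "(\<integral>r. indicator {a<..b} r * indicator {c<..d} r \<partial>lborel) = max 0 (min b d - max a c)"
    unfolding eq by (cases "max a c \<le> min b d") (auto simp: max_def)
qed

lemma integrable_mult_bounded: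
  fixes g p :: "'a \<Rightarrow> real"
  assumes g: "integrable M g" and p: "p \<in> borel_measurable M" and L: "\<And>\<omega>. \<omega> \<in> space M \<Longrightarrow> \<bar>p \<omega>\<bar> \<le> L"
  shows "integrable M (\<lambda>\<omega>. g \<omega> * p \<omega>)"
proof (rule Bochner_Integration.integrable_bound[of M "\<lambda>\<omega>. L * g \<omega>"])
  show "(\<lambda>\<omega>. g \<omega> * p \<omega>) \<in> borel_measurable M"
    using g p by simp
  show "AE \<omega> in M. norm (g \<omega> * p \<omega>) \<le> norm (L * g \<omega>)"
  proof (rule AE_I2)
    fix \<omega> assume "\<omega> \<in> space M"
    then have "\<bar>p \<omega>\<bar> \<le> \<bar>L\<bar>" using L[of \<omega>] by linarith
    then show "norm (g \<omega> * p \<omega>) \<le> norm (L * g \<omega>)"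
      unfolding real_norm_def abs_mult by (subst mult.commute) (rule mult_right_mono, simp_all)
  qed
qed (use g in simp)

text \<open>One term of the exponential series; it converts exponential moments into polynomial
  ones.\<close>

lemma power_le_fact_exp:
  fixes x :: real
  assumes "x \<ge> 0"
  shows "x ^ n \<le> fact n * exp x"
proof -
  have "x ^ n / fact n \<le> (\<Sum>i\<le>n. x ^ i / fact i)"
    using assms by (intro member_le_sum) auto
  also have "\<dots> \<le> exp x"
    using assms summable_exp_generic[of x] by (auto simp: exp_def divide_inverse mult.commute intro!: sum_le_suminf)
  finally show ?thesis by (simp add: field_simps)
qed

section \<open>Isometry, orthogonality and moments of elementary integrals\<close>

context brownian_setting
begin

definition elem_int :: "'d \<Rightarrow> (real \<times> real \<times> ('a \<Rightarrow> 'b::euclidean_space)) list \<Rightarrow> 'a \<Rightarrow> 'b" where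
  "elem_int k xs \<omega> = (\<Sum>(a, b, \<xi>)\<leftarrow>xs. dB k a b \<omega> *\<^sub>R \<xi> \<omega>)"

text \<open>\<open>s\<close> bounds the left endpoints from below: an integral over such items uses
  only noise after time \<open>s\<close> and is orthogonal to \<open>F s\<close>. Boundedness of
  each single coefficient keeps the products with increments integrable.\<close>

definition elementary :: "real \<Rightarrow> (real \<times> real \<times> ('a \<Rightarrow> 'b::euclidean_space)) list \<Rightarrow> bool" where
  "elementary s xs \<longleftrightarrow> (\<forall>(a, b, \<xi>)\<in>set xs. s \<le> a \<and> a \<le> b \<and> \<xi> \<in> borel_measurable (F a) \<and>
     bounded (\<xi> ` space M))"

lemma elem_int_simps [simp]:
  "elem_int k [] \<omega> = 0"
  "elem_int k ((a, b, \<xi>) # xs) \<omega> = dB k a b \<omega> *\<^sub>R \<xi> \<omega> + elem_int k xs \<omega>"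
  "elem_int k (xs @ ys) \<omega> = elem_int k xs \<omega> + elem_int k ys \<omega>"
  by (simp_all add: elem_int_def)

lemma elem_int_neg [simp]: "elem_int k (neg_items xs) \<omega> = - elem_int k xs \<omega>"
  by (induction xs) (auto simp: neg_items_def)

lemma elementary_simps [simp]:
  "elementary s []"
  "elementary s ((a, b, \<xi>) # xs) \<longleftrightarrow> s \<le> a \<and> a \<le> b \<and> \<xi> \<in> borel_measurable (F a) \<and>
     bounded (\<xi> ` space M) \<and> elementary s xs"
  "elementary s (xs @ ys) \<longleftrightarrow> elementary s xs \<and> elementary s ys"
  by (simp_all add: elementary_def ball_Un)

lemma elementary_neg: "elementary s xs \<Longrightarrow> elementary s (neg_items xs)"
proof (induction xs)
  case (Cons x xs)
  obtain a b \<xi> where x: "x = (a, b, \<xi>)" by (cases x)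
  have "(\<lambda>\<omega>. - \<xi> \<omega>) ` space M = uminus ` (\<xi> ` space M)" by auto
  then show ?case using Cons x by (auto simp: neg_items_def)
qed (simp add: neg_items_def)

lemma elem_int_measurable: "0 \<le> s \<Longrightarrow> elementary s xs \<Longrightarrow> elem_int k xs \<in> borel_measurable M"
proof (induction xs)
  case (Cons x xs)
  obtain a b \<xi> where x: "x = (a, b, \<xi>)" by (cases x)
  have "\<xi> \<in> borel_measurable M" "dB k a b \<in> borel_measurable M"
    using Cons.prems by (auto simp: x intro: measurable_F_M dB_measurable)
  moreover have "elem_int k xs \<in> borel_measurable M"
    using Cons by (simp add: x)
  ultimately have "(\<lambda>\<omega>. dB k a b \<omega> *\<^sub>R \<xi> \<omega> + elem_int k xs \<omega>) \<in> borel_measurable M"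
    by measurable
  moreover have "elem_int k (x # xs) = (\<lambda>\<omega>. dB k a b \<omega> *\<^sub>R \<xi> \<omega> + elem_int k xs \<omega>)"
    by (simp add: x fun_eq_iff)
  ultimately show ?case by simp
qed (simp add: fun_eq_iff elem_int_def[abs_def])

lemma elem_proc_measurable:
  "elementary s xs \<Longrightarrow> (\<lambda>(\<omega>, r). elem_proc xs r \<omega>) \<in> borel_measurable (M \<Otimes>\<^sub>M lborel)"
proof (induction xs)
  case (Cons x xs)
  obtain a b \<xi> where x: "x = (a, b, \<xi>)" by (cases x)
  have [measurable]: "\<xi> \<in> borel_measurable M"
    using Cons.prems by (auto simp: x intro: measurable_F_M)
  have [measurable]: "(\<lambda>p. elem_proc xs (snd p) (fst p)) \<in> borel_measurable (M \<Otimes>\<^sub>M lborel)"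
    using Cons by (simp add: x case_prod_beta')
  have "(\<lambda>p. indicator {a<..b} (snd p) *\<^sub>R \<xi> (fst p) + elem_proc xs (snd p) (fst p)) \<in> borel_measurable (M \<Otimes>\<^sub>M lborel)"
    by measurable
  then show ?case by (simp add: x case_prod_beta')
qed simp

text \<open>The isometry for two intervals that may overlap. \<open>p\<close> is known only at the
  later left endpoint \<open>c\<close>, so it may depend on the noise between \<open>a\<close> and
  \<open>c\<close> and does not factor out. The increments are therefore cut into pieces, so that
  each product contains a last piece lying in the future of the other factors.\<close>

lemma dB_dB_past_mean:
  fixes p :: "'a \<Rightarrow> real"
  assumes "0 \<le> a" "a \<le> c" "a \<le> b" "c \<le> d" and p: "p \<in> borel_measurable (F c)"
    and L: "\<And>\<omega>. \<omega> \<in> space M \<Longrightarrow> \<bar>p \<omega>\<bar> \<le> L"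
  shows "integrable M (\<lambda>\<omega>. dB k a b \<omega> * dB k c d \<omega> * p \<omega>) \<and>
    expectation (\<lambda>\<omega>. dB k a b \<omega> * dB k c d \<omega> * p \<omega>) = max 0 (min b d - c) * expectation p"
proof -
  have pM: "p \<in> borel_measurable M" using measurable_F_M[OF p] .
  have ip: "integrable M p"
    using integrable_mult_bounded[of M "\<lambda>_. 1" p L] pM L by simp
  have ip': "integrable M (\<lambda>\<omega>. dB k u v \<omega> * p \<omega>)" if "0 \<le> u" "u \<le> v" for u v
    using integrable_mult_bounded[OF dB_integrable[OF that] pM L] .
  have "0 \<le> c" using assms by simp
  show ?thesis
  proof (cases "b \<le> c")
    case True
    have Y: "(\<lambda>\<omega>. dB k a b \<omega> * p \<omega>) \<in> borel_measurable (F c)"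
      by (intro borel_measurable_times p dB_measurable_F) (use assms True in auto)
    show ?thesis
      using past_times_dB_integrable[OF \<open>0 \<le> c\<close> \<open>c \<le> d\<close> Y ip'[of a b], of k]
        past_times_dB_mean[OF \<open>0 \<le> c\<close> \<open>c \<le> d\<close> Y ip'[of a b], of k] assms True
      by (simp add: mult_ac)
  next
    case False
    \<comment> \<open>The overlap of the two intervals is (c, m]. Only its squared increment has a
      nonzero mean; the pieces beyond \<open>m\<close> cannot both be nonzero, since
      \<open>m\<close> is \<open>b\<close> or \<open>d\<close>.\<close>
    define m where "m = min b d"
    have m: "c \<le> m" "m \<le> b" "m \<le> d" "m = b \<or> m = d" "0 \<le> m"
      using False assms by (auto simp: m_def)
    have Y1: "(\<lambda>\<omega>. dB k a c \<omega> * p \<omega>) \<in> borel_measurable (F c)"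
      by (intro borel_measurable_times p dB_measurable_F) (use assms in auto)
    have Y2: "(\<lambda>\<omega>. dB k c m \<omega> * p \<omega>) \<in> borel_measurable (F m)"
      by (intro borel_measurable_times measurable_F_mono[OF p] dB_measurable_F) (use assms m in auto)
    note T1 = past_times_dB_integrable[OF \<open>0 \<le> c\<close> \<open>c \<le> d\<close> Y1 ip'[OF \<open>0 \<le> a\<close> \<open>a \<le> c\<close>], of k]
      past_times_dB_mean[OF \<open>0 \<le> c\<close> \<open>c \<le> d\<close> Y1 ip'[OF \<open>0 \<le> a\<close> \<open>a \<le> c\<close>], of k]
    note T2 = past_times_dB_dB_integrable[OF \<open>0 \<le> c\<close> m(1) p ip, of k k]
      past_times_dB_dB_mean[OF \<open>0 \<le> c\<close> m(1) p ip, of k k]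
    note T3 = past_times_dB_integrable[OF m(5,3) Y2 ip'[OF \<open>0 \<le> c\<close> m(1)], of k]
      past_times_dB_mean[OF m(5,3) Y2 ip'[OF \<open>0 \<le> c\<close> m(1)], of k]
    note T4 = past_times_dB_integrable[OF m(5,2) Y2 ip'[OF \<open>0 \<le> c\<close> m(1)], of k]
      past_times_dB_mean[OF m(5,2) Y2 ip'[OF \<open>0 \<le> c\<close> m(1)], of k]
    have "dB k a b \<omega> * dB k c d \<omega> * p \<omega> =
      dB k a c \<omega> * p \<omega> * dB k c d \<omega> + p \<omega> * (dB k c m \<omega> * dB k c m \<omega>) +
      dB k c m \<omega> * p \<omega> * dB k m d \<omega> + dB k c m \<omega> * p \<omega> * dB k m b \<omega>" for \<omega>
    proof -
      have "dB k a b \<omega> = dB k a c \<omega> + dB k c m \<omega> + dB k m b \<omega>"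
        "dB k c d \<omega> = dB k c m \<omega> + dB k m d \<omega>" "dB k m b \<omega> * dB k m d \<omega> = 0"
        using m(4) by (auto simp: dB_def)
      then show ?thesis by (simp add: algebra_simps)
    qed
    then show ?thesis
      using T1 T2 T3 T4 m by (simp add: max_def flip: m_def)
  qed
qed

lemma item_isometry:
  fixes \<xi> \<eta> :: "'a \<Rightarrow> 'b::euclidean_space"
  assumes "elementary 0 [(a, b, \<xi>)]" "elementary 0 [(c, d, \<eta>)]"
  shows "integrable M (\<lambda>\<omega>. \<xi> \<omega> \<bullet> \<eta> \<omega>)"
    and "integrable M (\<lambda>\<omega>. (dB k a b \<omega> *\<^sub>R \<xi> \<omega>) \<bullet> (dB k c d \<omega> *\<^sub>R \<eta> \<omega>))"
    and "expectation (\<lambda>\<omega>. (dB k a b \<omega> *\<^sub>R \<xi> \<omega>) \<bullet> (dB k c d \<omega> *\<^sub>R \<eta> \<omega>))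
      = max 0 (min b d - max a c) * expectation (\<lambda>\<omega>. \<xi> \<omega> \<bullet> \<eta> \<omega>)"
proof -
  obtain L1 L2 where L1: "\<And>\<omega>. \<omega> \<in> space M \<Longrightarrow> norm (\<xi> \<omega>) \<le> L1"
    and L2: "\<And>\<omega>. \<omega> \<in> space M \<Longrightarrow> norm (\<eta> \<omega>) \<le> L2"
    using assms by (auto simp: bounded_iff)
  have L: "\<bar>\<xi> \<omega> \<bullet> \<eta> \<omega>\<bar> \<le> L1 * L2" if "\<omega> \<in> space M" for \<omega>
    by (rule order_trans[OF Cauchy_Schwarz_ineq2 mult_mono])
      (use L1[OF that] L2[OF that] norm_ge_zero[of "\<xi> \<omega>"] in \<open>linarith | simp\<close>)+
  have meas: "(\<lambda>\<omega>. \<xi> \<omega> \<bullet> \<eta> \<omega>) \<in> borel_measurable (F (max a c))"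
    using assms by (intro borel_measurable_inner) (auto intro: measurable_F_mono)
  show "integrable M (\<lambda>\<omega>. \<xi> \<omega> \<bullet> \<eta> \<omega>)"
    using integrable_mult_bounded[of M "\<lambda>_. 1", OF _ measurable_F_M[OF meas] L] by simp
  have "integrable M (\<lambda>\<omega>. dB k a b \<omega> * dB k c d \<omega> * (\<xi> \<omega> \<bullet> \<eta> \<omega>)) \<and>
    expectation (\<lambda>\<omega>. dB k a b \<omega> * dB k c d \<omega> * (\<xi> \<omega> \<bullet> \<eta> \<omega>))
      = max 0 (min b d - max a c) * expectation (\<lambda>\<omega>. \<xi> \<omega> \<bullet> \<eta> \<omega>)"
  proof (cases "a \<le> c")
    case True
    then show ?thesis
      using dB_dB_past_mean[of a c b d "\<lambda>\<omega>. \<xi> \<omega> \<bullet> \<eta> \<omega>" "L1 * L2" k] assms meas L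
      by (simp add: max_absorb2)
  next
    case False
    then show ?thesis
      using dB_dB_past_mean[of c a d b "\<lambda>\<omega>. \<xi> \<omega> \<bullet> \<eta> \<omega>" "L1 * L2" k] assms meas L
      by (simp add: max_absorb1 min.commute mult.commute[of "dB k a b _"])
  qed
  then show "integrable M (\<lambda>\<omega>. (dB k a b \<omega> *\<^sub>R \<xi> \<omega>) \<bullet> (dB k c d \<omega> *\<^sub>R \<eta> \<omega>))"
    and "expectation (\<lambda>\<omega>. (dB k a b \<omega> *\<^sub>R \<xi> \<omega>) \<bullet> (dB k c d \<omega> *\<^sub>R \<eta> \<omega>))
      = max 0 (min b d - max a c) * expectation (\<lambda>\<omega>. \<xi> \<omega> \<bullet> \<eta> \<omega>)"
    by (simp_all add: mult_ac)
qed

text \<open>The isometry in polarised form, with the integrability that it needs. Being bilinear and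
  symmetric, it is inherited by concatenations in either argument, so that the case of two single
  items suffices.\<close>

definition isometric :: "'d \<Rightarrow> (real \<times> real \<times> ('a \<Rightarrow> 'b::euclidean_space)) list \<Rightarrow> (real \<times> real \<times> ('a \<Rightarrow> 'b)) list \<Rightarrow> bool" where
  "isometric k xs ys \<longleftrightarrow>
    (\<forall>\<omega>. integrable lborel (\<lambda>r. elem_proc xs r \<omega> \<bullet> elem_proc ys r \<omega>)) \<and>
    integrable M (\<lambda>\<omega>. \<integral>r. elem_proc xs r \<omega> \<bullet> elem_proc ys r \<omega> \<partial>lborel) \<and>
    integrable M (\<lambda>\<omega>. elem_int k xs \<omega> \<bullet> elem_int k ys \<omega>) \<and>
    expectation (\<lambda>\<omega>. elem_int k xs \<omega> \<bullet> elem_int k ys \<omega>) =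
    expectation (\<lambda>\<omega>. \<integral>r. elem_proc xs r \<omega> \<bullet> elem_proc ys r \<omega> \<partial>lborel)"

lemma isometric_Nil: "isometric k [] ys"
  by (simp add: isometric_def)

lemma isometric_sym: "isometric k xs ys \<Longrightarrow> isometric k ys xs"
  unfolding isometric_def by (simp add: inner_commute)

lemma isometric_append: "isometric k xs zs \<Longrightarrow> isometric k ys zs \<Longrightarrow> isometric k (xs @ ys) zs"
  unfolding isometric_def by (simp add: inner_add_left)

lemma isometric_item:
  assumes "elementary 0 [(a, b, \<xi>)]" "elementary 0 [(c, d, \<eta>)]"
  shows "isometric k [(a, b, \<xi>)] [(c, d, \<eta>)]"
proof -
  have eq: "elem_proc [(a, b, \<xi>)] r \<omega> \<bullet> elem_proc [(c, d, \<eta>)] r \<omega> =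
    indicator {a<..b} r * indicator {c<..d} r * (\<xi> \<omega> \<bullet> \<eta> \<omega>)" for r \<omega>
    by (simp add: mult_ac)
  show ?thesis
    unfolding isometric_def eq
    using item_isometry[OF assms] integral_indicator_Ioc_Ioc[of a b c d]
    by (simp add: integral_mult_left)
qed

lemma isometric_elementary:
  assumes "elementary 0 xs" "elementary 0 ys"
  shows "isometric k xs ys"
proof -
  have 1: "isometric k xs [(c, d, \<eta>)]" if "elementary 0 [(c, d, \<eta>)]" "elementary 0 xs" for c d \<eta> xs
    using that(2)
  proof (induction xs)
    case (Cons x xs)
    obtain a b \<xi> where x: "x = (a, b, \<xi>)" by (cases x)
    have "isometric k ([x] @ xs) [(c, d, \<eta>)]"
      by (rule isometric_append) (use Cons x that(1) in \<open>auto intro!: isometric_item\<close>)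
    then show ?case by simp
  qed (rule isometric_Nil)
  show ?thesis using assms(1)
  proof (induction xs)
    case (Cons x xs)
    obtain a b \<xi> where x: "x = (a, b, \<xi>)" by (cases x)
    have "isometric k ([x] @ xs) ys"
      by (rule isometric_append) (use Cons x in \<open>auto intro!: isometric_sym[OF 1] assms(2)\<close>)
    then show ?case by simp
  qed (rule isometric_Nil)
qed

lemma elem_int_isometry:
  assumes "elementary 0 xs"
  shows "(\<integral>\<^sup>+\<omega>. ennreal ((norm (elem_int k xs \<omega>))\<^sup>2) \<partial>M)
    = (\<integral>\<^sup>+\<omega>. (\<integral>\<^sup>+r. ennreal ((norm (elem_proc xs r \<omega>))\<^sup>2) \<partial>lborel) \<partial>M)"
proof -
  have i: "isometric k xs xs" by (rule isometric_elementary) fact+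
  have "(\<integral>\<^sup>+\<omega>. ennreal ((norm (elem_int k xs \<omega>))\<^sup>2) \<partial>M)
    = ennreal (expectation (\<lambda>\<omega>. elem_int k xs \<omega> \<bullet> elem_int k xs \<omega>))"
    using i unfolding isometric_def by (simp add: power2_norm_eq_inner nn_integral_eq_integral)
  also have "\<dots> = ennreal (expectation (\<lambda>\<omega>. \<integral>r. elem_proc xs r \<omega> \<bullet> elem_proc xs r \<omega> \<partial>lborel))"
    using i unfolding isometric_def by simp
  also have "\<dots> = (\<integral>\<^sup>+\<omega>. ennreal (\<integral>r. elem_proc xs r \<omega> \<bullet> elem_proc xs r \<omega> \<partial>lborel) \<partial>M)"
    using i unfolding isometric_def by (intro nn_integral_eq_integral[symmetric]) auto
  also have "\<dots> = (\<integral>\<^sup>+\<omega>. (\<integral>\<^sup>+r. ennreal ((norm (elem_proc xs r \<omega>))\<^sup>2) \<partial>lborel) \<partial>M)"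
    using i unfolding isometric_def
    by (intro nn_integral_cong) (simp add: power2_norm_eq_inner nn_integral_eq_integral)
  finally show ?thesis .
qed

lemma elem_int_past_mean:
  fixes Y :: "'a \<Rightarrow> 'b::euclidean_space"
  assumes "0 \<le> s" "elementary s xs" and Y: "Y \<in> borel_measurable (F s)" "integrable M Y"
  shows "integrable M (\<lambda>\<omega>. Y \<omega> \<bullet> elem_int k xs \<omega>) \<and> expectation (\<lambda>\<omega>. Y \<omega> \<bullet> elem_int k xs \<omega>) = 0"
  using assms(2)
proof (induction xs)
  case (Cons x xs)
  obtain a b \<xi> where x: "x = (a, b, \<xi>)" by (cases x)
  have p: "s \<le> a" "a \<le> b" "\<xi> \<in> borel_measurable (F a)" "0 \<le> a" "bounded (\<xi> ` space M)" and xs: "elementary s xs"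
    using Cons.prems assms(1) by (auto simp: x)
  obtain L where L: "\<And>\<omega>. \<omega> \<in> space M \<Longrightarrow> norm (\<xi> \<omega>) \<le> L"
    using p(5) by (auto simp: bounded_iff)
  have m: "(\<lambda>\<omega>. Y \<omega> \<bullet> \<xi> \<omega>) \<in> borel_measurable (F a)"
    using p by (intro borel_measurable_inner measurable_F_mono[OF Y(1)]) auto
  have "integrable M (\<lambda>\<omega>. Y \<omega> \<bullet> \<xi> \<omega>)"
  proof (rule Bochner_Integration.integrable_bound[of M "\<lambda>\<omega>. L * norm (Y \<omega>)"])
    show "AE \<omega> in M. norm (Y \<omega> \<bullet> \<xi> \<omega>) \<le> norm (L * norm (Y \<omega>))"
    proof (rule AE_I2)
      fix \<omega> assume "\<omega> \<in> space M"
      have "\<bar>Y \<omega> \<bullet> \<xi> \<omega>\<bar> \<le> norm (Y \<omega>) * norm (\<xi> \<omega>)" by (rule Cauchy_Schwarz_ineq2)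
      also have "\<dots> \<le> norm (Y \<omega>) * \<bar>L\<bar>"
        using L[OF \<open>\<omega> \<in> space M\<close>] by (intro mult_left_mono) auto
      finally show "norm (Y \<omega> \<bullet> \<xi> \<omega>) \<le> norm (L * norm (Y \<omega>))"
        by (simp add: abs_mult mult.commute)
    qed
  qed (use Y(2) measurable_F_M[OF m] in auto)
  then have "integrable M (\<lambda>\<omega>. Y \<omega> \<bullet> \<xi> \<omega> * dB k a b \<omega>)" "expectation (\<lambda>\<omega>. Y \<omega> \<bullet> \<xi> \<omega> * dB k a b \<omega>) = 0"
    using past_times_dB_integrable[OF p(4,2) m] past_times_dB_mean[OF p(4,2) m] by auto
  then show ?case
    using Cons.IH[OF xs] by (simp add: x inner_add_right mult.commute)
qed simp

text \<open>Peeling off the last increment multiplies the bound by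
  \<open>exp (K\<^sup>2 * (\<tau> (Suc n) - \<tau> n) / 2)\<close>, and the exponents telescope.
  Measurability with respect to \<open>F (\<tau> n)\<close> belongs to the induction because the
  exponential of the partial sum is the weight in the next step.\<close>

lemma exp_sum_dB_bound:
  fixes c :: "nat \<Rightarrow> 'a \<Rightarrow> real"
  assumes "0 \<le> \<tau> 0" "\<And>i. i < n \<Longrightarrow> \<tau> i \<le> \<tau> (Suc i)"
    "\<And>i. i < n \<Longrightarrow> c i \<in> borel_measurable (F (\<tau> i))" "\<And>i \<omega>. i < n \<Longrightarrow> \<bar>c i \<omega>\<bar> \<le> K"
  shows "0 \<le> \<tau> n \<and> (\<lambda>\<omega>. \<Sum>i<n. c i \<omega> * dB k (\<tau> i) (\<tau> (Suc i)) \<omega>) \<in> borel_measurable (F (\<tau> n)) \<and>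
    (\<integral>\<^sup>+\<omega>. ennreal (exp (\<Sum>i<n. c i \<omega> * dB k (\<tau> i) (\<tau> (Suc i)) \<omega>)) \<partial>M)
     \<le> ennreal (exp (K\<^sup>2 * (\<tau> n - \<tau> 0) / 2))"
  using assms
proof (induction n)
  case 0
  then show ?case by (simp add: emeasure_space_1)
next
  case (Suc n)
  let ?S = "\<lambda>n \<omega>. \<Sum>i<n. c i \<omega> * dB k (\<tau> i) (\<tau> (Suc i)) \<omega>"
  have IH: "0 \<le> \<tau> n" "?S n \<in> borel_measurable (F (\<tau> n))"
    "(\<integral>\<^sup>+\<omega>. ennreal (exp (?S n \<omega>)) \<partial>M) \<le> ennreal (exp (K\<^sup>2 * (\<tau> n - \<tau> 0) / 2))"
    using Suc.IH Suc.prems by auto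
  have mono: "\<tau> n \<le> \<tau> (Suc n)" using Suc.prems by auto
  have cn: "c n \<in> borel_measurable (F (\<tau> n))" using Suc.prems by auto
  have "0 \<le> \<tau> (Suc n)" using IH(1) mono by simp
  moreover have "?S (Suc n) \<in> borel_measurable (F (\<tau> (Suc n)))"
    unfolding sum.lessThan_Suc
    by (intro borel_measurable_add borel_measurable_times measurable_F_mono[OF IH(2) mono]
        measurable_F_mono[OF cn mono] dB_measurable_F) (use IH mono in auto)
  moreover have "(\<integral>\<^sup>+\<omega>. ennreal (exp (?S (Suc n) \<omega>)) \<partial>M) \<le> ennreal (exp (K\<^sup>2 * (\<tau> (Suc n) - \<tau> 0) / 2))"
  proof -
    have "(\<integral>\<^sup>+\<omega>. ennreal (exp (?S (Suc n) \<omega>)) \<partial>M)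
      = (\<integral>\<^sup>+\<omega>. ennreal (exp (?S n \<omega>) * exp (c n \<omega> * dB k (\<tau> n) (\<tau> (Suc n)) \<omega>)) \<partial>M)"
      by (simp add: exp_add)
    also have "\<dots> \<le> ennreal (exp (K\<^sup>2 * (\<tau> (Suc n) - \<tau> n) / 2)) * (\<integral>\<^sup>+\<omega>. ennreal (exp (?S n \<omega>)) \<partial>M)"
      using IH(1,2) mono cn Suc.prems(4)[of n]
      by (intro exp_dB_bound) (auto intro: borel_measurable_exp measurable_compose)
    also have "\<dots> \<le> ennreal (exp (K\<^sup>2 * (\<tau> (Suc n) - \<tau> n) / 2)) * ennreal (exp (K\<^sup>2 * (\<tau> n - \<tau> 0) / 2))"
      by (intro mult_left_mono IH(3)) simp
    also have "\<dots> = ennreal (exp (K\<^sup>2 * (\<tau> (Suc n) - \<tau> 0) / 2))"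
      by (simp add: ennreal_mult[symmetric] exp_add[symmetric] add_divide_distrib[symmetric] algebra_simps)
    finally show ?thesis .
  qed
  ultimately show ?case by blast
qed

text \<open>All even moments with the correct order \<open>h ^ p\<close>, from exponential moments
  alone. The constant depends on \<open>K\<close> and \<open>p\<close> but not on the partition,
  which is what allows a passage to the limit.\<close>

lemma power_sum_dB_bound:
  fixes c :: "nat \<Rightarrow> 'a \<Rightarrow> real"
  assumes "0 \<le> \<tau> 0" "\<And>i. i < n \<Longrightarrow> \<tau> i \<le> \<tau> (Suc i)"
    "\<And>i. i < n \<Longrightarrow> c i \<in> borel_measurable (F (\<tau> i))" "\<And>i \<omega>. i < n \<Longrightarrow> \<bar>c i \<omega>\<bar> \<le> K"
    and h: "\<tau> n - \<tau> 0 \<le> h" "h > 0"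
  shows "(\<integral>\<^sup>+\<omega>. ennreal ((\<Sum>i<n. c i \<omega> * dB k (\<tau> i) (\<tau> (Suc i)) \<omega>) ^ (2 * p)) \<partial>M)
     \<le> ennreal (2 * fact (2 * p) * exp (K\<^sup>2 / 2) * h ^ p)"
proof -
  let ?S = "\<lambda>\<omega>. \<Sum>i<n. c i \<omega> * dB k (\<tau> i) (\<tau> (Suc i)) \<omega>"
  have e: "(\<integral>\<^sup>+\<omega>. ennreal (exp (\<theta> * ?S \<omega>)) \<partial>M) \<le> ennreal (exp (K\<^sup>2 / 2)) \<and> ?S \<in> borel_measurable M" 
    if "\<bar>\<theta>\<bar> = 1 / sqrt h" for \<theta>
  proof -
    have eqS: "\<theta> * ?S \<omega> = (\<Sum>i<n. (\<theta> * c i \<omega>) * dB k (\<tau> i) (\<tau> (Suc i)) \<omega>)" for \<omega>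
      by (simp add: sum_distrib_left mult.assoc)
    have "(\<integral>\<^sup>+\<omega>. ennreal (exp (\<theta> * ?S \<omega>)) \<partial>M) \<le> ennreal (exp ((\<bar>\<theta>\<bar> * K)\<^sup>2 * (\<tau> n - \<tau> 0) / 2))"
      unfolding eqS
      by (intro exp_sum_dB_bound[where c = "\<lambda>i \<omega>. \<theta> * c i \<omega>", THEN conjunct2, THEN conjunct2])
        (use assms in \<open>auto simp: abs_mult intro!: mult_left_mono\<close>)
    also have "(\<bar>\<theta>\<bar> * K)\<^sup>2 * (\<tau> n - \<tau> 0) \<le> (\<bar>\<theta>\<bar> * K)\<^sup>2 * h"
      using h by (intro mult_left_mono) auto
    also have "\<dots> = K\<^sup>2"
      using h(2) by (simp only: that) (simp add: power_mult_distrib power_divide)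
    finally have "(\<integral>\<^sup>+\<omega>. ennreal (exp (\<theta> * ?S \<omega>)) \<partial>M) \<le> ennreal (exp (K\<^sup>2 / 2))"
      by (simp add: ennreal_leI)
    moreover have "?S \<in> borel_measurable M"
      using exp_sum_dB_bound[OF assms(1-4), where k = k] measurable_F_M by blast
    ultimately show ?thesis by blast
  qed
  \<comment> \<open>At this scale the exponent
    \<open>\<theta>\<^sup>2 * K\<^sup>2 * (\<tau> n - \<tau> 0) / 2\<close> is at most
    \<open>K\<^sup>2 / 2\<close>. Both signs of \<theta> are used because exp |y| <= exp y + exp
    (-y).\<close>
  define \<theta> where "\<theta> = 1 / sqrt h"
  have \<theta>: "\<bar>\<theta>\<bar> = 1 / sqrt h" "\<bar>- \<theta>\<bar> = 1 / sqrt h" using h by (auto simp: \<theta>_def)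
  have [measurable]: "?S \<in> borel_measurable M" using e[OF \<theta>(1)] by blast
  have pt: "?S \<omega> ^ (2 * p) \<le> fact (2 * p) * h ^ p * (exp (\<theta> * ?S \<omega>) + exp (- \<theta> * ?S \<omega>))" for \<omega>
  proof -
    define x where "x = ?S \<omega>"
    have "\<bar>\<theta> * x\<bar> ^ (2 * p) \<le> fact (2 * p) * exp \<bar>\<theta> * x\<bar>"
      by (rule power_le_fact_exp) simp
    also have "exp \<bar>\<theta> * x\<bar> \<le> exp (\<theta> * x) + exp (- \<theta> * x)"
      by (simp add: abs_if add_increasing add_increasing2)
    finally have *: "\<bar>\<theta> * x\<bar> ^ (2 * p) \<le> fact (2 * p) * (exp (\<theta> * x) + exp (- \<theta> * x))"
      by simp
    have "\<bar>\<theta> * x\<bar> ^ (2 * p) = (\<theta>\<^sup>2) ^ p * x ^ (2 * p)"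
      by (simp add: power_mult power_mult_distrib)
    also have "\<theta>\<^sup>2 = 1 / h" using h by (simp add: \<theta>_def power_divide)
    finally have "x ^ (2 * p) = h ^ p * \<bar>\<theta> * x\<bar> ^ (2 * p)"
      using h by (simp add: power_divide)
    also have "\<dots> \<le> h ^ p * (fact (2 * p) * (exp (\<theta> * x) + exp (- \<theta> * x)))"
      using h by (intro mult_left_mono *) simp
    finally show ?thesis by (simp add: x_def mult_ac)
  qed
  have "(\<integral>\<^sup>+\<omega>. ennreal (?S \<omega> ^ (2 * p)) \<partial>M)
    \<le> (\<integral>\<^sup>+\<omega>. ennreal (fact (2 * p) * h ^ p) * (ennreal (exp (\<theta> * ?S \<omega>)) + ennreal (exp (- \<theta> * ?S \<omega>))) \<partial>M)"
  proof (rule nn_integral_mono)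
    fix \<omega>
    show "ennreal (?S \<omega> ^ (2 * p)) \<le> ennreal (fact (2 * p) * h ^ p) * (ennreal (exp (\<theta> * ?S \<omega>)) + ennreal (exp (- \<theta> * ?S \<omega>)))"
      using ennreal_leI[OF pt[of \<omega>]] h by (simp only: ennreal_mult ennreal_plus exp_ge_zero add_nonneg_nonneg
        zero_le_power less_imp_le fact_ge_zero mult_nonneg_nonneg)
  qed
  also have "\<dots> = ennreal (fact (2 * p) * h ^ p) * ((\<integral>\<^sup>+\<omega>. ennreal (exp (\<theta> * ?S \<omega>)) \<partial>M) + (\<integral>\<^sup>+\<omega>. ennreal (exp (- \<theta> * ?S \<omega>)) \<partial>M))"
    by (subst nn_integral_cmult, measurable, subst nn_integral_add) measurable
  also have "\<dots> \<le> ennreal (fact (2 * p) * h ^ p) * (ennreal (exp (K\<^sup>2 / 2)) + ennreal (exp (K\<^sup>2 / 2)))"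
    by (intro mult_left_mono add_mono e[OF \<theta>(1), THEN conjunct1] e[OF \<theta>(2), THEN conjunct1]) simp
  also have "\<dots> = ennreal (fact (2 * p) * h ^ p * (exp (K\<^sup>2 / 2) + exp (K\<^sup>2 / 2)))"
    using h by (simp only: ennreal_mult ennreal_plus exp_ge_zero add_nonneg_nonneg
        zero_le_power less_imp_le fact_ge_zero mult_nonneg_nonneg)
  also have "\<dots> = ennreal (2 * fact (2 * p) * exp (K\<^sup>2 / 2) * h ^ p)"
    by (rule arg_cong[where f = ennreal]) (simp add: algebra_simps)
  finally show ?thesis .
qed

end

lemma norm_power_le_sum_Basis:
  fixes x :: "'b::euclidean_space"
  shows "norm x ^ n \<le> real DIM('b) ^ n * (\<Sum>b\<in>Basis. \<bar>x \<bullet> b\<bar> ^ n)"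
proof -
  have "norm x ^ n \<le> (\<Sum>b\<in>Basis. \<bar>x \<bullet> b\<bar>) ^ n"
    by (intro power_mono norm_le_l1) simp
  also have "\<dots> \<le> real DIM('b) ^ n * (\<Sum>b\<in>Basis. \<bar>x \<bullet> b\<bar> ^ n)"
    by (rule sum_power_le_card) simp_all
  finally show ?thesis .
qed

section \<open>Increments of Ito integrals\<close>

definition simple_items :: "nat \<Rightarrow> (nat \<Rightarrow> real) \<Rightarrow> (nat \<Rightarrow> 'a \<Rightarrow> 'b::euclidean_space) \<Rightarrow> (real \<times> real \<times> ('a \<Rightarrow> 'b)) list" where
  "simple_items n \<tau> \<xi> = map (\<lambda>i. (\<tau> i, \<tau> (Suc i), \<xi> i)) [0..<n]"

lemma elem_proc_simple_items:
  "elem_proc (simple_items n \<tau> \<xi>) r \<omega> = (\<Sum>i<n. indicator {\<tau> i<..\<tau> (Suc i)} r *\<^sub>R \<xi> i \<omega>)"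
  by (simp add: elem_proc_def simple_items_def comp_def interv_sum_list_conv_sum_set_nat atLeast0LessThan)

lemma le_of_le_Suc_below:
  fixes \<tau> :: "nat \<Rightarrow> real"
  assumes "\<And>i. i < n \<Longrightarrow> \<tau> i \<le> \<tau> (Suc i)" and "i \<le> j" "j \<le> n"
  shows "\<tau> i \<le> \<tau> j"
  using assms(2,3)
proof (induction rule: dec_induct)
  case (step m)
  then show ?case using assms(1)[of m] by simp
qed simp

text \<open>At each time at most one interval of the partition is active. The equation holds for all
  \<open>v\<close> with the index fixed beforehand, because the same index has to serve for the
  coefficients and for their projections.\<close>

lemma disjoint_sum_cases:
  fixes \<tau> :: "nat \<Rightarrow> real"
  assumes mono: "\<And>i. i < n \<Longrightarrow> \<tau> i \<le> \<tau> (Suc i)"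
  obtains "\<And>v :: nat \<Rightarrow> 'b::real_vector. (\<Sum>i<n. indicator {\<tau> i<..\<tau> (Suc i)} r *\<^sub>R v i) = 0"
  | i where "i < n" "r \<in> {\<tau> i<..\<tau> (Suc i)}"
    "\<And>v :: nat \<Rightarrow> 'b. (\<Sum>i<n. indicator {\<tau> i<..\<tau> (Suc i)} r *\<^sub>R v i) = v i"
proof (cases "\<exists>i<n. r \<in> {\<tau> i<..\<tau> (Suc i)}")
  case True
  then obtain i where i: "i < n" "r \<in> {\<tau> i<..\<tau> (Suc i)}" by blast
  have uniq: "indicator {\<tau> j<..\<tau> (Suc j)} r = (0::real)" if "j < n" "j \<noteq> i" for j
  proof (cases "j < i")
    case True
    then have "\<tau> (Suc j) \<le> \<tau> i" using le_of_le_Suc_below[of n \<tau> "Suc j" i] mono i(1) by auto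
    then show ?thesis using i(2) by auto
  next
    case False
    then have "\<tau> (Suc i) \<le> \<tau> j" using le_of_le_Suc_below[of n \<tau> "Suc i" j] mono that by auto
    then show ?thesis using i(2) by auto
  qed
  have "(\<Sum>i<n. indicator {\<tau> i<..\<tau> (Suc i)} r *\<^sub>R v i) = v i" for v :: "nat \<Rightarrow> 'b"
  proof -
    have "(\<Sum>i<n. indicator {\<tau> i<..\<tau> (Suc i)} r *\<^sub>R v i) = (\<Sum>j\<in>{i}. indicator {\<tau> j<..\<tau> (Suc j)} r *\<^sub>R v j)"
      using i(1) uniq by (intro sum.mono_neutral_right) auto
    also have "\<dots> = indicator {\<tau> i<..\<tau> (Suc i)} r *\<^sub>R v i"
      by (subst sum.insert) (simp_all only: finite.emptyI empty_iff not_False_eq_True sum.empty add_0_right)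
    finally show ?thesis using i(2) by simp
  qed
  with i show ?thesis using that(2) by blast
next
  case False
  then have "(\<Sum>i<n. indicator {\<tau> i<..\<tau> (Suc i)} r *\<^sub>R v i) = 0" for v :: "nat \<Rightarrow> 'b"
    by (intro sum.neutral) auto
  then show ?thesis using that(1) by blast
qed

section \<open>Ito integrals as limits of elementary integrals\<close>

context brownian_setting
begin

lemma elem_int_simple_items:
  "elem_int k (simple_items n \<tau> \<xi>) \<omega> = (\<Sum>i<n. dB k (\<tau> i) (\<tau> (Suc i)) \<omega> *\<^sub>R \<xi> i \<omega>)"
  by (simp add: elem_int_def simple_items_def comp_def interv_sum_list_conv_sum_set_nat atLeast0LessThan)

lemma elem_int_simple_ito_integral:
  "elem_int k (simple_items n \<tau> \<xi>) \<omega> = simple_ito_integral (B k) n \<tau> \<xi> \<omega>"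
  by (simp add: elem_int_simple_items simple_ito_integral_def dB_def)

lemma elem_proc_simple_process: "elem_proc (simple_items n \<tau> \<xi>) r \<omega> = simple_process n \<tau> \<xi> r \<omega>"
  by (simp add: elem_proc_simple_items simple_process_def)

lemma elementary_simple_items:
  assumes "s \<le> \<tau> 0" "\<And>i. i < n \<Longrightarrow> \<tau> i \<le> \<tau> (Suc i)" "\<And>i. i < n \<Longrightarrow> \<xi> i \<in> borel_measurable (F (\<tau> i))"
    "\<And>i. i < n \<Longrightarrow> bounded (\<xi> i ` space M)"
  shows "elementary s (simple_items n \<tau> \<xi>)"
proof -
  have "s \<le> \<tau> i" if "i < n" for i
    using le_of_le_Suc_below[of n \<tau> 0 i] assms(1,2) that by fastforce
  then show ?thesis
    using assms by (auto simp: elementary_def simple_items_def)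
qed

text \<open>Progressiveness speaks about the interval [0,t] and the sigma-algebra
  \<open>F t\<close>. Extension by zero gives joint measurability over the whole time axis, in the
  order of variables used for Fubini's theorem.\<close>

lemma progressive_measurable:
  fixes H :: "real \<Rightarrow> 'a \<Rightarrow> 'b::euclidean_space"
  assumes "progressive F H" "0 \<le> t"
  shows "(\<lambda>(\<omega>, r). if r \<in> {0..t} then H r \<omega> else 0) \<in> borel_measurable (M \<Otimes>\<^sub>M lborel)"
proof -
  let ?N = "M \<Otimes>\<^sub>M (lborel :: real measure)"
  let ?R = "restrict_space ?N {p. snd p \<in> {0..t}}"
  have H: "(\<lambda>(s, \<omega>). H s \<omega>) \<in> borel_measurable (restrict_space borel {0..t} \<Otimes>\<^sub>M F t)"
    using assms by (simp add: progressive_def)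
  have id: "(\<lambda>\<omega>. \<omega>) \<in> measurable M (F t)"
    by (rule measurable_F_M[where s = t]) simp
  have "fst \<in> measurable ?R (F t)"
    by (rule measurable_compose[OF _ id]) (rule measurable_restrict_space1, measurable)
  moreover have "snd \<in> measurable ?R (restrict_space borel {0..t})"
    by (rule measurable_restrict_space2) (auto simp: space_restrict_space intro!: measurable_restrict_space1)
  ultimately have "(\<lambda>p. (snd p, fst p)) \<in> measurable ?R (restrict_space borel {0..t} \<Otimes>\<^sub>M F t)"
    by (intro measurable_Pair) simp_all
  from measurable_compose[OF this H]
  have 1: "(\<lambda>p. H (snd p) (fst p)) \<in> borel_measurable ?R" by simp
  have "(\<lambda>p. if snd p \<in> {0..t} then H (snd p) (fst p) else 0) \<in> borel_measurable ?N"
  proof (subst measurable_If_restrict_space_iff)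
    show "{p \<in> space ?N. snd p \<in> {0..t}} \<in> sets ?N" by measurable
  qed (use 1 in simp_all)
  then show ?thesis by (simp add: case_prod_beta')
qed

lemma progressive_adapted:
  assumes "progressive F H" "0 \<le> t"
  shows "H t \<in> borel_measurable (F t)"
proof -
  have H: "(\<lambda>(s, \<omega>). H s \<omega>) \<in> borel_measurable (restrict_space borel {0..t} \<Otimes>\<^sub>M F t)"
    using assms by (simp add: progressive_def)
  have "(\<lambda>\<omega>. (t, \<omega>)) \<in> measurable (F t) (restrict_space borel {0..t} \<Otimes>\<^sub>M F t)"
    using assms(2) by (intro measurable_Pair measurable_const) (auto simp: space_restrict_space)
  from measurable_compose[OF this H] show ?thesis by simp
qed

text \<open>The squared norm in L^2(dt x P) over the whole time axis. Time intervals enter through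
  indicators in the integrand, so that processes on different intervals can be added.\<close>

definition L2sq :: "(real \<Rightarrow> 'a \<Rightarrow> 'b::euclidean_space) \<Rightarrow> ennreal" where
  "L2sq f = (\<integral>\<^sup>+\<omega>. (\<integral>\<^sup>+r. ennreal ((norm (f r \<omega>))\<^sup>2) \<partial>lborel) \<partial>M)"

definition jmeas :: "(real \<Rightarrow> 'a \<Rightarrow> 'b::euclidean_space) \<Rightarrow> bool" where
  "jmeas f \<longleftrightarrow> (\<lambda>(\<omega>, r). f r \<omega>) \<in> borel_measurable (M \<Otimes>\<^sub>M lborel)"

lemma jmeas_add: "jmeas f \<Longrightarrow> jmeas g \<Longrightarrow> jmeas (\<lambda>r \<omega>. f r \<omega> + g r \<omega>)"
  unfolding jmeas_def by (simp add: case_prod_beta')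

lemma jmeas_diff: "jmeas f \<Longrightarrow> jmeas g \<Longrightarrow> jmeas (\<lambda>r \<omega>. f r \<omega> - g r \<omega>)"
  unfolding jmeas_def by (simp add: case_prod_beta')

lemma jmeas_elem_proc: "elementary s xs \<Longrightarrow> jmeas (elem_proc xs)"
  unfolding jmeas_def by (rule elem_proc_measurable)

lemma ennreal_norm_add_sq_le:
  fixes a b :: "'b::real_inner"
  shows "ennreal ((norm (a + b))\<^sup>2) \<le> 2 * ennreal ((norm a)\<^sup>2) + 2 * ennreal ((norm b)\<^sup>2)"
proof -
  have "ennreal ((norm (a + b))\<^sup>2) \<le> ennreal (2 * (norm a)\<^sup>2 + 2 * (norm b)\<^sup>2)"
    by (intro ennreal_leI norm_add_sq_le)
  also have "\<dots> = 2 * ennreal ((norm a)\<^sup>2) + 2 * ennreal ((norm b)\<^sup>2)"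
    by (simp add: ennreal_plus ennreal_mult)
  finally show ?thesis .
qed

lemma nn_integral_norm_add_sq_le:
  fixes f g :: "'c \<Rightarrow> 'b::euclidean_space"
  assumes [measurable]: "f \<in> borel_measurable N" "g \<in> borel_measurable N"
  shows "(\<integral>\<^sup>+\<omega>. ennreal ((norm (f \<omega> + g \<omega>))\<^sup>2) \<partial>N)
    \<le> 2 * (\<integral>\<^sup>+\<omega>. ennreal ((norm (f \<omega>))\<^sup>2) \<partial>N) + 2 * (\<integral>\<^sup>+\<omega>. ennreal ((norm (g \<omega>))\<^sup>2) \<partial>N)"
proof -
  have "(\<integral>\<^sup>+\<omega>. ennreal ((norm (f \<omega> + g \<omega>))\<^sup>2) \<partial>N)
    \<le> (\<integral>\<^sup>+\<omega>. 2 * ennreal ((norm (f \<omega>))\<^sup>2) + 2 * ennreal ((norm (g \<omega>))\<^sup>2) \<partial>N)"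
    by (intro nn_integral_mono ennreal_norm_add_sq_le)
  also have "\<dots> = 2 * (\<integral>\<^sup>+\<omega>. ennreal ((norm (f \<omega>))\<^sup>2) \<partial>N) + 2 * (\<integral>\<^sup>+\<omega>. ennreal ((norm (g \<omega>))\<^sup>2) \<partial>N)"
    by (subst nn_integral_add) (simp_all add: nn_integral_cmult)
  finally show ?thesis .
qed

lemma L2sq_pair:
  assumes "jmeas f"
  shows "L2sq f = (\<integral>\<^sup>+p. ennreal ((norm (f (snd p) (fst p)))\<^sup>2) \<partial>(M \<Otimes>\<^sub>M lborel))"
proof -
  have [measurable]: "(\<lambda>p. f (snd p) (fst p)) \<in> borel_measurable (M \<Otimes>\<^sub>M lborel)"
    using assms by (simp add: jmeas_def case_prod_beta')
  show ?thesis
    unfolding L2sq_def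
    using lborel.nn_integral_fst[of "\<lambda>p. ennreal ((norm (f (snd p) (fst p)))\<^sup>2)" M] by simp
qed

lemma L2sq_add:
  assumes "jmeas f" "jmeas g"
  shows "L2sq (\<lambda>r \<omega>. f r \<omega> + g r \<omega>) \<le> 2 * L2sq f + 2 * L2sq g"
  unfolding L2sq_pair[OF assms(1)] L2sq_pair[OF assms(2)] L2sq_pair[OF jmeas_add[OF assms]]
  using assms by (intro nn_integral_norm_add_sq_le) (simp_all add: jmeas_def case_prod_beta')

lemma L2sq_uminus: "L2sq (\<lambda>r \<omega>. - f r \<omega>) = L2sq f"
  by (simp add: L2sq_def)

lemma L2sq_elem_proc: "elementary 0 xs \<Longrightarrow> L2sq (elem_proc xs) = (\<integral>\<^sup>+\<omega>. ennreal ((norm (elem_int k xs \<omega>))\<^sup>2) \<partial>M)"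
  by (simp add: L2sq_def elem_int_isometry)

lemma ito_integral_items:
  fixes H :: "real \<Rightarrow> 'a \<Rightarrow> 'b::euclidean_space"
  assumes "is_ito_integral M F (B k) t H J"
  obtains n \<tau> \<xi> where
    "\<And>m. 0 \<le> \<tau> m 0" "\<And>m. \<tau> m (n m) \<le> t" "\<And>m i. i < n m \<Longrightarrow> \<tau> m i \<le> \<tau> m (Suc i)"
    "\<And>m i. i < n m \<Longrightarrow> \<xi> m i \<in> borel_measurable (F (\<tau> m i))"
    "\<And>m. elementary 0 (simple_items (n m) (\<tau> m) (\<xi> m))"
    "(\<lambda>m. L2sq (\<lambda>r \<omega>. indicator {0..t} r *\<^sub>R H r \<omega> - elem_proc (simple_items (n m) (\<tau> m) (\<xi> m)) r \<omega>)) \<longlonglongrightarrow> 0"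
    "(\<lambda>m. \<integral>\<^sup>+\<omega>. ennreal ((norm (J \<omega> - elem_int k (simple_items (n m) (\<tau> m) (\<xi> m)) \<omega>))\<^sup>2) \<partial>M) \<longlonglongrightarrow> 0"
proof -
  obtain n \<tau> \<xi> where si: "\<And>m::nat. simple_integrand M F t (n m) (\<tau> m) (\<xi> m)" 
    and c1: "(\<lambda>m. \<integral>\<^sup>+\<omega>. (\<integral>\<^sup>+s\<in>{0..t}. ennreal ((norm (H s \<omega> - simple_process (n m) (\<tau> m) (\<xi> m) s \<omega>))\<^sup>2) \<partial>lborel) \<partial>M) \<longlonglongrightarrow> 0"
    and c2: "(\<lambda>m. \<integral>\<^sup>+\<omega>. ennreal ((norm (J \<omega> - simple_ito_integral (B k) (n m) (\<tau> m) (\<xi> m) \<omega>))\<^sup>2) \<partial>M) \<longlonglongrightarrow> 0"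
    using assms[unfolded is_ito_integral_def, THEN conjunct2, THEN conjunct2]
    by (elim exE conjE) (rule that, erule spec, assumption+)
  have 0: "0 \<le> \<tau> m 0" "\<tau> m (n m) \<le> t" for m
    using si[of m] by (auto simp: simple_integrand_def)
  have 1: "\<tau> m i \<le> \<tau> m (Suc i)" "\<xi> m i \<in> borel_measurable (F (\<tau> m i))" "bounded (\<xi> m i ` space M)" if "i < n m" for m i
    using si[of m] that by (auto simp: simple_integrand_def)
  have el: "elementary 0 (simple_items (n m) (\<tau> m) (\<xi> m))" for m
    by (rule elementary_simple_items) (use 0 1 in auto)
  \<comment> \<open>Simple processes vanish outside [0,t], so the integral over [0,t] in the
    definition equals the one over the whole axis with \<open>H\<close> cut off.\<close>
  have out: "simple_process (n m) (\<tau> m) (\<xi> m) r \<omega> = 0" if "r \<notin> {0..t}" for m r \<omega>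
  proof (rule disjoint_sum_cases[of "n m" "\<tau> m" r])
    fix i assume i: "i < n m" "r \<in> {\<tau> m i<..\<tau> m (Suc i)}"
    have "0 \<le> \<tau> m i" "\<tau> m (Suc i) \<le> t"
      using le_of_le_Suc_below[of "n m" "\<tau> m" 0 i] le_of_le_Suc_below[of "n m" "\<tau> m" "Suc i" "n m"] 1(1) 0[of m] i(1)
      by (force intro: order_trans)+
    then show ?thesis using i that by auto
  qed (auto simp: simple_process_def 1)
  have eq: "(\<integral>\<^sup>+\<omega>. (\<integral>\<^sup>+s\<in>{0..t}. ennreal ((norm (H s \<omega> - simple_process (n m) (\<tau> m) (\<xi> m) s \<omega>))\<^sup>2) \<partial>lborel) \<partial>M)
    = L2sq (\<lambda>r \<omega>. indicator {0..t} r *\<^sub>R H r \<omega> - elem_proc (simple_items (n m) (\<tau> m) (\<xi> m)) r \<omega>)" for m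
    unfolding L2sq_def elem_proc_simple_process
    by (intro nn_integral_cong) (auto simp: indicator_def out)
  show ?thesis
    by (rule that[OF 0 1(1,2) el c1[unfolded eq] c2[folded elem_int_simple_ito_integral]])
qed

lemma jmeas_indicator_progressive:
  fixes H :: "real \<Rightarrow> 'a \<Rightarrow> 'b::euclidean_space"
  assumes "progressive F H" "A \<subseteq> {0..t}" "A \<in> sets borel" "0 \<le> t"
  shows "jmeas (\<lambda>r \<omega>. indicator A r *\<^sub>R H r \<omega>)"
proof -
  have eq: "indicator A r *\<^sub>R H r \<omega> = indicator A r *\<^sub>R (if r \<in> {0..t} then H r \<omega> else 0)" for r \<omega>
    using assms(2) by (auto simp: indicator_def)
  have [measurable]: "A \<in> sets borel" "(\<lambda>p. if snd p \<in> {0..t} then H (snd p) (fst p) else 0) \<in> borel_measurable (M \<Otimes>\<^sub>M lborel)"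
    using progressive_measurable[OF assms(1,4)] assms(3) by (simp_all add: case_prod_beta')
  show ?thesis
    unfolding jmeas_def eq by (simp add: case_prod_beta' del: atLeastAtMost_iff)
qed

text \<open>The isometry for an increment of Ito integrals, as an inequality. \<open>J\<close> and
  \<open>J'\<close> come with unrelated approximating sequences, whose difference approximates
  \<open>H\<close> on (s,t]; the exact isometry is applied to the finite list \<open>D m\<close>.
  The factor 4 comes from splitting a square twice and is harmless.\<close>

lemma ito_increment_approx:
  fixes H :: "real \<Rightarrow> 'a \<Rightarrow> 'b::euclidean_space"
  assumes I: "is_ito_integral M F (B k) t H J" "is_ito_integral M F (B k) s H J'" and st: "0 \<le> s" "s \<le> t"
    and xs: "elementary 0 xs"
  shows "(\<integral>\<^sup>+\<omega>. ennreal ((norm (J \<omega> - J' \<omega> - elem_int k xs \<omega>))\<^sup>2) \<partial>M)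
    \<le> 4 * L2sq (\<lambda>r \<omega>. indicator {s<..t} r *\<^sub>R H r \<omega> - elem_proc xs r \<omega>)" (is "?L \<le> 4 * ?R")
proof -
  have prog: "progressive F H" using I(1) by (simp add: is_ito_integral_def)
  have [measurable]: "J \<in> borel_measurable M" "J' \<in> borel_measurable M"
    using I by (auto simp: is_ito_integral_def)
  obtain n \<tau> \<xi> where S: "\<And>m. elementary 0 (simple_items (n m) (\<tau> m) (\<xi> m))"
    "(\<lambda>m. L2sq (\<lambda>r \<omega>. indicator {0..t} r *\<^sub>R H r \<omega> - elem_proc (simple_items (n m) (\<tau> m) (\<xi> m)) r \<omega>)) \<longlonglongrightarrow> 0"
    "(\<lambda>m. \<integral>\<^sup>+\<omega>. ennreal ((norm (J \<omega> - elem_int k (simple_items (n m) (\<tau> m) (\<xi> m)) \<omega>))\<^sup>2) \<partial>M) \<longlonglongrightarrow> 0"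
    by (rule ito_integral_items[OF I(1)]) (rule that; assumption)
  obtain n' \<tau>' \<xi>' where S': "\<And>m. elementary 0 (simple_items (n' m) (\<tau>' m) (\<xi>' m))"
    "(\<lambda>m. L2sq (\<lambda>r \<omega>. indicator {0..s} r *\<^sub>R H r \<omega> - elem_proc (simple_items (n' m) (\<tau>' m) (\<xi>' m)) r \<omega>)) \<longlonglongrightarrow> 0"
    "(\<lambda>m. \<integral>\<^sup>+\<omega>. ennreal ((norm (J' \<omega> - elem_int k (simple_items (n' m) (\<tau>' m) (\<xi>' m)) \<omega>))\<^sup>2) \<partial>M) \<longlonglongrightarrow> 0"
    by (rule ito_integral_items[OF I(2)]) (rule that; assumption)
  define L where "L m = simple_items (n m) (\<tau> m) (\<xi> m)" for m
  define L' where "L' m = simple_items (n' m) (\<tau>' m) (\<xi>' m)" for m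
  note S = S[folded L_def] and S' = S'[folded L'_def]
  define D where "D m = L m @ neg_items (L' m) @ neg_items xs" for m
  have D: "elementary 0 (D m)" for m
    unfolding D_def using S(1) S'(1) xs by (simp add: elementary_neg)
  have [measurable]: "elem_int k (D m) \<in> borel_measurable M" "elem_int k (L m) \<in> borel_measurable M"
    "elem_int k (L' m) \<in> borel_measurable M" "elem_int k xs \<in> borel_measurable M" for m
    using D S(1) S'(1) xs by (auto intro: elem_int_measurable)
  define a where "a r \<omega> = indicator {s<..t} r *\<^sub>R H r \<omega> - elem_proc xs r \<omega>" for r \<omega>
  define b where "b m r \<omega> = indicator {0..t} r *\<^sub>R H r \<omega> - elem_proc (L m) r \<omega>" for m r \<omega>
  define c where "c m r \<omega> = indicator {0..s} r *\<^sub>R H r \<omega> - elem_proc (L' m) r \<omega>" for m r \<omega>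
  have ja: "jmeas a"
    unfolding a_def[abs_def] using prog xs st by (intro jmeas_diff jmeas_indicator_progressive[of _ _ t] jmeas_elem_proc) auto
  have jb: "jmeas (b m)" for m
    unfolding b_def[abs_def] using prog S(1) st by (intro jmeas_diff jmeas_indicator_progressive[of _ _ t] jmeas_elem_proc) auto
  have jc: "jmeas (c m)" for m
    unfolding c_def[abs_def] using prog S'(1) st by (intro jmeas_diff jmeas_indicator_progressive[of _ _ s] jmeas_elem_proc) auto
  define e where "e m = (\<integral>\<^sup>+\<omega>. ennreal ((norm (J \<omega> - elem_int k (L m) \<omega>))\<^sup>2) \<partial>M)" for m
  define e' where "e' m = (\<integral>\<^sup>+\<omega>. ennreal ((norm (J' \<omega> - elem_int k (L' m) \<omega>))\<^sup>2) \<partial>M)" for m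
  have bound: "?L \<le> 2 * (2 * L2sq a + 2 * (2 * L2sq (b m) + 2 * L2sq (c m))) + 2 * (2 * e m + 2 * e' m)" for m
  proof -
    have "?L = (\<integral>\<^sup>+\<omega>. ennreal ((norm (elem_int k (D m) \<omega> + ((J \<omega> - elem_int k (L m) \<omega>) + - (J' \<omega> - elem_int k (L' m) \<omega>))))\<^sup>2) \<partial>M)"
      by (simp add: D_def algebra_simps)
    also have "\<dots> \<le> 2 * (\<integral>\<^sup>+\<omega>. ennreal ((norm (elem_int k (D m) \<omega>))\<^sup>2) \<partial>M)
      + 2 * (\<integral>\<^sup>+\<omega>. ennreal ((norm ((J \<omega> - elem_int k (L m) \<omega>) + - (J' \<omega> - elem_int k (L' m) \<omega>)))\<^sup>2) \<partial>M)"
      by (rule nn_integral_norm_add_sq_le) measurable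
    also have "(\<integral>\<^sup>+\<omega>. ennreal ((norm ((J \<omega> - elem_int k (L m) \<omega>) + - (J' \<omega> - elem_int k (L' m) \<omega>)))\<^sup>2) \<partial>M)
      \<le> 2 * e m + 2 * (\<integral>\<^sup>+\<omega>. ennreal ((norm (- (J' \<omega> - elem_int k (L' m) \<omega>)))\<^sup>2) \<partial>M)"
      unfolding e_def by (rule nn_integral_norm_add_sq_le) measurable
    also have "(\<integral>\<^sup>+\<omega>. ennreal ((norm (- (J' \<omega> - elem_int k (L' m) \<omega>)))\<^sup>2) \<partial>M) = e' m"
      unfolding e'_def norm_minus_cancel ..
    also have "(\<integral>\<^sup>+\<omega>. ennreal ((norm (elem_int k (D m) \<omega>))\<^sup>2) \<partial>M) = L2sq (elem_proc (D m))"
      by (rule L2sq_elem_proc[OF D, symmetric])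
    also have "elem_proc (D m) = (\<lambda>r \<omega>. a r \<omega> + ((- b m r \<omega>) + c m r \<omega>))"
    proof (intro ext)
      fix r \<omega>
      have "indicator {0..t} r = (indicator {s<..t} r + indicator {0..s} r :: real)"
        using st by (auto simp: indicator_def)
      then show "elem_proc (D m) r \<omega> = a r \<omega> + ((- b m r \<omega>) + c m r \<omega>)"
        by (simp add: D_def a_def b_def c_def algebra_simps)
    qed
    also have "L2sq (\<lambda>r \<omega>. a r \<omega> + ((- b m r \<omega>) + c m r \<omega>)) \<le> 2 * L2sq a + 2 * L2sq (\<lambda>r \<omega>. (- b m r \<omega>) + c m r \<omega>)"
      using jb jc jmeas_diff[OF jc jb] by (intro L2sq_add ja) (simp add: add.commute[of "- _"])
    also have "L2sq (\<lambda>r \<omega>. (- b m r \<omega>) + c m r \<omega>) \<le> 2 * L2sq (\<lambda>r \<omega>. - b m r \<omega>) + 2 * L2sq (c m)"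
      using jb[of m] by (intro L2sq_add jc) (simp add: jmeas_def case_prod_beta')
    finally show ?thesis
      unfolding L2sq_uminus by (auto simp: add_mono mult_left_mono)
  qed
  have e0: "e \<longlonglongrightarrow> 0" "e' \<longlonglongrightarrow> 0" "(\<lambda>m. L2sq (b m)) \<longlonglongrightarrow> 0" "(\<lambda>m. L2sq (c m)) \<longlonglongrightarrow> 0"
    using S(2,3) S'(2,3) unfolding e_def[abs_def] e'_def[abs_def] b_def[abs_def] c_def[abs_def] by auto
  have tc: "(\<lambda>m. 2 * f m) \<longlonglongrightarrow> 2 * l" if "f \<longlonglongrightarrow> l" for f :: "nat \<Rightarrow> ennreal" and l
    using that by (intro ennreal_tendsto_cmult) auto
  have "(\<lambda>m. 2 * (2 * L2sq a + 2 * (2 * L2sq (b m) + 2 * L2sq (c m))) + 2 * (2 * e m + 2 * e' m))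
    \<longlonglongrightarrow> 2 * (2 * L2sq a + 2 * (2 * 0 + 2 * 0)) + 2 * (2 * 0 + 2 * 0)"
    by (intro tendsto_add tc tendsto_const e0)
  then have "?L \<le> 2 * (2 * L2sq a + 2 * (2 * 0 + 2 * 0)) + 2 * (2 * 0 + 2 * 0)"
    by (rule LIMSEQ_le_const) (use bound in auto)
  also have "\<dots> = 4 * L2sq a" by (simp add: mult.assoc[symmetric])
  finally show ?thesis by (simp add: a_def[abs_def])
qed

section \<open>Square-integrable random variables\<close>

definition L2 :: "('a \<Rightarrow> 'c::euclidean_space) \<Rightarrow> bool" where
  "L2 f \<longleftrightarrow> f \<in> borel_measurable M \<and> integrable M (\<lambda>\<omega>. (norm (f \<omega>))\<^sup>2)"

lemma L2D: "L2 f \<Longrightarrow> f \<in> borel_measurable M" "L2 f \<Longrightarrow> integrable M (\<lambda>\<omega>. (norm (f \<omega>))\<^sup>2)"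
  by (simp_all add: L2_def)

lemma L2_bound:
  assumes "f \<in> borel_measurable M" "(\<integral>\<^sup>+\<omega>. ennreal ((norm (f \<omega>))\<^sup>2) \<partial>M) \<le> ennreal C" "0 \<le> C"
  shows "L2 f" and "expectation (\<lambda>\<omega>. (norm (f \<omega>))\<^sup>2) \<le> C"
proof -
  have "(\<integral>\<^sup>+\<omega>. ennreal ((norm (f \<omega>))\<^sup>2) \<partial>M) < \<infinity>"
    by (rule le_less_trans[OF assms(2)]) simp
  then have i: "integrable M (\<lambda>\<omega>. (norm (f \<omega>))\<^sup>2)"
    using assms(1) by (intro integrableI_nonneg) auto
  then show "L2 f" using assms(1) by (simp add: L2_def)
  show "expectation (\<lambda>\<omega>. (norm (f \<omega>))\<^sup>2) \<le> C"
    using assms(2,3) by (subst (asm) nn_integral_eq_integral[OF i]) (simp_all add: ennreal_le_iff)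
qed

lemma L2_dominated:
  assumes f: "f \<in> borel_measurable M" and g: "integrable M g" and le: "\<And>\<omega>. \<omega> \<in> space M \<Longrightarrow> (norm (f \<omega>))\<^sup>2 \<le> g \<omega>"
  shows "L2 f"
  unfolding L2_def
proof (intro conjI f Bochner_Integration.integrable_bound[OF g])
  show "AE \<omega> in M. norm ((norm (f \<omega>))\<^sup>2) \<le> norm (g \<omega>)"
    by (rule AE_I2) (use le in \<open>simp add: abs_of_nonneg order_trans[OF _ abs_ge_self]\<close>)
qed (use f in simp)

lemma L2_add:
  assumes "L2 f" "L2 g" shows "L2 (\<lambda>\<omega>. f \<omega> + g \<omega>)"
proof (rule L2_dominated)
  show "integrable M (\<lambda>\<omega>. 2 * (norm (f \<omega>))\<^sup>2 + 2 * (norm (g \<omega>))\<^sup>2)"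
    using assms by (simp add: L2_def)
qed (use assms norm_add_sq_le in \<open>auto simp: L2_def\<close>)

lemma L2_scaleR: "L2 f \<Longrightarrow> L2 (\<lambda>\<omega>. a *\<^sub>R f \<omega>)"
  by (auto simp: L2_def power_mult_distrib)

lemma L2_minus: "L2 f \<Longrightarrow> L2 (\<lambda>\<omega>. - f \<omega>)"
  by (auto simp: L2_def)

lemma L2_diff: "L2 f \<Longrightarrow> L2 g \<Longrightarrow> L2 (\<lambda>\<omega>. f \<omega> - g \<omega>)"
  using L2_add[of f "\<lambda>\<omega>. - g \<omega>"] L2_minus[of g] by simp

lemma L2_const: "L2 (\<lambda>_. a)"
  by (simp add: L2_def)

lemma L2_sum: "finite A \<Longrightarrow> (\<And>i. i \<in> A \<Longrightarrow> L2 (f i)) \<Longrightarrow> L2 (\<lambda>\<omega>. \<Sum>i\<in>A. f i \<omega>)"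
  by (induction A rule: finite_induct) (auto intro: L2_add L2_const)

lemma L2_inner_integrable:
  assumes "L2 f" "L2 g"
  shows "integrable M (\<lambda>\<omega>. f \<omega> \<bullet> g \<omega>)"
proof (rule Bochner_Integration.integrable_bound[of M "\<lambda>\<omega>. (norm (f \<omega>))\<^sup>2 + (norm (g \<omega>))\<^sup>2"])
  show "integrable M (\<lambda>\<omega>. (norm (f \<omega>))\<^sup>2 + (norm (g \<omega>))\<^sup>2)" using assms by (simp add: L2_def)
  show "(\<lambda>\<omega>. f \<omega> \<bullet> g \<omega>) \<in> borel_measurable M" by (intro borel_measurable_inner L2D(1) assms)
  show "AE \<omega> in M. norm (f \<omega> \<bullet> g \<omega>) \<le> norm ((norm (f \<omega>))\<^sup>2 + (norm (g \<omega>))\<^sup>2)"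
  proof (rule AE_I2)
    fix \<omega>
    have "\<bar>f \<omega> \<bullet> g \<omega>\<bar> \<le> norm (f \<omega>) * norm (g \<omega>)" by (rule Cauchy_Schwarz_ineq2)
    moreover have "2 * norm (f \<omega>) * norm (g \<omega>) \<le> (norm (f \<omega>))\<^sup>2 + (norm (g \<omega>))\<^sup>2" by (rule sum_squares_bound)
    moreover have "0 \<le> norm (f \<omega>) * norm (g \<omega>)" by simp
    ultimately show "norm (f \<omega> \<bullet> g \<omega>) \<le> norm ((norm (f \<omega>))\<^sup>2 + (norm (g \<omega>))\<^sup>2)"
      by (simp add: abs_of_nonneg add_nonneg_nonneg)
  qed
qed

lemma L2_integrable:
  assumes "L2 f" shows "integrable M f"
proof (rule Bochner_Integration.integrable_bound[of M "\<lambda>\<omega>. 1 + (norm (f \<omega>))\<^sup>2"])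
  show "AE \<omega> in M. norm (f \<omega>) \<le> norm (1 + (norm (f \<omega>))\<^sup>2)"
  proof (rule AE_I2)
    fix \<omega>
    have "2 * 1 * norm (f \<omega>) \<le> 1\<^sup>2 + (norm (f \<omega>))\<^sup>2" by (rule sum_squares_bound)
    then show "norm (f \<omega>) \<le> norm (1 + (norm (f \<omega>))\<^sup>2)"
      using norm_ge_zero[of "f \<omega>"] by (simp add: abs_of_nonneg add_nonneg_nonneg del: norm_ge_zero)
  qed
qed (use assms in \<open>simp_all add: L2_def\<close>)

lemma expectation_norm_sq_add_le:
  assumes "L2 f" "L2 g" "e > 0"
  shows "expectation (\<lambda>\<omega>. (norm (f \<omega> + g \<omega>))\<^sup>2)
    \<le> (1 + e) * expectation (\<lambda>\<omega>. (norm (f \<omega>))\<^sup>2) + (1 + 1 / e) * expectation (\<lambda>\<omega>. (norm (g \<omega>))\<^sup>2)"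
proof -
  have "expectation (\<lambda>\<omega>. (norm (f \<omega> + g \<omega>))\<^sup>2) \<le> expectation (\<lambda>\<omega>. (1 + e) * (norm (f \<omega>))\<^sup>2 + (1 + 1 / e) * (norm (g \<omega>))\<^sup>2)"
    by (intro integral_mono norm_add_sq_le_eps assms(3) L2D(2)[OF L2_add[OF assms(1,2)]]
        Bochner_Integration.integrable_add integrable_mult_right L2D(2) assms(1,2))
  also have "\<dots> = (1 + e) * expectation (\<lambda>\<omega>. (norm (f \<omega>))\<^sup>2) + (1 + 1 / e) * expectation (\<lambda>\<omega>. (norm (g \<omega>))\<^sup>2)"
    using assms by (simp add: L2_def)
  finally show ?thesis .
qed

lemma expectation_norm_sq_orthogonal:
  assumes "L2 f" "L2 g" "expectation (\<lambda>\<omega>. f \<omega> \<bullet> g \<omega>) = 0"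
  shows "expectation (\<lambda>\<omega>. (norm (f \<omega> + g \<omega>))\<^sup>2) = expectation (\<lambda>\<omega>. (norm (f \<omega>))\<^sup>2) + expectation (\<lambda>\<omega>. (norm (g \<omega>))\<^sup>2)"
proof -
  have "expectation (\<lambda>\<omega>. (norm (f \<omega> + g \<omega>))\<^sup>2) = expectation (\<lambda>\<omega>. (norm (f \<omega>))\<^sup>2 + (norm (g \<omega>))\<^sup>2 + 2 * (f \<omega> \<bullet> g \<omega>))"
    by (intro Bochner_Integration.integral_cong) (simp_all add: power2_norm_eq_inner inner_add inner_commute)
  also have "\<dots> = expectation (\<lambda>\<omega>. (norm (f \<omega>))\<^sup>2) + expectation (\<lambda>\<omega>. (norm (g \<omega>))\<^sup>2)"
    using L2D(2)[OF assms(1)] L2D(2)[OF assms(2)] L2_inner_integrable[OF assms(1,2)] assms(3) by simp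
  finally show ?thesis .
qed

text \<open>The coefficients of the given approximations are only known to be bounded one by one;
  projecting them to the ball of radius \<open>K\<close> makes the exponential moment bound uniform.\<close>

lemma ito_increment_bounded_approx:
  fixes H :: "real \<Rightarrow> 'a \<Rightarrow> 'b::euclidean_space"
  assumes I: "is_ito_integral M F (B k) t H J" "is_ito_integral M F (B k) s H J'" and st: "0 \<le> s" "s \<le> t"
    and K: "\<And>r \<omega>. norm (H r \<omega>) \<le> K"
  obtains n \<tau> \<xi> where
    "\<And>m. s \<le> \<tau> m 0" "\<And>m. \<tau> m (n m) \<le> t" "\<And>m i. i < n m \<Longrightarrow> \<tau> m i \<le> \<tau> m (Suc i)"
    "\<And>m i. i < n m \<Longrightarrow> \<xi> m i \<in> borel_measurable (F (\<tau> m i))"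
    "\<And>m i \<omega>. norm (\<xi> m i \<omega>) \<le> K"
    "\<And>m. elementary s (simple_items (n m) (\<tau> m) (\<xi> m))"
    "(\<lambda>m::nat. \<integral>\<^sup>+\<omega>. ennreal ((norm (J \<omega> - J' \<omega> - elem_int k (simple_items (n m) (\<tau> m) (\<xi> m)) \<omega>))\<^sup>2) \<partial>M) \<longlonglongrightarrow> 0"
proof -
  obtain n \<tau> \<xi> where S: "\<And>m::nat. 0 \<le> \<tau> m 0" "\<And>m. \<tau> m (n m) \<le> t" "\<And>m i. i < n m \<Longrightarrow> \<tau> m i \<le> \<tau> m (Suc i)"
    "\<And>m i. i < n m \<Longrightarrow> \<xi> m i \<in> borel_measurable (F (\<tau> m i))"
    "\<And>m. elementary 0 (simple_items (n m) (\<tau> m) (\<xi> m))"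
    "(\<lambda>m. L2sq (\<lambda>r \<omega>. indicator {0..t} r *\<^sub>R H r \<omega> - elem_proc (simple_items (n m) (\<tau> m) (\<xi> m)) r \<omega>)) \<longlonglongrightarrow> 0"
    by (rule ito_integral_items[OF I(1)]) (rule that; assumption)
  have K0: "0 \<le> K" using K[of 0 undefined] norm_ge_zero order_trans by blast
  \<comment> \<open>The projection is 1-Lipschitz and fixes the values of \<open>H\<close>, so
    applying it does not increase the distance to \<open>H\<close>.\<close>
  define cl where "cl = closest_point (cball (0::'b) K)"
  have cl_lip: "norm (cl x - cl y) \<le> norm (x - y)" for x y
    unfolding cl_def dist_norm[symmetric] using K0 by (intro closest_point_lipschitz) auto
  have cl_K: "norm (cl x) \<le> K" for x
    unfolding cl_def using closest_point_in_set[of "cball (0::'b) K" x] K0 by (simp add: dist_norm)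
  have cl_id: "cl x = x" if "norm x \<le> K" for x
    unfolding cl_def using that by (intro closest_point_self) (simp add: dist_norm)
  have "continuous_on UNIV cl"
    unfolding cl_def using K0 by (intro continuous_on_closest_point) auto
  then have cl_m: "cl \<in> borel_measurable borel" by (rule borel_measurable_continuous_onI)
  \<comment> \<open>The partition is clipped at \<open>s\<close>: intervals before \<open>s\<close>
    become empty, and on (s,t] all indicators stay the same. Hence the steps of the new partition
    are only weakly increasing.\<close>
  define \<tau>' where "\<tau>' m i = max (\<tau> m i) s" for m i
  define \<xi>' where "\<xi>' m i \<omega> = cl (\<xi> m i \<omega>)" for m i \<omega>
  have 1: "s \<le> \<tau>' m 0" for m by (simp add: \<tau>'_def)
  have 2: "\<tau>' m (n m) \<le> t" for m using S(2)[of m] st by (simp add: \<tau>'_def)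
  have 3: "\<tau>' m i \<le> \<tau>' m (Suc i)" if "i < n m" for m i using S(3)[OF that] by (auto simp: \<tau>'_def)
  have 4: "\<xi>' m i \<in> borel_measurable (F (\<tau>' m i))" if "i < n m" for m i
    unfolding \<xi>'_def[abs_def]
    by (rule measurable_compose[OF measurable_F_mono[OF S(4)[OF that]] cl_m]) (simp add: \<tau>'_def)
  have 5: "norm (\<xi>' m i \<omega>) \<le> K" for m i \<omega> by (simp add: \<xi>'_def cl_K)
  have bd: "bounded (\<xi>' m i ` space M)" for m i
    using 5 by (auto simp: bounded_iff)
  have 6: "elementary s (simple_items (n m) (\<tau>' m) (\<xi>' m))" for m
    by (rule elementary_simple_items[OF 1 3 4 bd]) 
  have 60: "elementary 0 (simple_items (n m) (\<tau>' m) (\<xi>' m))" for m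
    by (rule elementary_simple_items[OF order_trans[OF st(1) 1] 3 4 bd]) 
  let ?e = "\<lambda>m. L2sq (\<lambda>r \<omega>. indicator {0..t} r *\<^sub>R H r \<omega> - elem_proc (simple_items (n m) (\<tau> m) (\<xi> m)) r \<omega>)"
  have le: "norm (indicator {s<..t} r *\<^sub>R H r \<omega> - elem_proc (simple_items (n m) (\<tau>' m) (\<xi>' m)) r \<omega>)
    \<le> norm (indicator {0..t} r *\<^sub>R H r \<omega> - elem_proc (simple_items (n m) (\<tau> m) (\<xi> m)) r \<omega>)" for m r \<omega>
  proof (cases "r \<in> {s<..t}")
    case True
    have ind: "indicator {\<tau>' m i<..\<tau>' m (Suc i)} r = (indicator {\<tau> m i<..\<tau> m (Suc i)} r :: real)" for i
      using True by (auto simp: indicator_def \<tau>'_def)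
    have "elem_proc (simple_items (n m) (\<tau>' m) (\<xi>' m)) r \<omega> = cl (elem_proc (simple_items (n m) (\<tau> m) (\<xi> m)) r \<omega>)"
      unfolding elem_proc_simple_items ind
    proof (rule disjoint_sum_cases[of "n m" "\<tau> m" r])
      assume z: "\<And>v::nat \<Rightarrow> 'b. (\<Sum>i<n m. indicator {\<tau> m i<..\<tau> m (Suc i)} r *\<^sub>R v i) = 0"
      show "(\<Sum>i<n m. indicator {\<tau> m i<..\<tau> m (Suc i)} r *\<^sub>R \<xi>' m i \<omega>) =
        cl (\<Sum>i<n m. indicator {\<tau> m i<..\<tau> m (Suc i)} r *\<^sub>R \<xi> m i \<omega>)"
        unfolding z using cl_id[of 0] K0 by simp
    next
      fix i assume z: "\<And>v::nat \<Rightarrow> 'b. (\<Sum>i<n m. indicator {\<tau> m i<..\<tau> m (Suc i)} r *\<^sub>R v i) = v i"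
      show "(\<Sum>i<n m. indicator {\<tau> m i<..\<tau> m (Suc i)} r *\<^sub>R \<xi>' m i \<omega>) =
        cl (\<Sum>i<n m. indicator {\<tau> m i<..\<tau> m (Suc i)} r *\<^sub>R \<xi> m i \<omega>)"
        unfolding z by (simp add: \<xi>'_def)
    qed (rule S(3))
    then show ?thesis
      using True st cl_lip[of "H r \<omega>" "elem_proc (simple_items (n m) (\<tau> m) (\<xi> m)) r \<omega>"] cl_id[OF K[of r \<omega>]]
      by simp
  next
    case False
    have "elem_proc (simple_items (n m) (\<tau>' m) (\<xi>' m)) r \<omega> = 0"
      unfolding elem_proc_simple_items
    proof (rule disjoint_sum_cases[of "n m" "\<tau>' m" r])
      fix i assume i: "i < n m" "r \<in> {\<tau>' m i<..\<tau>' m (Suc i)}"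
      have "s \<le> \<tau>' m i" by (simp add: \<tau>'_def)
      moreover have "\<tau>' m (Suc i) \<le> t"
        using le_of_le_Suc_below[of "n m" "\<tau>' m" "Suc i" "n m"] 3 2[of m] i(1) by force
      ultimately have "r \<in> {s<..t}" using i(2) by auto
      with False show "(\<Sum>i<n m. indicator {\<tau>' m i<..\<tau>' m (Suc i)} r *\<^sub>R \<xi>' m i \<omega>) = 0" by blast
    qed (use 3 in auto)
    with False show ?thesis by simp
  qed
  have le4: "(\<integral>\<^sup>+\<omega>. ennreal ((norm (J \<omega> - J' \<omega> - elem_int k (simple_items (n m) (\<tau>' m) (\<xi>' m)) \<omega>))\<^sup>2) \<partial>M) \<le> 4 * ?e m" for m
  proof -
    have "(\<integral>\<^sup>+\<omega>. ennreal ((norm (J \<omega> - J' \<omega> - elem_int k (simple_items (n m) (\<tau>' m) (\<xi>' m)) \<omega>))\<^sup>2) \<partial>M)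
      \<le> 4 * L2sq (\<lambda>r \<omega>. indicator {s<..t} r *\<^sub>R H r \<omega> - elem_proc (simple_items (n m) (\<tau>' m) (\<xi>' m)) r \<omega>)"
      by (rule ito_increment_approx[OF I st 60])
    also have "\<dots> \<le> 4 * ?e m"
      unfolding L2sq_def by (intro mult_left_mono nn_integral_mono ennreal_leI power_mono le) auto
    finally show ?thesis .
  qed
  have lim4: "(\<lambda>m. 4 * ?e m) \<longlonglongrightarrow> 4 * 0"
    by (rule ennreal_tendsto_cmult[OF _ S(6)]) simp
  have last: "(\<lambda>m. \<integral>\<^sup>+\<omega>. ennreal ((norm (J \<omega> - J' \<omega> - elem_int k (simple_items (n m) (\<tau>' m) (\<xi>' m)) \<omega>))\<^sup>2) \<partial>M) \<longlonglongrightarrow> 0"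
  proof (rule tendsto_sandwich[OF _ _ tendsto_const])
    show "(\<lambda>m. 4 * ?e m) \<longlonglongrightarrow> 0" using lim4 by (simp only: mult_zero_right)
  qed (rule always_eventually, rule allI, rule zero_le le4)+
  show ?thesis
    by (rule that[OF 1 2 3 4 5 6 last])
qed

text \<open>The simple integrals satisfy the bound uniformly. Convergence in L^2 provides a
  subsequence converging almost everywhere, and an upper bound on the moments survives the limit by
  Fatou's lemma.\<close>

lemma ito_increment_moment:
  fixes H :: "real \<Rightarrow> 'a \<Rightarrow> 'b::euclidean_space"
  assumes I: "is_ito_integral M F (B k) t H J" "is_ito_integral M F (B k) s H J'" and st: "0 \<le> s" "s < t"
    and K: "\<And>r \<omega>. norm (H r \<omega>) \<le> K"
  shows "(\<integral>\<^sup>+\<omega>. ennreal (norm (J \<omega> - J' \<omega>) ^ (2 * p)) \<partial>M)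
    \<le> ennreal (real DIM('b) ^ (2 * p) * (real DIM('b) * (2 * fact (2 * p) * exp (K\<^sup>2 / 2))) * (t - s) ^ p)"
proof -
  have st': "s \<le> t" using st by simp
  have [measurable]: "J \<in> borel_measurable M" "J' \<in> borel_measurable M"
    using I by (auto simp: is_ito_integral_def)
  obtain n \<tau> \<xi> where S: "\<And>m::nat. s \<le> \<tau> m 0" "\<And>m. \<tau> m (n m) \<le> t" "\<And>m i. i < n m \<Longrightarrow> \<tau> m i \<le> \<tau> m (Suc i)"
    "\<And>m i. i < n m \<Longrightarrow> \<xi> m i \<in> borel_measurable (F (\<tau> m i))"
    "\<And>m i \<omega>. norm (\<xi> m i \<omega>) \<le> K"
    "\<And>m. elementary s (simple_items (n m) (\<tau> m) (\<xi> m))"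
    "(\<lambda>m::nat. \<integral>\<^sup>+\<omega>. ennreal ((norm (J \<omega> - J' \<omega> - elem_int k (simple_items (n m) (\<tau> m) (\<xi> m)) \<omega>))\<^sup>2) \<partial>M) \<longlonglongrightarrow> 0"
    by (rule ito_increment_bounded_approx[OF I st(1) st' K]) (rule that; assumption)
  define L where "L m = elem_int k (simple_items (n m) (\<tau> m) (\<xi> m))" for m
  have L_m [measurable]: "L m \<in> borel_measurable M" for m
    unfolding L_def using S(6) st(1) by (intro elem_int_measurable) auto
  define C where "C = real DIM('b) ^ (2 * p) * (real DIM('b) * (2 * fact (2 * p) * exp (K\<^sup>2 / 2))) * (t - s) ^ p"
  have L_bd: "(\<integral>\<^sup>+\<omega>. ennreal (norm (L m \<omega>) ^ (2 * p)) \<partial>M) \<le> ennreal C" for m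
  proof -
    have comp: "L m \<omega> \<bullet> b = (\<Sum>i<n m. (\<xi> m i \<omega> \<bullet> b) * dB k (\<tau> m i) (\<tau> m (Suc i)) \<omega>)" for \<omega> b
      by (simp add: L_def elem_int_simple_items inner_sum_left mult.commute)
    have "(\<integral>\<^sup>+\<omega>. ennreal (norm (L m \<omega>) ^ (2 * p)) \<partial>M)
      \<le> (\<integral>\<^sup>+\<omega>. ennreal (real DIM('b) ^ (2 * p)) * (\<Sum>b\<in>Basis. ennreal ((L m \<omega> \<bullet> b) ^ (2 * p))) \<partial>M)"
    proof (rule nn_integral_mono)
      fix \<omega>
      show "ennreal (norm (L m \<omega>) ^ (2 * p)) \<le> ennreal (real DIM('b) ^ (2 * p)) * (\<Sum>b\<in>Basis. ennreal ((L m \<omega> \<bullet> b) ^ (2 * p)))"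
        using ennreal_leI[OF norm_power_le_sum_Basis[of "L m \<omega>" "2 * p"]]
        by (simp add: ennreal_mult sum_nonneg sum_ennreal power_even_abs)
    qed
    also have "\<dots> = ennreal (real DIM('b) ^ (2 * p)) * (\<Sum>b\<in>Basis. (\<integral>\<^sup>+\<omega>. ennreal ((L m \<omega> \<bullet> b) ^ (2 * p)) \<partial>M))"
      by (subst nn_integral_cmult, measurable, subst nn_integral_sum) simp_all
    also have "\<dots> \<le> ennreal (real DIM('b) ^ (2 * p)) * (\<Sum>b\<in>(Basis::'b set). ennreal (2 * fact (2 * p) * exp (K\<^sup>2 / 2) * (t - s) ^ p))"
    proof (intro mult_left_mono sum_mono)
      fix b :: 'b assume b: "b \<in> Basis"
      show "(\<integral>\<^sup>+\<omega>. ennreal ((L m \<omega> \<bullet> b) ^ (2 * p)) \<partial>M) \<le> ennreal (2 * fact (2 * p) * exp (K\<^sup>2 / 2) * (t - s) ^ p)"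
        unfolding comp
      proof (rule power_sum_dB_bound)
        show "0 \<le> \<tau> m 0" using S(1)[of m] st(1) by simp
        show "(\<lambda>\<omega>. \<xi> m i \<omega> \<bullet> b) \<in> borel_measurable (F (\<tau> m i))" if "i < n m" for i
          using S(4)[OF that] by simp
        show "\<bar>\<xi> m i \<omega> \<bullet> b\<bar> \<le> K" for i \<omega>
          using Basis_le_norm[OF b, of "\<xi> m i \<omega>"] S(5)[of m i \<omega>] by linarith
        show "\<tau> m (n m) - \<tau> m 0 \<le> t - s" using S(1,2)[of m] by simp
      qed (use S(3) st in auto)
    qed simp
    also have "\<dots> = ennreal C"
      using st by (simp add: C_def ennreal_mult mult_ac flip: ennreal_of_nat_eq_real_of_nat)
    finally show ?thesis .
  qed
  define u where "u m \<omega> = (norm (J \<omega> - J' \<omega> - L m \<omega>))\<^sup>2" for m \<omega>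
  have u_m [measurable]: "u m \<in> borel_measurable M" for m unfolding u_def by measurable
  have lim: "(\<lambda>m. \<integral>\<^sup>+\<omega>. ennreal (u m \<omega>) \<partial>M) \<longlonglongrightarrow> 0"
    using S(7) by (simp add: u_def L_def)
  then have "eventually (\<lambda>m. (\<integral>\<^sup>+\<omega>. ennreal (u m \<omega>) \<partial>M) < 1) sequentially"
    by (rule order_tendstoD) simp
  \<comment> \<open>\<open>u m\<close> may fail to be integrable for small \<open>m\<close>; from
    \<open>N\<close> on its integral is below 1, so the sequence is shifted by
    \<open>N\<close>.\<close>
  then obtain N where N: "\<And>m. m \<ge> N \<Longrightarrow> (\<integral>\<^sup>+\<omega>. ennreal (u m \<omega>) \<partial>M) < 1"
    by (auto simp: eventually_sequentially)
  have int: "integrable M (u (m + N))" for m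
    using N[of "m + N"] by (intro integrableI_nonneg) (auto simp: u_def intro: less_trans)
  have le2: "(\<lambda>m. enn2real (\<integral>\<^sup>+\<omega>. ennreal (u (m + N) \<omega>) \<partial>M)) \<longlonglongrightarrow> 0"
    using LIMSEQ_ignore_initial_segment[OF lim, of N] by (intro tendsto_enn2real) auto
  have "(\<lambda>m. \<integral>\<omega>. norm (u (m + N) \<omega>) \<partial>M) \<longlonglongrightarrow> 0"
  proof -
    have "(\<integral>\<omega>. norm (u (m + N) \<omega>) \<partial>M) = enn2real (\<integral>\<^sup>+\<omega>. ennreal (u (m + N) \<omega>) \<partial>M)" for m
      by (subst integral_eq_nn_integral) (auto simp: u_def)
    then show ?thesis using le2 by simp
  qed
  from tendsto_L1_AE_subseq[OF int this] obtain r where r: "strict_mono r" "AE \<omega> in M. (\<lambda>m. u (r m + N) \<omega>) \<longlonglongrightarrow> 0"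
    by blast
  have AEL: "AE \<omega> in M. ennreal (norm (J \<omega> - J' \<omega>) ^ (2 * p)) = liminf (\<lambda>m. ennreal (norm (L (r m + N) \<omega>) ^ (2 * p)))"
    using r(2)
  proof eventually_elim
    case (elim \<omega>)
    from tendsto_real_sqrt[OF elim] have "(\<lambda>m. norm (J \<omega> - J' \<omega> - L (r m + N) \<omega>)) \<longlonglongrightarrow> 0"
      by (simp add: u_def)
    then have "(\<lambda>m. J \<omega> - J' \<omega> - L (r m + N) \<omega>) \<longlonglongrightarrow> 0"
      by (rule tendsto_norm_zero_cancel)
    from tendsto_diff[OF tendsto_const[of "J \<omega> - J' \<omega>"] this]
    have "(\<lambda>m. L (r m + N) \<omega>) \<longlonglongrightarrow> J \<omega> - J' \<omega>" by simp
    then have "(\<lambda>m. ennreal (norm (L (r m + N) \<omega>) ^ (2 * p))) \<longlonglongrightarrow> ennreal (norm (J \<omega> - J' \<omega>) ^ (2 * p))"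
      by (intro tendsto_ennrealI tendsto_power tendsto_norm)
    then show ?case by (intro lim_imp_Liminf[symmetric]) auto
  qed
  have "(\<integral>\<^sup>+\<omega>. ennreal (norm (J \<omega> - J' \<omega>) ^ (2 * p)) \<partial>M) = (\<integral>\<^sup>+\<omega>. liminf (\<lambda>m. ennreal (norm (L (r m + N) \<omega>) ^ (2 * p))) \<partial>M)"
    using AEL by (rule nn_integral_cong_AE)
  also have "\<dots> \<le> liminf (\<lambda>m. \<integral>\<^sup>+\<omega>. ennreal (norm (L (r m + N) \<omega>) ^ (2 * p)) \<partial>M)"
    by (rule nn_integral_liminf) measurable
  also have "\<dots> \<le> liminf (\<lambda>m::nat. ennreal C)"
    using L_bd by (intro Liminf_mono always_eventually) auto
  also have "\<dots> = ennreal C" by (simp add: Liminf_const)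
  finally show ?thesis by (simp add: C_def)
qed

text \<open>The martingale property in weak form: testing against square-integrable \<open>Y\<close>
  known at time \<open>s\<close> replaces conditional expectations. The pairing with the simple
  integrals vanishes, and convergence in mean square passes this on.\<close>

lemma ito_increment_past_mean:
  fixes H :: "real \<Rightarrow> 'a \<Rightarrow> 'b::euclidean_space" and Y :: "'a \<Rightarrow> 'b"
  assumes I: "is_ito_integral M F (B k) t H J" "is_ito_integral M F (B k) s H J'" and st: "0 \<le> s" "s < t"
    and K: "\<And>r \<omega>. norm (H r \<omega>) \<le> K"
    and Y: "Y \<in> borel_measurable (F s)" "L2 Y"
  shows "integrable M (\<lambda>\<omega>. Y \<omega> \<bullet> (J \<omega> - J' \<omega>)) \<and> expectation (\<lambda>\<omega>. Y \<omega> \<bullet> (J \<omega> - J' \<omega>)) = 0"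
proof -
  have st': "s \<le> t" using st by simp
  have [measurable]: "J \<in> borel_measurable M" "J' \<in> borel_measurable M" "Y \<in> borel_measurable M"
    using I measurable_F_M[OF Y(1)] by (auto simp: is_ito_integral_def)
  define D where "D \<omega> = J \<omega> - J' \<omega>" for \<omega>
  have [measurable]: "D \<in> borel_measurable M" unfolding D_def by measurable
  note Y1 = L2_integrable[OF Y(2)]
  obtain n \<tau> \<xi> where S: 
    "\<And>m::nat. elementary s (simple_items (n m) (\<tau> m) (\<xi> m))"
    "(\<lambda>m::nat. \<integral>\<^sup>+\<omega>. ennreal ((norm (J \<omega> - J' \<omega> - elem_int k (simple_items (n m) (\<tau> m) (\<xi> m)) \<omega>))\<^sup>2) \<partial>M) \<longlonglongrightarrow> 0"
    by (rule ito_increment_bounded_approx[OF I st(1) st' K]) (rule that; assumption)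
  define L where "L m = elem_int k (simple_items (n m) (\<tau> m) (\<xi> m))" for m
  have L_m [measurable]: "L m \<in> borel_measurable M" for m
    unfolding L_def using S(1) st(1) by (intro elem_int_measurable) auto
  define u where "u m \<omega> = (norm (D \<omega> - L m \<omega>))\<^sup>2" for m \<omega>
  have u_m [measurable]: "u m \<in> borel_measurable M" for m unfolding u_def by measurable
  have lim: "(\<lambda>m. \<integral>\<^sup>+\<omega>. ennreal (u m \<omega>) \<partial>M) \<longlonglongrightarrow> 0"
    using S(2) by (simp add: u_def L_def D_def)
  have LY: "integrable M (\<lambda>\<omega>. Y \<omega> \<bullet> L m \<omega>)" "expectation (\<lambda>\<omega>. Y \<omega> \<bullet> L m \<omega>) = 0" for m
    unfolding L_def using elem_int_past_mean[OF st(1) S(1) Y(1) Y1] by auto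
  have "L2 D"
    using ito_increment_moment[OF I st K, of 1] st(2)
    by (intro L2_bound(1)) (auto simp: D_def intro!: mult_nonneg_nonneg)
  then have inner_int: "integrable M (\<lambda>\<omega>. Y \<omega> \<bullet> D \<omega>)"
    by (rule L2_inner_integrable[OF Y(2)])
  \<comment> \<open>Young's inequality with weight \<open>e\<close>: for fixed \<open>e\<close> the
    second term vanishes along the approximation, after which \<open>e\<close> is sent to
    zero.\<close>
  have bound: "\<bar>expectation (\<lambda>\<omega>. Y \<omega> \<bullet> D \<omega>)\<bar> \<le> e * expectation (\<lambda>\<omega>. (norm (Y \<omega>))\<^sup>2)" if "e > 0" for e
  proof -
    have "ennreal \<bar>expectation (\<lambda>\<omega>. Y \<omega> \<bullet> D \<omega>)\<bar>
      \<le> ennreal e * (\<integral>\<^sup>+\<omega>. ennreal ((norm (Y \<omega>))\<^sup>2) \<partial>M) + ennreal (1 / e) * (\<integral>\<^sup>+\<omega>. ennreal (u m \<omega>) \<partial>M)" for m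
    proof -
      have "expectation (\<lambda>\<omega>. Y \<omega> \<bullet> D \<omega>) = expectation (\<lambda>\<omega>. Y \<omega> \<bullet> (D \<omega> - L m \<omega>))"
        using inner_int LY[of m] by (simp add: inner_diff_right)
      then have "ennreal \<bar>expectation (\<lambda>\<omega>. Y \<omega> \<bullet> D \<omega>)\<bar> = ennreal (norm (expectation (\<lambda>\<omega>. Y \<omega> \<bullet> (D \<omega> - L m \<omega>))))" by simp
      also have "\<dots> \<le> (\<integral>\<^sup>+\<omega>. ennreal (norm (Y \<omega> \<bullet> (D \<omega> - L m \<omega>))) \<partial>M)"
        using inner_int LY[of m] by (intro integral_norm_bound_ennreal) (simp add: inner_diff_right)
      also have "\<dots> \<le> (\<integral>\<^sup>+\<omega>. ennreal e * ennreal ((norm (Y \<omega>))\<^sup>2) + ennreal (1 / e) * ennreal (u m \<omega>) \<partial>M)"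
      proof (rule nn_integral_mono)
        fix \<omega>
        have "\<bar>Y \<omega> \<bullet> (D \<omega> - L m \<omega>)\<bar> \<le> norm (Y \<omega>) * norm (D \<omega> - L m \<omega>)" by (rule Cauchy_Schwarz_ineq2)
        also have "\<dots> \<le> 2 * (sqrt e * norm (Y \<omega>)) * (norm (D \<omega> - L m \<omega>) / sqrt e)" using that by simp
        also have "\<dots> \<le> (sqrt e * norm (Y \<omega>))\<^sup>2 + (norm (D \<omega> - L m \<omega>) / sqrt e)\<^sup>2"
          by (rule sum_squares_bound)
        also have "\<dots> = e * (norm (Y \<omega>))\<^sup>2 + (1 / e) * u m \<omega>"
          using that by (simp add: u_def power_mult_distrib power_divide)
        finally have "ennreal (norm (Y \<omega> \<bullet> (D \<omega> - L m \<omega>))) \<le> ennreal (e * (norm (Y \<omega>))\<^sup>2 + (1 / e) * u m \<omega>)"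
          by (intro ennreal_leI) simp
        then show "ennreal (norm (Y \<omega> \<bullet> (D \<omega> - L m \<omega>))) \<le> ennreal e * ennreal ((norm (Y \<omega>))\<^sup>2) + ennreal (1 / e) * ennreal (u m \<omega>)"
          using that by (simp add: ennreal_plus ennreal_mult[symmetric] u_def)
      qed
      also have "\<dots> = ennreal e * (\<integral>\<^sup>+\<omega>. ennreal ((norm (Y \<omega>))\<^sup>2) \<partial>M) + ennreal (1 / e) * (\<integral>\<^sup>+\<omega>. ennreal (u m \<omega>) \<partial>M)"
        by (subst nn_integral_add) (simp_all add: nn_integral_cmult)
      finally show ?thesis .
    qed
    moreover have "(\<lambda>m. ennreal e * (\<integral>\<^sup>+\<omega>. ennreal ((norm (Y \<omega>))\<^sup>2) \<partial>M) + ennreal (1 / e) * (\<integral>\<^sup>+\<omega>. ennreal (u m \<omega>) \<partial>M))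
      \<longlonglongrightarrow> ennreal e * (\<integral>\<^sup>+\<omega>. ennreal ((norm (Y \<omega>))\<^sup>2) \<partial>M) + ennreal (1 / e) * 0"
      by (intro tendsto_add tendsto_const ennreal_tendsto_cmult lim) auto
    ultimately have "ennreal \<bar>expectation (\<lambda>\<omega>. Y \<omega> \<bullet> D \<omega>)\<bar> \<le> ennreal e * (\<integral>\<^sup>+\<omega>. ennreal ((norm (Y \<omega>))\<^sup>2) \<partial>M) + ennreal (1 / e) * 0"
      by (intro LIMSEQ_le_const) auto
    also have "\<dots> = ennreal (e * expectation (\<lambda>\<omega>. (norm (Y \<omega>))\<^sup>2))"
      using that L2D(2)[OF Y(2)] by (simp add: nn_integral_eq_integral ennreal_mult)
    finally show ?thesis using that by (simp add: ennreal_le_iff)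
  qed
  have "\<bar>expectation (\<lambda>\<omega>. Y \<omega> \<bullet> D \<omega>)\<bar> \<le> 0 + d" if "d > 0" for d
  proof -
    define E where "E = expectation (\<lambda>\<omega>. (norm (Y \<omega>))\<^sup>2)"
    have "E \<ge> 0" by (simp add: E_def)
    have "d / (1 + E) * E \<le> d" using that \<open>E \<ge> 0\<close> by (simp add: field_simps)
    moreover have "d / (1 + E) > 0" using that \<open>E \<ge> 0\<close> by simp
    ultimately show ?thesis using bound[of "d / (1 + E)"] by (simp add: E_def)
  qed
  then have "\<bar>expectation (\<lambda>\<omega>. Y \<omega> \<bullet> D \<omega>)\<bar> \<le> 0" by (rule field_le_epsilon)
  then show ?thesis using inner_int by (simp add: D_def)
qed

text \<open>The integrand is frozen at \<open>\<xi>\<close> on the whole step; this compares an Ito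
  increment with a single Euler increment.\<close>

lemma ito_increment_one_step:
  fixes H :: "real \<Rightarrow> 'a \<Rightarrow> 'b::euclidean_space"
  assumes I: "is_ito_integral M F (B k) t H J" "is_ito_integral M F (B k) s H J'" and st: "0 \<le> s" "s < t"
    and \<xi>: "\<xi> \<in> borel_measurable (F s)" "bounded (\<xi> ` space M)"
  shows "(\<integral>\<^sup>+\<omega>. ennreal ((norm (J \<omega> - J' \<omega> - dB k s t \<omega> *\<^sub>R \<xi> \<omega>))\<^sup>2) \<partial>M)
    \<le> 4 * (\<integral>\<^sup>+\<omega>. (\<integral>\<^sup>+r. indicator {s..t} r * ennreal ((norm (H r \<omega> - \<xi> \<omega>))\<^sup>2) \<partial>lborel) \<partial>M)"
proof -
  have "(\<integral>\<^sup>+\<omega>. ennreal ((norm (J \<omega> - J' \<omega> - elem_int k [(s, t, \<xi>)] \<omega>))\<^sup>2) \<partial>M)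
    \<le> 4 * L2sq (\<lambda>r \<omega>. indicator {s<..t} r *\<^sub>R H r \<omega> - elem_proc [(s, t, \<xi>)] r \<omega>)"
    by (rule ito_increment_approx[OF I]) (use st \<xi> in auto)
  also have "\<dots> \<le> 4 * (\<integral>\<^sup>+\<omega>. (\<integral>\<^sup>+r. indicator {s..t} r * ennreal ((norm (H r \<omega> - \<xi> \<omega>))\<^sup>2) \<partial>lborel) \<partial>M)"
    unfolding L2sq_def by (intro mult_left_mono nn_integral_mono) (auto simp: indicator_def)
  finally show ?thesis by simp
qed

end

section \<open>Moments of the solution\<close>

lemma norm_sum_power_le:
  fixes v :: "'i \<Rightarrow> 'b::real_normed_vector"
  assumes "finite A" "A \<noteq> {}"
  shows "norm (\<Sum>i\<in>A. v i) ^ n \<le> real (card A) ^ n * (\<Sum>i\<in>A. norm (v i) ^ n)"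
proof -
  have "norm (\<Sum>i\<in>A. v i) ^ n \<le> (\<Sum>i\<in>A. norm (v i)) ^ n"
    by (intro power_mono norm_sum) simp
  also have "\<dots> \<le> real (card A) ^ n * (\<Sum>i\<in>A. norm (v i) ^ n)"
    by (rule sum_power_le_card) (use assms in auto)
  finally show ?thesis .
qed

lemma nn_integral_indicator_continuous:
  fixes g :: "real \<Rightarrow> real"
  assumes "continuous_on {a..b} g" and "\<And>r. r \<in> {a..b} \<Longrightarrow> 0 \<le> g r"
  shows "(\<integral>\<^sup>+r. indicator {a..b} r * ennreal (g r) \<partial>lborel) = ennreal (integral {a..b} g)"
proof -
  have si: "set_integrable lborel {a..b} g"
    by (rule borel_integrable_atLeastAtMost') fact
  have "(\<integral>\<^sup>+r. indicator {a..b} r * ennreal (g r) \<partial>lborel) = (\<integral>\<^sup>+r. ennreal (indicator {a..b} r *\<^sub>R g r) \<partial>lborel)"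
    by (intro nn_integral_cong) (auto simp: indicator_def)
  also have "\<dots> = ennreal (LINT r:{a..b}|lborel. g r)"
    unfolding set_lebesgue_integral_def
    by (rule nn_integral_eq_integral) (use si assms in \<open>auto simp: set_integrable_def indicator_def\<close>)
  also have "(LINT r:{a..b}|lborel. g r) = integral {a..b} g"
    by (rule set_borel_integral_eq_integral(2)[OF si])
  finally show ?thesis .
qed

section \<open>Pathwise damping by the drift\<close>

context contractive_coefficients
begin

text \<open>The left side is the derivative of |z|^(2m) along z' = U (z + y). Monotonicity between
  \<open>z + y\<close> and \<open>y\<close> bounds the inner product by -l |z|^2 + |z| |U y|. If |U
  y| <= (l/2) |z|, half of the damping absorbs the second term, which lowers the rate from 2ml to
  ml; otherwise |z| is at most (2/l) |U y|. Powers of \<open>z \<bullet> z\<close> are used because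
  they are differentiable at 0 as well.\<close>

lemma drift_power_bound:
  assumes "m > 0"
  shows "real m * (z \<bullet> z) ^ (m - 1) * (2 * (z \<bullet> U (z + y)))
    \<le> - (real m * l) * (z \<bullet> z) ^ m + 2 * real m * (2 / l) ^ (2 * m - 1) * norm (U y) ^ (2 * m)"
proof -
  define a where "a = norm z"
  define G where "G = norm (U y)"
  have a: "a \<ge> 0" "G \<ge> 0" by (auto simp: a_def G_def)
  have zz: "z \<bullet> z = a\<^sup>2" by (simp add: a_def power2_norm_eq_inner)
  have m1: "2 * m = Suc (2 * m - 1)" "2 * m = 2 * (m - 1) + 2" using assms by auto
  have sq: "a ^ (2 * m) = a ^ (2 * (m - 1)) * a\<^sup>2"
    using m1(2) by (metis power_add)
  have "z \<bullet> U (z + y) = (U (z + y) - U y) \<bullet> (z + y - y) + z \<bullet> U y"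
    by (simp add: inner_commute[of z] inner_diff_left)
  also have "\<dots> \<le> - l * a\<^sup>2 + a * G"
    using U_mono[of "z + y" y] norm_cauchy_schwarz[of z "U y"] by (simp add: a_def G_def)
  finally have 1: "z \<bullet> U (z + y) \<le> - l * a\<^sup>2 + a * G" .
  have "real m * (z \<bullet> z) ^ (m - 1) * (2 * (z \<bullet> U (z + y))) \<le> real m * a ^ (2 * (m - 1)) * (2 * (- l * a\<^sup>2 + a * G))"
    unfolding zz power_mult using 1 by (intro mult_left_mono) auto
  also have "\<dots> = - 2 * real m * l * a ^ (2 * m) + 2 * real m * (a ^ (2 * (m - 1)) * a * G)"
    unfolding sq by (simp add: algebra_simps)
  also have "\<dots> = - (2 * (real m * l * a ^ (2 * m))) + 2 * real m * (a ^ (2 * (m - 1)) * a * G)"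
    by simp
  also have "\<dots> \<le> - (real m * l * a ^ (2 * m)) + 2 * real m * (2 / l) ^ (2 * m - 1) * G ^ (2 * m)"
  proof (cases "G \<le> (l / 2) * a")
    case True
    have "2 * real m * (a ^ (2 * (m - 1)) * a * G) \<le> 2 * real m * (a ^ (2 * (m - 1)) * a * ((l / 2) * a))"
      using True a by (intro mult_left_mono) auto
    moreover have "2 * real m * (a ^ (2 * (m - 1)) * a * ((l / 2) * a)) = real m * l * a ^ (2 * m)"
      unfolding sq by (simp add: power2_eq_square)
    moreover have "0 \<le> 2 * real m * (2 / l) ^ (2 * m - 1) * G ^ (2 * m)"
      using pos a by simp
    ultimately show ?thesis by linarith
  next
    case False
    then have "a \<le> (2 / l) * G" using pos(1) by (simp add: field_simps)
    then have "a ^ (2 * m - 1) \<le> ((2 / l) * G) ^ (2 * m - 1)"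
      using a by (intro power_mono) auto
    then have "a ^ (2 * m - 1) * G \<le> ((2 / l) * G) ^ (2 * m - 1) * G"
      using a by (intro mult_right_mono) auto
    also have "\<dots> = (2 / l) ^ (2 * m - 1) * G ^ (2 * m)"
    proof -
      have "G ^ (2 * m) = G ^ (2 * m - 1) * G" by (subst m1(1)) (simp only: power_Suc2)
      then show ?thesis by (simp only: power_mult_distrib mult.assoc)
    qed
    finally have 2: "2 * real m * (a ^ (2 * m - 1) * G) \<le> 2 * real m * ((2 / l) ^ (2 * m - 1) * G ^ (2 * m))"
      by (intro mult_left_mono) auto
    have e: "a ^ (2 * (m - 1)) * a = a ^ (2 * m - 1)"
    proof -
      have "2 * m - 1 = Suc (2 * (m - 1))" using assms by simp
      then show ?thesis by (simp only: power_Suc2)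
    qed
    have "0 \<le> real m * l * a ^ (2 * m)" using pos a by simp
    with 2 show ?thesis unfolding e mult.assoc by linarith
  qed
  also have "- (real m * l * a ^ (2 * m)) = - (real m * l) * (z \<bullet> z) ^ m"
    by (simp add: zz power_mult)
  finally show ?thesis by (simp only: G_def)
qed

lemma pathwise_bound:
  fixes w :: "real \<Rightarrow> 'b"
  assumes ab: "a \<le> b" and w: "continuous_on {a..b} w" and m: "m > 0"
  defines "y \<equiv> (\<lambda>r. w r - w a - integral {a..r} (\<lambda>u. U (w u)))"
  shows "norm (w b - y b) ^ (2 * m) \<le> exp (- (real m * l) * (b - a)) * norm (w a) ^ (2 * m)
      + 2 * real m * (2 / l) ^ (2 * m - 1) * integral {a..b} (\<lambda>r. norm (U (y r)) ^ (2 * m))"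
    and "continuous_on {a..b} y"
proof -
  define C where "C = 2 * real m * (2 / l) ^ (2 * m - 1)"
  have C: "C \<ge> 0" using pos by (simp add: C_def)
  \<comment> \<open>\<open>z\<close> is differentiable although \<open>w\<close> is only continuous,
    and \<open>w = z + y\<close> with \<open>y a = 0\<close>.\<close>
  define z where "z r = w a + integral {a..r} (\<lambda>u. U (w u))" for r
  define g where "g r = norm (U (y r)) ^ (2 * m)" for r
  have cUw: "continuous_on {a..b} (\<lambda>u. U (w u))"
    by (rule continuous_on_compose2[OF U_cont w]) auto
  have cz: "continuous_on {a..b} z"
    unfolding z_def by (intro continuous_intros indefinite_integral_continuous_1 integrable_continuous_real cUw)
  have yz: "y r = w r - z r" for r by (simp add: y_def z_def)
  show cy: "continuous_on {a..b} y"
    unfolding yz by (intro continuous_intros w cz)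
  have cg: "continuous_on {a..b} g"
    unfolding g_def by (intro continuous_intros continuous_on_compose2[OF U_cont cy]) auto
  \<comment> \<open>\<open>exp (real m * l * r)\<close> is the integrating factor. In the source
    term it is replaced by its largest value, at \<open>b\<close>, so that the integral of
    \<open>g\<close> remains unweighted.\<close>
  define \<psi> where "\<psi> r = exp (real m * l * r) * (z r \<bullet> z r) ^ m - C * exp (real m * l * b) * integral {a..r} g" for r
  have "\<psi> b \<le> \<psi> a"
  proof (rule DERIV_nonpos_imp_decreasing_open[OF ab])
    show "continuous_on {a..b} \<psi>"
      unfolding \<psi>_def by (intro continuous_intros cz indefinite_integral_continuous_1 integrable_continuous_real cg)
    fix r assume r: "a < r" "r < b"
    then have at: "at r within {a..b} = at r" by (intro at_within_interior) auto
    have "(z has_vector_derivative U (w r)) (at r)"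
      using integral_has_vector_derivative[OF cUw, of r] r unfolding z_def[abs_def] at
      by (auto intro!: derivative_eq_intros)
    then have dz: "(z has_derivative (\<lambda>h. h *\<^sub>R U (w r))) (at r)"
      by (simp add: has_vector_derivative_def)
    have dzz: "((\<lambda>r. z r \<bullet> z r) has_real_derivative 2 * (z r \<bullet> U (w r))) (at r)"
      unfolding has_field_derivative_def
      by (rule has_derivative_eq_rhs[OF has_derivative_inner[OF dz dz]]) (auto simp: fun_eq_iff inner_commute algebra_simps)
    have dg: "((\<lambda>r. integral {a..r} g) has_real_derivative g r) (at r)"
      using integral_has_vector_derivative[OF cg, of r] r unfolding at
      by (simp add: has_real_derivative_iff_has_vector_derivative)
    let ?E = "exp (real m * l * r)"
    let ?d = "?E * (real m * (z r \<bullet> z r) ^ (m - 1) * (2 * (z r \<bullet> U (w r)))) + ?E * (real m * l) * (z r \<bullet> z r) ^ m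
      - C * exp (real m * l * b) * g r"
    have "(\<psi> has_real_derivative ?d) (at r)"
      unfolding \<psi>_def[abs_def]
      by (rule derivative_eq_intros dzz dg refl | simp)+
    moreover have "?d \<le> 0"
    proof -
      have wz: "w r = z r + y r" by (simp add: yz)
      have "real m * (z r \<bullet> z r) ^ (m - 1) * (2 * (z r \<bullet> U (w r))) \<le> - (real m * l) * (z r \<bullet> z r) ^ m + C * g r"
        unfolding wz C_def g_def by (rule drift_power_bound[OF m])
      then have "?E * (real m * (z r \<bullet> z r) ^ (m - 1) * (2 * (z r \<bullet> U (w r)))) \<le> ?E * (- (real m * l) * (z r \<bullet> z r) ^ m + C * g r)"
        by (intro mult_left_mono) auto
      moreover have "?E * (C * g r) \<le> exp (real m * l * b) * (C * g r)"
        using r pos C by (intro mult_right_mono) (auto simp: g_def intro!: mult_left_mono)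
      ultimately show ?thesis by (simp add: algebra_simps)
    qed
    ultimately show "\<exists>d. (\<psi> has_real_derivative d) (at r) \<and> d \<le> 0" by blast
  qed
  then have "exp (real m * l * b) * (z b \<bullet> z b) ^ m \<le> exp (real m * l * a) * (w a \<bullet> w a) ^ m + C * exp (real m * l * b) * integral {a..b} g"
    by (simp add: \<psi>_def z_def)
  then have "exp (- (real m * l * b)) * (exp (real m * l * b) * (z b \<bullet> z b) ^ m)
    \<le> exp (- (real m * l * b)) * (exp (real m * l * a) * (w a \<bullet> w a) ^ m + C * exp (real m * l * b) * integral {a..b} g)"
    by (intro mult_left_mono) auto
  moreover have "exp (- (real m * l * b)) * (exp (real m * l * b) * (z b \<bullet> z b) ^ m) = norm (w b - y b) ^ (2 * m)"
    by (simp add: yz power_mult power2_norm_eq_inner mult.assoc[symmetric] exp_add[symmetric])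
  moreover have "exp (- (real m * l * b)) * (exp (real m * l * a) * (w a \<bullet> w a) ^ m + C * exp (real m * l * b) * integral {a..b} g)
    = exp (- (real m * l) * (b - a)) * norm (w a) ^ (2 * m) + C * integral {a..b} g"
  proof -
    have "exp (- (real m * l * b)) * exp (real m * l * a) = exp (- (real m * l) * (b - a))"
      by (simp add: exp_add[symmetric] algebra_simps)
    moreover have "exp (- (real m * l * b)) * exp (real m * l * b) = 1"
      by (simp add: exp_add[symmetric])
    moreover have "e1 * (e2 * p + C * e3 * i) = (e1 * e2) * p + C * (e1 * e3) * i" for e1 e2 e3 p i :: real
      by (simp add: algebra_simps)
    ultimately have "exp (- (real m * l * b)) * (exp (real m * l * a) * p + C * exp (real m * l * b) * i) =
      exp (- (real m * l) * (b - a)) * p + C * i" for p i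
      by (simp only: mult_1_right)
    then show ?thesis by (simp add: power_mult power2_norm_eq_inner)
  qed
  ultimately show "norm (w b - y b) ^ (2 * m) \<le> exp (- (real m * l) * (b - a)) * norm (w a) ^ (2 * m)
      + 2 * real m * (2 / l) ^ (2 * m - 1) * integral {a..b} (\<lambda>r. norm (U (y r)) ^ (2 * m))"
    by (simp add: C_def g_def[abs_def])
qed

text \<open>The real exponent is rounded up to an even integer, to which the moment bounds of the
  noise apply.\<close>

lemma U_power_growth:
  "\<exists>C p. C > 0 \<and> (\<forall>y. norm (U y) ^ (2 * m) \<le> C * (1 + norm y ^ (2 * p)))"
proof -
  define p where "p = nat \<lceil>(q + 1) * real m\<rceil>"
  have p: "(q + 1) * real (2 * m) \<le> real (2 * p)"
  proof -
    have "(q + 1) * real m \<le> real p"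
      unfolding p_def by (rule real_nat_ceiling_ge)
    then show ?thesis by simp
  qed
  have "norm (U y) ^ (2 * m) \<le> (c ^ (2 * m) * 2 ^ (2 * p)) * (1 + norm y ^ (2 * p))" for y
  proof -
    have n0: "0 < 1 + norm y"
      using norm_ge_zero[of y] by linarith
    have "((1 + norm y) powr (q + 1)) ^ (2 * m) = ((1 + norm y) powr (q + 1)) powr (real (2 * m))"
      by (rule powr_realpow[symmetric]) (use n0 in simp)
    also have "\<dots> = (1 + norm y) powr ((q + 1) * real (2 * m))"
      by (rule powr_powr)
    also have "\<dots> \<le> (1 + norm y) powr (real (2 * p))"
      by (rule powr_mono[OF p]) simp
    also have "\<dots> = (1 + norm y) ^ (2 * p)"
      by (rule powr_realpow[OF n0])
    also have "\<dots> \<le> 2 ^ (2 * p) * (1 ^ (2 * p) + norm y ^ (2 * p))"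
      by (rule add_power_le) auto
    finally have g: "((1 + norm y) powr (q + 1)) ^ (2 * m) \<le> 2 ^ (2 * p) * (1 + norm y ^ (2 * p))"
      by simp
    have "norm (U y) ^ (2 * m) \<le> (c * (1 + norm y) powr (q + 1)) ^ (2 * m)"
      by (intro power_mono U_growth) simp
    also have "\<dots> = c ^ (2 * m) * ((1 + norm y) powr (q + 1)) ^ (2 * m)"
      by (rule power_mult_distrib)
    also have "\<dots> \<le> c ^ (2 * m) * (2 ^ (2 * p) * (1 + norm y ^ (2 * p)))"
      using pos by (intro mult_left_mono[OF g]) simp
    finally show ?thesis by (simp only: mult.assoc)
  qed
  then show ?thesis using pos by (intro exI[of _ "c ^ (2 * m) * 2 ^ (2 * p)"] exI[of _ p]) auto
qed

end

section \<open>Solutions of the stochastic equation\<close>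

locale sde_setting = brownian_setting M F B + contractive_coefficients U V l c q K
  for M :: "'a measure" and F and B :: "'d::finite \<Rightarrow> real \<Rightarrow> 'a \<Rightarrow> real"
    and U :: "'b::euclidean_space \<Rightarrow> 'b" and V :: "'d \<Rightarrow> 'b \<Rightarrow> 'b" and l c q K
begin

text \<open>The stochastic part of the increment, obtained by subtraction: it is defined on each
  path without choosing versions of Ito integrals, and it is the path \<open>y\<close> of
  \<open>pathwise_bound\<close>.\<close>

definition noise :: "(real \<Rightarrow> 'a \<Rightarrow> 'b) \<Rightarrow> real \<Rightarrow> real \<Rightarrow> 'a \<Rightarrow> 'b" where
  "noise X s t \<omega> = X t \<omega> - X s \<omega> - integral {s..t} (\<lambda>u. U (X u \<omega>))"

lemma solution_progressive: "sde_solution M F B U V x X \<Longrightarrow> progressive F X"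
  by (simp add: sde_solution_def)

lemma solution_continuous: "sde_solution M F B U V x X \<Longrightarrow> AE \<omega> in M. continuous_on {0..} (\<lambda>t. X t \<omega>)"
  by (simp add: sde_solution_def)

lemma solution_start: "sde_solution M F B U V x X \<Longrightarrow> AE \<omega> in M. X 0 \<omega> = x"
  by (simp add: sde_solution_def)

lemma solution_adapted: "sde_solution M F B U V x X \<Longrightarrow> 0 \<le> t \<Longrightarrow> X t \<in> borel_measurable (F t)"
  by (rule progressive_adapted[OF solution_progressive])

lemma solution_measurable: "sde_solution M F B U V x X \<Longrightarrow> 0 \<le> t \<Longrightarrow> X t \<in> borel_measurable M"
  by (rule measurable_F_M[OF solution_adapted])

lemma continuous_drift_path:
  fixes X :: "real \<Rightarrow> 'a \<Rightarrow> 'b"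
  assumes "continuous_on {0..} (\<lambda>t. X t \<omega>)" "0 \<le> s"
  shows "continuous_on {s..t} (\<lambda>u. U (X u \<omega>))"
  by (rule continuous_on_compose2[OF U_cont continuous_on_subset[OF assms(1)]]) (use assms(2) in auto)

definition moment_const :: "nat \<Rightarrow> real" where
  "moment_const p = real DIM('b) ^ (2 * p) * (real DIM('b) * (2 * fact (2 * p) * exp (K\<^sup>2 / 2)))"

text \<open>An interface to Ito calculus: \<open>N k\<close> stands for the increment over (s,t] of
  the integral of \<open>V k (X r)\<close> against \<open>B k\<close>. Once its existence is shown,
  the estimates argue with these properties only and no stochastic integral occurs any more.\<close>

definition martingale_increment :: "(real \<Rightarrow> 'a \<Rightarrow> 'b) \<Rightarrow> real \<Rightarrow> real \<Rightarrow> ('d \<Rightarrow> 'a \<Rightarrow> 'b) \<Rightarrow> bool" where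
  "martingale_increment X s t N \<longleftrightarrow>
    (\<forall>k. N k \<in> borel_measurable M) \<and>
    (AE \<omega> in M. noise X s t \<omega> = sqrt 2 *\<^sub>R (\<Sum>k\<in>UNIV. N k \<omega>)) \<and>
    (\<forall>k Y. Y \<in> borel_measurable (F s) \<longrightarrow> L2 Y \<longrightarrow>
       integrable M (\<lambda>\<omega>. Y \<omega> \<bullet> N k \<omega>) \<and> expectation (\<lambda>\<omega>. Y \<omega> \<bullet> N k \<omega>) = 0) \<and>
    (\<forall>k p. (\<integral>\<^sup>+\<omega>. ennreal (norm (N k \<omega>) ^ (2 * p)) \<partial>M) \<le> ennreal (moment_const p * (t - s) ^ p)) \<and>
    (\<forall>k. (\<integral>\<^sup>+\<omega>. ennreal ((norm (N k \<omega> - dB k s t \<omega> *\<^sub>R V k (X s \<omega>)))\<^sup>2) \<partial>M)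
       \<le> 4 * (\<integral>\<^sup>+\<omega>. (\<integral>\<^sup>+r. indicator {s..t} r * ennreal ((norm (V k (X r \<omega>) - V k (X s \<omega>)))\<^sup>2) \<partial>lborel) \<partial>M))"

lemma martingale_increment_exists:
  assumes sol: "sde_solution M F B U V x X" and st: "0 \<le> s" "s < t"
  shows "\<exists>N. martingale_increment X s t N"
proof -
  have "0 \<le> t" using st by simp
  note ex = sol[unfolded sde_solution_def, THEN conjunct2, THEN conjunct2, THEN conjunct2, rule_format]
  obtain J where J: "\<And>k. is_ito_integral M F (B k) t (\<lambda>s \<omega>. V k (X s \<omega>)) (J k)"
    "AE \<omega> in M. X t \<omega> = x + (LINT s:{0..t}|lborel. U (X s \<omega>)) + sqrt 2 *\<^sub>R (\<Sum>k\<in>UNIV. J k \<omega>)"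
    using ex[OF \<open>0 \<le> t\<close>] by (elim exE conjE) (rule that, erule spec, assumption)
  obtain J' where J': "\<And>k. is_ito_integral M F (B k) s (\<lambda>s \<omega>. V k (X s \<omega>)) (J' k)"
    "AE \<omega> in M. X s \<omega> = x + (LINT r:{0..s}|lborel. U (X r \<omega>)) + sqrt 2 *\<^sub>R (\<Sum>k\<in>UNIV. J' k \<omega>)"
    using ex[OF st(1)] by (elim exE conjE) (rule that, erule spec, assumption)
  have Vs: "(\<lambda>\<omega>. V k (X s \<omega>)) \<in> borel_measurable (F s)" for k
    by (rule measurable_compose[OF solution_adapted[OF sol st(1)] V_measurable])
  have bd: "bounded ((\<lambda>\<omega>. V k (X s \<omega>)) ` space M)" for k
    using V_bd by (auto simp: bounded_iff)
  have ae: "AE \<omega> in M. noise X s t \<omega> = sqrt 2 *\<^sub>R (\<Sum>k\<in>UNIV. J k \<omega> - J' k \<omega>)"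
    using J(2) J'(2) solution_continuous[OF sol]
  proof eventually_elim
    case (elim \<omega>)
    have L: "(LINT u:{0..v}|lborel. U (X u \<omega>)) = integral {0..v} (\<lambda>u. U (X u \<omega>))" for v
      by (intro set_borel_integral_eq_integral(2) borel_integrable_atLeastAtMost' continuous_drift_path[where X = X and \<omega> = \<omega>, OF elim(3)]) simp
    have "integral {0..s} (\<lambda>u. U (X u \<omega>)) + integral {s..t} (\<lambda>u. U (X u \<omega>)) = integral {0..t} (\<lambda>u. U (X u \<omega>))"
      by (intro Henstock_Kurzweil_Integration.integral_combine integrable_continuous_real continuous_drift_path[where X = X and \<omega> = \<omega>, OF elim(3)])
        (use st in auto)
    with elim(1,2)[unfolded L] show ?case
      by (simp add: noise_def sum_subtractf scaleR_diff_right algebra_simps)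
  qed
  have "martingale_increment X s t (\<lambda>k \<omega>. J k \<omega> - J' k \<omega>)"
    unfolding martingale_increment_def
  proof (intro conjI allI impI)
    show "(\<lambda>\<omega>. J k \<omega> - J' k \<omega>) \<in> borel_measurable M" for k
      using J(1)[of k] J'(1)[of k] by (auto simp: is_ito_integral_def)
  next
    fix k :: 'd and p :: nat
    show "(\<integral>\<^sup>+\<omega>. ennreal (norm (J k \<omega> - J' k \<omega>) ^ (2 * p)) \<partial>M) \<le> ennreal (moment_const p * (t - s) ^ p)"
      unfolding moment_const_def by (rule ito_increment_moment[OF J(1) J'(1) st V_bd])
  next
    fix k :: 'd and Y :: "'a \<Rightarrow> 'b"
    assume "Y \<in> borel_measurable (F s)" "L2 Y"
    from ito_increment_past_mean[OF J(1) J'(1) st V_bd this, of k]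
    show "integrable M (\<lambda>\<omega>. Y \<omega> \<bullet> (J k \<omega> - J' k \<omega>))" "expectation (\<lambda>\<omega>. Y \<omega> \<bullet> (J k \<omega> - J' k \<omega>)) = 0"
      by auto
  next
    fix k
    show "(\<integral>\<^sup>+\<omega>. ennreal ((norm (J k \<omega> - J' k \<omega> - dB k s t \<omega> *\<^sub>R V k (X s \<omega>)))\<^sup>2) \<partial>M)
       \<le> 4 * (\<integral>\<^sup>+\<omega>. (\<integral>\<^sup>+r. indicator {s..t} r * ennreal ((norm (V k (X r \<omega>) - V k (X s \<omega>)))\<^sup>2) \<partial>lborel) \<partial>M)"
      by (rule ito_increment_one_step[OF J(1) J'(1) st Vs bd])
  qed (rule ae)
  then show ?thesis by blast
qed

text \<open>Paths are continuous only almost surely, so the noise is jointly measurable only up to a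
  modification.\<close>

lemma noise_jointly_measurable:
  assumes sol: "sde_solution M F B U V x X" and ab: "0 \<le> a" "a \<le> b"
  obtains Y where "jmeas Y" "AE \<omega> in M. \<forall>r\<in>{a..b}. Y r \<omega> = noise X a r \<omega>"
proof -
  let ?N = "M \<Otimes>\<^sub>M (lborel :: real measure)"
  have "0 \<le> b" using ab by simp
  define W where "W p = (if snd p \<in> {0..b} then X (snd p) (fst p) else 0)" for p
  have W [measurable]: "W \<in> borel_measurable ?N"
    using progressive_measurable[OF solution_progressive[OF sol] \<open>0 \<le> b\<close>] unfolding W_def[abs_def]
    by (simp add: case_prod_beta')
  \<comment> \<open>The upper limit enters as a cutoff inside an integral over a fixed interval, so
    that measurability in both variables is that of a parameter integral.\<close>
  define I where "I p = (\<integral>u. indicator {a..b} u *\<^sub>R (if u \<le> snd p then U (W (fst p, u)) else 0) \<partial>lborel)" for p :: "'a \<times> real"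
  have I [measurable]: "I \<in> borel_measurable ?N"
    unfolding I_def[abs_def] by (rule lborel.borel_measurable_lebesgue_integral) measurable
  have Xa [measurable]: "X a \<in> borel_measurable M" by (rule solution_measurable[OF sol ab(1)])
  define Y where "Y r \<omega> = W (\<omega>, r) - X a \<omega> - I (\<omega>, r)" for r \<omega>
  have "jmeas Y"
    unfolding jmeas_def Y_def by measurable
  moreover have "AE \<omega> in M. \<forall>r\<in>{a..b}. Y r \<omega> = noise X a r \<omega>"
    using solution_continuous[OF sol]
  proof eventually_elim
    case (elim \<omega>)
    show ?case
    proof
      fix r assume r: "r \<in> {a..b}"
      have "I (\<omega>, r) = (LINT u:{a..r}|lborel. U (X u \<omega>))"
        unfolding I_def set_lebesgue_integral_def W_def using r ab
        by (intro Bochner_Integration.integral_cong) (auto simp: indicator_def)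
      also have "\<dots> = integral {a..r} (\<lambda>u. U (X u \<omega>))"
        by (intro set_borel_integral_eq_integral(2) borel_integrable_atLeastAtMost' continuous_drift_path[where X = X and \<omega> = \<omega>, OF elim ab(1)])
      finally show "Y r \<omega> = noise X a r \<omega>"
        using r ab by (simp add: Y_def noise_def W_def)
    qed
  qed
  ultimately show ?thesis by (rule that)
qed

lemma noise_moment:
  "\<exists>C>0. \<forall>x X s t. sde_solution M F B U V x X \<and> 0 \<le> s \<and> s \<le> t \<longrightarrow>
    (\<integral>\<^sup>+\<omega>. ennreal (norm (noise X s t \<omega>) ^ (2 * p)) \<partial>M) \<le> ennreal (C * (t - s) ^ p)"
proof -
  define D where "D = moment_const p"
  have "D > 0" by (simp add: D_def moment_const_def)
  define d where "d = real CARD('d)"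
  have "d > 0" by (simp add: d_def)
  \<comment> \<open>The summand 1 covers the case \<open>s = t\<close>, \<open>p = 0\<close>, where
    \<open>0 ^ 0 = 1\<close>.\<close>
  define C where "C = 1 + 2 ^ p * d ^ (2 * p) * d * D"
  have "C > 0" using \<open>D > 0\<close> \<open>d > 0\<close> by (simp add: C_def add_pos_nonneg)
  show ?thesis
  proof (intro exI[of _ C] conjI allI impI \<open>C > 0\<close>, goal_cases)
  case (1 x X s t)
  then have sol: "sde_solution M F B U V x X" and st: "0 \<le> s" "s \<le> t" by auto
  show "(\<integral>\<^sup>+\<omega>. ennreal (norm (noise X s t \<omega>) ^ (2 * p)) \<partial>M) \<le> ennreal (C * (t - s) ^ p)"
  proof (cases "s = t")
    case True
    then show ?thesis using \<open>D > 0\<close> \<open>d > 0\<close> by (cases "p = 0") (auto simp: noise_def C_def emeasure_space_1 power_0_left)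
  next
    case False
    then have st': "s < t" using st by simp
    obtain N where "martingale_increment X s t N"
      using martingale_increment_exists[OF sol st(1) st'] by (rule exE)
    then have N [measurable]: "\<And>k. N k \<in> borel_measurable M"
      and ae: "AE \<omega> in M. noise X s t \<omega> = sqrt 2 *\<^sub>R (\<Sum>k\<in>UNIV. N k \<omega>)"
      and mo: "\<And>k p. (\<integral>\<^sup>+\<omega>. ennreal (norm (N k \<omega>) ^ (2 * p)) \<partial>M) \<le> ennreal (moment_const p * (t - s) ^ p)"
      unfolding martingale_increment_def by simp_all
    have "(\<integral>\<^sup>+\<omega>. ennreal (norm (noise X s t \<omega>) ^ (2 * p)) \<partial>M)
      \<le> (\<integral>\<^sup>+\<omega>. ennreal (2 ^ p * d ^ (2 * p)) * (\<Sum>k\<in>UNIV. ennreal (norm (N k \<omega>) ^ (2 * p))) \<partial>M)"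
    proof (rule nn_integral_mono_AE)
      show "AE \<omega> in M. ennreal (norm (noise X s t \<omega>) ^ (2 * p)) \<le> ennreal (2 ^ p * d ^ (2 * p)) * (\<Sum>k\<in>UNIV. ennreal (norm (N k \<omega>) ^ (2 * p)))"
        using ae
      proof eventually_elim
        case (elim \<omega>)
        have "norm (noise X s t \<omega>) ^ (2 * p) = 2 ^ p * norm (\<Sum>k\<in>UNIV. N k \<omega>) ^ (2 * p)"
          unfolding elim by (simp add: power_mult_distrib power_mult)
        also have "\<dots> \<le> 2 ^ p * (d ^ (2 * p) * (\<Sum>k\<in>UNIV. norm (N k \<omega>) ^ (2 * p)))"
          unfolding d_def by (intro mult_left_mono norm_sum_power_le) auto
        finally have "ennreal (norm (noise X s t \<omega>) ^ (2 * p)) \<le> ennreal (2 ^ p * d ^ (2 * p) * (\<Sum>k\<in>UNIV. norm (N k \<omega>) ^ (2 * p)))"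
          by (intro ennreal_leI) (simp add: mult.assoc)
        also have "\<dots> = ennreal (2 ^ p * d ^ (2 * p)) * (\<Sum>k\<in>UNIV. ennreal (norm (N k \<omega>) ^ (2 * p)))"
          using \<open>d > 0\<close> by (subst ennreal_mult) (auto simp: sum_nonneg sum_ennreal)
        finally show ?case .
      qed
    qed
    also have "\<dots> = ennreal (2 ^ p * d ^ (2 * p)) * (\<Sum>k\<in>UNIV. (\<integral>\<^sup>+\<omega>. ennreal (norm (N k \<omega>) ^ (2 * p)) \<partial>M))"
      by (subst nn_integral_cmult, measurable, subst nn_integral_sum) simp_all
    also have "\<dots> \<le> ennreal (2 ^ p * d ^ (2 * p)) * (\<Sum>k\<in>(UNIV::'d set). ennreal (D * (t - s) ^ p))"
      unfolding D_def by (intro mult_left_mono sum_mono mo) simp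
    also have "(\<Sum>k\<in>(UNIV::'d set). ennreal (D * (t - s) ^ p)) = ennreal (d * (D * (t - s) ^ p))"
      using \<open>D > 0\<close> st by (subst sum_ennreal) (auto simp: d_def)
    also have "ennreal (2 ^ p * d ^ (2 * p)) * \<dots> = ennreal (2 ^ p * d ^ (2 * p) * (d * (D * (t - s) ^ p)))"
      using \<open>D > 0\<close> \<open>d > 0\<close> st by (intro ennreal_mult[symmetric]) auto
    also have "\<dots> \<le> ennreal (C * (t - s) ^ p)"
      using st by (intro ennreal_leI) (simp add: C_def algebra_simps)
    finally show ?thesis .
  qed
  qed
qed

lemma nn_integral_swap:
  fixes f :: "'a \<Rightarrow> real \<Rightarrow> ennreal"
  assumes "(\<lambda>(\<omega>, r). f \<omega> r) \<in> borel_measurable (M \<Otimes>\<^sub>M lborel)"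
  shows "(\<integral>\<^sup>+\<omega>. (\<integral>\<^sup>+r. f \<omega> r \<partial>lborel) \<partial>M) = (\<integral>\<^sup>+r. (\<integral>\<^sup>+\<omega>. f \<omega> r \<partial>M) \<partial>lborel)"
proof -
  interpret pair_sigma_finite M "lborel :: real measure" ..
  show ?thesis using Fubini'[OF assms] by simp
qed

lemma nn_integral_interval_le:
  assumes "\<And>r. r \<in> {a..b} \<Longrightarrow> f r \<le> ennreal C" "a \<le> b" "0 \<le> C"
  shows "(\<integral>\<^sup>+r. indicator {a..b} r * f r \<partial>lborel) \<le> ennreal (C * (b - a))"
proof -
  have "(\<integral>\<^sup>+r. indicator {a..b} r * f r \<partial>lborel) \<le> (\<integral>\<^sup>+r. ennreal C * indicator {a..b} r \<partial>lborel)"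
    using assms(1) by (intro nn_integral_mono) (auto simp: indicator_def)
  also have "\<dots> = ennreal (C * (b - a))"
    using assms by (subst nn_integral_cmult_indicator) (auto simp: ennreal_mult)
  finally show ?thesis .
qed

text \<open>Noise moments grow with the length of the interval, so the pathwise bound is used only
  on intervals of length at most 1. The factor exp (m l / 2) > 1 is the price for adding the noise
  to the damped part; over a full unit of time the damping exp (- m l) outweighs it.\<close>

lemma moment_step:
  assumes m: "m > 0"
  shows "\<exists>C>0. \<forall>x X a b. sde_solution M F B U V x X \<and> 0 \<le> a \<and> a \<le> b \<and> b \<le> a + 1 \<longrightarrow>
    (\<integral>\<^sup>+\<omega>. ennreal (norm (X b \<omega>) ^ (2 * m)) \<partial>M)
    \<le> ennreal (exp (real m * l / 2) * exp (- (real m * l) * (b - a))) * (\<integral>\<^sup>+\<omega>. ennreal (norm (X a \<omega>) ^ (2 * m)) \<partial>M)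
      + ennreal C"
proof -
  define \<kappa> where "\<kappa> = exp (real m * l / 2)"
  have \<kappa>: "\<kappa> > 1" using m pos by (simp add: \<kappa>_def)
  obtain C1 where C1: "C1 > 0" "\<And>a b::real. a \<ge> 0 \<Longrightarrow> b \<ge> 0 \<Longrightarrow> (a + b) ^ (2 * m) \<le> (1 + (\<kappa> - 1)) * a ^ (2 * m) + C1 * b ^ (2 * m)"
    using power_add_le_eps[of "\<kappa> - 1" "2 * m"] \<kappa> m by auto
  obtain Cu p where Cu: "Cu > 0" "\<And>y. norm (U y) ^ (2 * m) \<le> Cu * (1 + norm y ^ (2 * p))"
    using U_power_growth[of m] by auto
  obtain Cp where Cp: "Cp > 0" "\<And>x X s t. sde_solution M F B U V x X \<Longrightarrow> 0 \<le> s \<Longrightarrow> s \<le> t \<Longrightarrow>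
    (\<integral>\<^sup>+\<omega>. ennreal (norm (noise X s t \<omega>) ^ (2 * p)) \<partial>M) \<le> ennreal (Cp * (t - s) ^ p)"
    using noise_moment[of p] by blast
  obtain Cm where Cm: "Cm > 0" "\<And>x X s t. sde_solution M F B U V x X \<Longrightarrow> 0 \<le> s \<Longrightarrow> s \<le> t \<Longrightarrow>
    (\<integral>\<^sup>+\<omega>. ennreal (norm (noise X s t \<omega>) ^ (2 * m)) \<partial>M) \<le> ennreal (Cm * (t - s) ^ m)"
    using noise_moment[of m] by blast
  define D where "D = 2 * real m * (2 / l) ^ (2 * m - 1)"
  have D: "D > 0" using m pos by (simp add: D_def)
  define C where "C = \<kappa> * D * (Cu * (1 + Cp)) + C1 * Cm"
  have C: "C > 0" using \<kappa> D Cu Cp C1 Cm by (simp add: C_def add_pos_pos)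
  show ?thesis
  proof (intro exI[of _ C] conjI allI impI C, goal_cases)
    case (1 x X a b)
    then have sol: "sde_solution M F B U V x X" and ab: "0 \<le> a" "a \<le> b" "b \<le> a + 1" by auto
    obtain Y where Y: "jmeas Y" "AE \<omega> in M. \<forall>r\<in>{a..b}. Y r \<omega> = noise X a r \<omega>"
      by (rule noise_jointly_measurable[OF sol ab(1,2)])
    have Yj [measurable]: "(\<lambda>p. Y (snd p) (fst p)) \<in> borel_measurable (M \<Otimes>\<^sub>M lborel)"
      using Y(1) by (simp add: jmeas_def case_prod_beta')
    have Yr [measurable]: "Y r \<in> borel_measurable M" for r
      using measurable_compose[OF _ Yj, of "\<lambda>\<omega>. (\<omega>, r)" M] by simp
    have [measurable]: "X a \<in> borel_measurable M"
      by (rule solution_measurable[OF sol ab(1)])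
    \<comment> \<open>Written with the version \<open>Y\<close>, the time integral is measurable in
      \<omega>; on continuous paths it is the integral that occurs in
      \<open>pathwise_bound\<close>.\<close>
    define G where "G \<omega> = (\<integral>\<^sup>+r. indicator {a..b} r * ennreal (norm (U (Y r \<omega>)) ^ (2 * m)) \<partial>lborel)" for \<omega>
    have jG: "(\<lambda>(\<omega>, r). indicator {a..b} r * ennreal (norm (U (Y r \<omega>)) ^ (2 * m))) \<in> borel_measurable (M \<Otimes>\<^sub>M lborel)"
      unfolding case_prod_beta' by measurable
    have Gm [measurable]: "G \<in> borel_measurable M"
      unfolding G_def[abs_def] using jG by (intro lborel.borel_measurable_nn_integral) simp
    have EU: "(\<integral>\<^sup>+\<omega>. ennreal (norm (U (Y r \<omega>)) ^ (2 * m)) \<partial>M) \<le> ennreal (Cu * (1 + Cp))" if r: "r \<in> {a..b}" for r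
    proof -
      have "(\<integral>\<^sup>+\<omega>. ennreal (norm (U (Y r \<omega>)) ^ (2 * m)) \<partial>M)
        \<le> (\<integral>\<^sup>+\<omega>. ennreal Cu * (1 + ennreal (norm (noise X a r \<omega>) ^ (2 * p))) \<partial>M)"
      proof (rule nn_integral_mono_AE)
        show "AE \<omega> in M. ennreal (norm (U (Y r \<omega>)) ^ (2 * m)) \<le> ennreal Cu * (1 + ennreal (norm (noise X a r \<omega>) ^ (2 * p)))"
          using Y(2)
        proof eventually_elim
          case (elim \<omega>)
          then have "Y r \<omega> = noise X a r \<omega>" using r by blast
          then show ?case
            using ennreal_leI[OF Cu(2)[of "noise X a r \<omega>"]] Cu(1) by (simp add: ennreal_mult)
        qed
      qed
      also have "\<dots> = (\<integral>\<^sup>+\<omega>. ennreal Cu * (1 + ennreal (norm (Y r \<omega>) ^ (2 * p))) \<partial>M)"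
      proof (rule nn_integral_cong_AE)
        show "AE \<omega> in M. ennreal Cu * (1 + ennreal (norm (noise X a r \<omega>) ^ (2 * p))) = ennreal Cu * (1 + ennreal (norm (Y r \<omega>) ^ (2 * p)))"
          using Y(2) by eventually_elim (use r in simp)
      qed
      also have "\<dots> = ennreal Cu * (1 + (\<integral>\<^sup>+\<omega>. ennreal (norm (Y r \<omega>) ^ (2 * p)) \<partial>M))"
        by (subst nn_integral_cmult, measurable, subst nn_integral_add) (simp_all add: emeasure_space_1)
      also have "(\<integral>\<^sup>+\<omega>. ennreal (norm (Y r \<omega>) ^ (2 * p)) \<partial>M) = (\<integral>\<^sup>+\<omega>. ennreal (norm (noise X a r \<omega>) ^ (2 * p)) \<partial>M)"
      proof (rule nn_integral_cong_AE)
        show "AE \<omega> in M. ennreal (norm (Y r \<omega>) ^ (2 * p)) = ennreal (norm (noise X a r \<omega>) ^ (2 * p))"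
          using Y(2) by eventually_elim (use r in simp)
      qed
      also have "\<dots> \<le> ennreal (Cp * (r - a) ^ p)"
        using Cp(2)[OF sol ab(1)] r by simp
      also have "\<dots> \<le> ennreal (Cp * 1)"
        using r ab Cp(1) by (intro ennreal_leI mult_left_mono power_le_one) auto
      also have "ennreal Cu * (1 + ennreal (Cp * 1)) = ennreal (Cu * (1 + Cp))"
        using Cu(1) Cp(1) by (simp add: ennreal_mult)
      finally show ?thesis by (auto simp: add_left_mono mult_left_mono)
    qed
    have EG: "(\<integral>\<^sup>+\<omega>. G \<omega> \<partial>M) \<le> ennreal (Cu * (1 + Cp))"
    proof -
      have "(\<integral>\<^sup>+\<omega>. G \<omega> \<partial>M) = (\<integral>\<^sup>+r. (\<integral>\<^sup>+\<omega>. indicator {a..b} r * ennreal (norm (U (Y r \<omega>)) ^ (2 * m)) \<partial>M) \<partial>lborel)"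
        unfolding G_def by (rule nn_integral_swap[OF jG])
      also have "\<dots> = (\<integral>\<^sup>+r. indicator {a..b} r * (\<integral>\<^sup>+\<omega>. ennreal (norm (U (Y r \<omega>)) ^ (2 * m)) \<partial>M) \<partial>lborel)"
        by (simp add: nn_integral_cmult)
      also have "\<dots> \<le> ennreal (Cu * (1 + Cp) * (b - a))"
        using Cu Cp ab by (intro nn_integral_interval_le EU) auto
      also have "\<dots> \<le> ennreal (Cu * (1 + Cp))"
        using Cu Cp ab by (intro ennreal_leI mult_left_le) auto
      finally show ?thesis .
    qed
    have Eb: "(\<integral>\<^sup>+\<omega>. ennreal (norm (Y b \<omega>) ^ (2 * m)) \<partial>M) \<le> ennreal Cm"
    proof -
      have "(\<integral>\<^sup>+\<omega>. ennreal (norm (Y b \<omega>) ^ (2 * m)) \<partial>M) = (\<integral>\<^sup>+\<omega>. ennreal (norm (noise X a b \<omega>) ^ (2 * m)) \<partial>M)"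
      proof (rule nn_integral_cong_AE)
        show "AE \<omega> in M. ennreal (norm (Y b \<omega>) ^ (2 * m)) = ennreal (norm (noise X a b \<omega>) ^ (2 * m))"
          using Y(2) by eventually_elim (use ab in simp)
      qed
      also have "\<dots> \<le> ennreal (Cm * (b - a) ^ m)"
        using Cm(2)[OF sol ab(1,2)] .
      also have "\<dots> \<le> ennreal (Cm * 1)"
        using ab Cm(1) by (intro ennreal_leI mult_left_mono power_le_one) auto
      finally show ?thesis by simp
    qed
    let ?e = "exp (- (real m * l) * (b - a))"
    have "(\<integral>\<^sup>+\<omega>. ennreal (norm (X b \<omega>) ^ (2 * m)) \<partial>M)
      \<le> (\<integral>\<^sup>+\<omega>. ennreal (\<kappa> * ?e) * ennreal (norm (X a \<omega>) ^ (2 * m)) + (ennreal (\<kappa> * D) * G \<omega> + ennreal C1 * ennreal (norm (Y b \<omega>) ^ (2 * m))) \<partial>M)"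
    proof (rule nn_integral_mono_AE)
      show "AE \<omega> in M. ennreal (norm (X b \<omega>) ^ (2 * m))
        \<le> ennreal (\<kappa> * ?e) * ennreal (norm (X a \<omega>) ^ (2 * m)) + (ennreal (\<kappa> * D) * G \<omega> + ennreal C1 * ennreal (norm (Y b \<omega>) ^ (2 * m)))"
        using Y(2) solution_continuous[OF sol]
      proof eventually_elim
        case (elim \<omega>)
        have cw: "continuous_on {a..b} (\<lambda>r. X r \<omega>)"
          by (rule continuous_on_subset[OF elim(2)]) (use ab in auto)
        let ?I = "integral {a..b} (\<lambda>r. norm (U (noise X a r \<omega>)) ^ (2 * m))"
        note pw = pathwise_bound[OF ab(2) cw m, folded noise_def D_def]
        have cg: "continuous_on {a..b} (\<lambda>r. norm (U (noise X a r \<omega>)) ^ (2 * m))"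
          by (intro continuous_intros continuous_on_compose2[OF U_cont pw(2)]) auto
        have GI: "G \<omega> = ennreal ?I"
        proof -
          have "G \<omega> = (\<integral>\<^sup>+r. indicator {a..b} r * ennreal (norm (U (noise X a r \<omega>)) ^ (2 * m)) \<partial>lborel)"
            unfolding G_def using elim(1) by (intro nn_integral_cong) (auto simp: indicator_def)
          also have "\<dots> = ennreal ?I"
            by (rule nn_integral_indicator_continuous[OF cg]) simp
          finally show ?thesis .
        qed
        have I0: "0 \<le> ?I" by (rule integral_nonneg[OF integrable_continuous_real[OF cg]]) simp
        have "norm (X b \<omega>) ^ (2 * m) \<le> (norm (X b \<omega> - noise X a b \<omega>) + norm (noise X a b \<omega>)) ^ (2 * m)"
          by (intro power_mono) (metis add.commute norm_triangle_sub, simp)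
        also have "\<dots> \<le> (1 + (\<kappa> - 1)) * norm (X b \<omega> - noise X a b \<omega>) ^ (2 * m) + C1 * norm (noise X a b \<omega>) ^ (2 * m)"
          by (rule C1(2)) simp_all
        also have "\<dots> \<le> \<kappa> * (?e * norm (X a \<omega>) ^ (2 * m) + D * ?I) + C1 * norm (noise X a b \<omega>) ^ (2 * m)"
        proof -
          have "\<kappa> * norm (X b \<omega> - noise X a b \<omega>) ^ (2 * m) \<le> \<kappa> * (?e * norm (X a \<omega>) ^ (2 * m) + D * ?I)"
            using \<kappa> by (intro mult_left_mono pw(1)) simp
          then show ?thesis by simp
        qed
        also have "noise X a b \<omega> = Y b \<omega>" using elim(1) ab by simp
        finally have "ennreal (norm (X b \<omega>) ^ (2 * m)) \<le> ennreal (\<kappa> * (?e * norm (X a \<omega>) ^ (2 * m) + D * ?I) + C1 * norm (Y b \<omega>) ^ (2 * m))"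
          by (rule ennreal_leI)
        also have "\<kappa> * (?e * norm (X a \<omega>) ^ (2 * m) + D * ?I) + C1 * norm (Y b \<omega>) ^ (2 * m)
          = (\<kappa> * ?e) * norm (X a \<omega>) ^ (2 * m) + ((\<kappa> * D) * ?I + C1 * norm (Y b \<omega>) ^ (2 * m))"
          by (simp only: distrib_left mult.assoc add.assoc)
        also have "ennreal \<dots> = ennreal (\<kappa> * ?e) * ennreal (norm (X a \<omega>) ^ (2 * m)) + (ennreal (\<kappa> * D) * G \<omega> + ennreal C1 * ennreal (norm (Y b \<omega>) ^ (2 * m)))"
        proof -
          have e1: "ennreal (u * v) = ennreal u * ennreal v" if "0 \<le> u" "0 \<le> v" for u v
            using that by (rule ennreal_mult)
          have nn: "0 \<le> \<kappa> * ?e" "0 \<le> \<kappa> * D" "0 \<le> C1" "0 \<le> norm (X a \<omega>) ^ (2 * m)" "0 \<le> norm (Y b \<omega>) ^ (2 * m)"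
            using \<kappa> D C1 by auto
          show ?thesis
            unfolding GI e1[OF nn(1,4), symmetric] e1[OF nn(2) I0, symmetric] e1[OF nn(3,5), symmetric]
            using nn I0 by (simp only: ennreal_plus[symmetric] add_nonneg_nonneg mult_nonneg_nonneg)
        qed
        finally show ?case .
      qed
    qed
    also have "\<dots> = ennreal (\<kappa> * ?e) * (\<integral>\<^sup>+\<omega>. ennreal (norm (X a \<omega>) ^ (2 * m)) \<partial>M) + (ennreal (\<kappa> * D) * (\<integral>\<^sup>+\<omega>. G \<omega> \<partial>M) + ennreal C1 * (\<integral>\<^sup>+\<omega>. ennreal (norm (Y b \<omega>) ^ (2 * m)) \<partial>M))"
      by (subst nn_integral_add, measurable, subst nn_integral_add, measurable) (simp add: nn_integral_cmult)
    also have "\<dots> \<le> ennreal (\<kappa> * ?e) * (\<integral>\<^sup>+\<omega>. ennreal (norm (X a \<omega>) ^ (2 * m)) \<partial>M) + (ennreal (\<kappa> * D) * ennreal (Cu * (1 + Cp)) + ennreal C1 * ennreal Cm)"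
      by (intro add_mono mult_left_mono EG Eb order_refl) simp_all
    also have "ennreal (\<kappa> * D) * ennreal (Cu * (1 + Cp)) + ennreal C1 * ennreal Cm = ennreal C"
      using \<kappa> D Cu(1) Cp(1) C1(1) Cm(1) by (simp add: C_def ennreal_mult[symmetric] ennreal_plus[symmetric] del: ennreal_plus)
    finally show ?case unfolding \<kappa>_def .
  qed
qed

text \<open>A time \<open>t\<close> is reached by one fractional step followed by unit steps. The
  factor of the fractional step may exceed 1 but occurs once; each unit step contracts by exp (- m l
  / 2), which makes the bound uniform in time.\<close>

lemma even_moment_bound:
  assumes m: "m > 0"
  shows "\<exists>C>0. \<forall>x X t. sde_solution M F B U V x X \<and> 0 \<le> t \<longrightarrow>
    (\<integral>\<^sup>+\<omega>. ennreal (norm (X t \<omega>) ^ (2 * m)) \<partial>M) \<le> ennreal (C * (1 + norm x) ^ (2 * m))"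
proof -
  obtain C where C: "C > 0" and step: "\<And>x X a b. sde_solution M F B U V x X \<Longrightarrow> 0 \<le> a \<Longrightarrow> a \<le> b \<Longrightarrow> b \<le> a + 1 \<Longrightarrow>
    (\<integral>\<^sup>+\<omega>. ennreal (norm (X b \<omega>) ^ (2 * m)) \<partial>M)
    \<le> ennreal (exp (real m * l / 2) * exp (- (real m * l) * (b - a))) * (\<integral>\<^sup>+\<omega>. ennreal (norm (X a \<omega>) ^ (2 * m)) \<partial>M)
      + ennreal C"
    using moment_step[OF m] by blast
  define \<kappa> where "\<kappa> = exp (real m * l / 2)"
  define \<rho> where "\<rho> = exp (- (real m * l / 2))"
  have \<kappa>: "\<kappa> > 1" using m pos by (simp add: \<kappa>_def)
  have \<rho>: "0 < \<rho>" "\<rho> < 1" using m pos by (auto simp: \<rho>_def)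
  have \<kappa>\<rho>: "exp (real m * l / 2) * exp (- (real m * l)) = \<rho>"
    by (simp add: \<rho>_def exp_add[symmetric])
  define C' where "C' = \<kappa> + C / (1 - \<rho>) + C"
  have C': "C' > 0" using \<kappa> \<rho> C by (simp add: C'_def add_pos_pos)
  show ?thesis
  proof (intro exI[of _ C'] conjI allI impI C', goal_cases)
    case (1 x X t)
    then have sol: "sde_solution M F B U V x X" and t: "0 \<le> t" by auto
    define R where "R = (1 + norm x) ^ (2 * m)"
    have R: "1 \<le> R" "norm x ^ (2 * m) \<le> R"
      unfolding R_def by (auto intro!: one_le_power power_mono)
    \<comment> \<open>The summand \<open>C / (1 - \<rho>)\<close> ensures
      \<open>\<rho> * L + C \<le> L\<close>, which is what a unit step needs; the other two summands
      cover the fractional first step.\<close>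
    define L where "L = \<kappa> * R + C / (1 - \<rho>) + C"
    have L0: "0 \<le> L" using \<kappa> \<rho> C R by (simp add: L_def add_nonneg_nonneg)
    define n where "n = nat \<lfloor>t\<rfloor>"
    define s where "s = t - real n"
    have s: "0 \<le> s" "s \<le> 1" using t by (auto simp: s_def n_def) linarith
    have "(\<integral>\<^sup>+\<omega>. ennreal (norm (X (s + real j) \<omega>) ^ (2 * m)) \<partial>M) \<le> ennreal L" for j
    proof (induction j)
      case 0
      have "(\<integral>\<^sup>+\<omega>. ennreal (norm (X 0 \<omega>) ^ (2 * m)) \<partial>M) = (\<integral>\<^sup>+\<omega>. ennreal (norm x ^ (2 * m)) \<partial>M)"
        using solution_start[OF sol] by (intro nn_integral_cong_AE) auto
      then have 0: "(\<integral>\<^sup>+\<omega>. ennreal (norm (X 0 \<omega>) ^ (2 * m)) \<partial>M) = ennreal (norm x ^ (2 * m))"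
        by (simp add: emeasure_space_1)
      have "(\<integral>\<^sup>+\<omega>. ennreal (norm (X s \<omega>) ^ (2 * m)) \<partial>M)
        \<le> ennreal (exp (real m * l / 2) * exp (- (real m * l) * (s - 0))) * ennreal (norm x ^ (2 * m)) + ennreal C"
        using step[OF sol order_refl s(1)] s(2) unfolding 0 by simp
      also have "\<dots> \<le> ennreal \<kappa> * ennreal R + ennreal C"
      proof (intro add_mono mult_mono ennreal_leI R(2) order_refl)
        have "exp (- (real m * l) * (s - 0)) \<le> 1"
          using s pos by simp
        then show "exp (real m * l / 2) * exp (- (real m * l) * (s - 0)) \<le> \<kappa>"
          unfolding \<kappa>_def by (intro mult_left_le) auto
      qed simp_all
      also have "\<dots> = ennreal (\<kappa> * R + C)"
        using \<kappa> R C by (simp add: ennreal_mult)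
      also have "\<dots> \<le> ennreal L"
        using \<rho> C by (intro ennreal_leI) (simp add: L_def)
      finally show ?case by simp
    next
      case (Suc j)
      have "(\<integral>\<^sup>+\<omega>. ennreal (norm (X (s + real (Suc j)) \<omega>) ^ (2 * m)) \<partial>M)
        \<le> ennreal \<rho> * (\<integral>\<^sup>+\<omega>. ennreal (norm (X (s + real j) \<omega>) ^ (2 * m)) \<partial>M) + ennreal C"
        using step[OF sol, of "s + real j" "s + real (Suc j)"] s(1) \<kappa>\<rho> by (simp add: algebra_simps)
      also have "\<dots> \<le> ennreal \<rho> * ennreal L + ennreal C"
        by (intro add_mono mult_left_mono Suc.IH order_refl) simp
      also have "\<dots> = ennreal (\<rho> * L + C)"
        using \<rho> L0 C by (simp add: ennreal_mult)
      also have "\<dots> \<le> ennreal L"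
      proof (rule ennreal_leI)
        have "C / (1 - \<rho>) \<le> L" using \<kappa> R C by (simp add: L_def)
        then have "C \<le> L * (1 - \<rho>)" using \<rho> by (simp add: pos_divide_le_eq)
        then show "\<rho> * L + C \<le> L" by (simp add: algebra_simps)
      qed
      finally show ?case .
    qed
    from this[of n] have "(\<integral>\<^sup>+\<omega>. ennreal (norm (X t \<omega>) ^ (2 * m)) \<partial>M) \<le> ennreal L"
      by (simp add: s_def)
    also have "L \<le> C' * R"
    proof -
      have "0 \<le> C / (1 - \<rho>) + C"
        using C \<rho> by (simp add: add_nonneg_nonneg)
      from mult_left_mono[OF R(1) this] have "C / (1 - \<rho>) + C \<le> (C / (1 - \<rho>) + C) * R"
        by simp
      then show ?thesis by (simp add: L_def C'_def distrib_right)
    qed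
    finally show ?case by (simp add: R_def ennreal_leI)
  qed
qed

lemma moment_bound:
  assumes "p \<ge> 0"
  shows "\<exists>C>0. \<forall>x X t. sde_solution M F B U V x X \<and> 0 \<le> t \<longrightarrow>
    (\<integral>\<^sup>+\<omega>. ennreal ((1 + norm (X t \<omega>)) powr p) \<partial>M) \<le> ennreal (C * (1 + norm x) powr p)"
proof -
  define m where "m = nat \<lceil>p\<rceil> + 1"
  have m: "m > 0" "p \<le> real (2 * m)"
    using real_nat_ceiling_ge[of p] by (auto simp: m_def)
  obtain C where C: "C > 0" and bd: "\<And>x X t. sde_solution M F B U V x X \<Longrightarrow> 0 \<le> t \<Longrightarrow>
    (\<integral>\<^sup>+\<omega>. ennreal (norm (X t \<omega>) ^ (2 * m)) \<partial>M) \<le> ennreal (C * (1 + norm x) ^ (2 * m))"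
    using even_moment_bound[OF m(1)] by blast
  define C' where "C' = 1 + 2 ^ (2 * m) * (1 + C)"
  have C': "C' > 0" using C by (simp add: C'_def add_pos_nonneg)
  show ?thesis
  proof (intro exI[of _ C'] conjI allI impI C', goal_cases)
    case (1 x X t)
    then have sol: "sde_solution M F B U V x X" and t: "0 \<le> t" by auto
    have [measurable]: "X t \<in> borel_measurable M"
      by (rule solution_measurable[OF sol t])
    \<comment> \<open>\<open>R\<close> is the scale of the solution: dividing by it turns the even
      moment bound \<open>C * R ^ (2 * m)\<close> into a constant, so that the result has order
      \<open>R powr p\<close>.\<close>
    define R where "R = 1 + norm x"
    have R: "1 \<le> R" by (simp add: R_def)
    define Rp where "Rp = R powr p"
    have Rp: "0 \<le> Rp" by (simp add: Rp_def)
    define a where "a = 2 ^ (2 * m) / R ^ (2 * m)"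
    have a: "0 \<le> a" using R by (simp add: a_def)
    have pt: "(1 + norm (X t \<omega>)) powr p \<le> Rp * (1 + a) + Rp * a * norm (X t \<omega>) ^ (2 * m)" for \<omega>
    proof -
      have "(1 + norm (X t \<omega>)) powr p \<le> R powr p * (1 + ((1 + norm (X t \<omega>)) / R) ^ (2 * m))"
        using R assms m by (intro powr_le_normalized_even_power) auto
      also have "\<dots> \<le> Rp * (1 + a * (1 + norm (X t \<omega>) ^ (2 * m)))"
      proof -
        have "(1 + norm (X t \<omega>)) ^ (2 * m) \<le> 2 ^ (2 * m) * (1 ^ (2 * m) + norm (X t \<omega>) ^ (2 * m))"
          by (rule add_power_le) simp_all
        then have "((1 + norm (X t \<omega>)) / R) ^ (2 * m) \<le> a * (1 + norm (X t \<omega>) ^ (2 * m))"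
          using R by (simp add: power_divide a_def divide_right_mono)
        then show ?thesis unfolding Rp_def[symmetric] using Rp by (intro mult_left_mono) simp_all
      qed
      finally show ?thesis by (simp add: algebra_simps)
    qed
    have "(\<integral>\<^sup>+\<omega>. ennreal ((1 + norm (X t \<omega>)) powr p) \<partial>M)
      \<le> (\<integral>\<^sup>+\<omega>. ennreal (Rp * (1 + a)) + ennreal (Rp * a) * ennreal (norm (X t \<omega>) ^ (2 * m)) \<partial>M)"
    proof (rule nn_integral_mono)
      fix \<omega>
      show "ennreal ((1 + norm (X t \<omega>)) powr p) \<le> ennreal (Rp * (1 + a)) + ennreal (Rp * a) * ennreal (norm (X t \<omega>) ^ (2 * m))"
        using ennreal_leI[OF pt[of \<omega>]] Rp a
        by (simp add: ennreal_mult[symmetric] ennreal_plus[symmetric] del: ennreal_plus)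
    qed
    also have "\<dots> = ennreal (Rp * (1 + a)) + ennreal (Rp * a) * (\<integral>\<^sup>+\<omega>. ennreal (norm (X t \<omega>) ^ (2 * m)) \<partial>M)"
      by (subst nn_integral_add) (simp_all add: nn_integral_cmult emeasure_space_1)
    also have "\<dots> \<le> ennreal (Rp * (1 + a)) + ennreal (Rp * a) * ennreal (C * R ^ (2 * m))"
      unfolding R_def by (intro add_left_mono mult_left_mono bd[OF sol t]) simp
    also have "\<dots> = ennreal (Rp * (1 + a) + Rp * a * (C * R ^ (2 * m)))"
      using Rp a C R by (simp add: ennreal_mult[symmetric] ennreal_plus[symmetric] del: ennreal_plus)
    also have "\<dots> \<le> ennreal (C' * Rp)"
    proof (rule ennreal_leI)
      have "a \<le> 2 ^ (2 * m)"
        unfolding a_def using R by (simp add: divide_le_eq mult_le_cancel_left1 one_le_power)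
      moreover have "a * R ^ (2 * m) = 2 ^ (2 * m)" using R by (simp add: a_def)
      ultimately have "1 + a + C * (a * R ^ (2 * m)) \<le> C'"
        by (simp add: C'_def algebra_simps)
      then have "Rp * (1 + a + C * (a * R ^ (2 * m))) \<le> Rp * C'"
        by (rule mult_left_mono) (rule Rp)
      then show "Rp * (1 + a) + Rp * a * (C * R ^ (2 * m)) \<le> C' * Rp"
        by (simp add: algebra_simps)
    qed
    finally show ?case by (simp add: Rp_def R_def)
  qed
qed

end

section \<open>Local errors\<close>

lemma norm_integral_sq_le:
  fixes f :: "real \<Rightarrow> 'b::euclidean_space"
  assumes "a \<le> b" and f: "continuous_on {a..b} f"
  shows "(norm (integral {a..b} f))\<^sup>2 \<le> (b - a) * integral {a..b} (\<lambda>r. (norm (f r))\<^sup>2)"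
proof (cases "a = b")
  case False
  define h where "h = b - a"
  have h: "h > 0" using assms(1) False by (simp add: h_def)
  define A where "A = integral {a..b} (\<lambda>r. norm (f r))"
  define S where "S = integral {a..b} (\<lambda>r. (norm (f r))\<^sup>2)"
  have i0: "f integrable_on {a..b}" and i1: "(\<lambda>r. norm (f r)) integrable_on {a..b}"
    and i2: "(\<lambda>r. (norm (f r))\<^sup>2) integrable_on {a..b}"
    by (intro integrable_continuous_real continuous_intros f)+
  have "norm (integral {a..b} f) \<le> A"
    unfolding A_def by (rule integral_norm_bound_integral[OF i0 i1]) simp
  then have 1: "(norm (integral {a..b} f))\<^sup>2 \<le> A\<^sup>2" by (intro power_mono) simp_all
  \<comment> \<open>Cauchy-Schwarz in time, by integrating Young's inequality between the norm and
    its mean value \<open>A / h\<close>.\<close>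
  have "integral {a..b} (\<lambda>r. (2 * (A / h)) * norm (f r)) \<le> integral {a..b} (\<lambda>r. (norm (f r))\<^sup>2 + (A / h)\<^sup>2)"
  proof (rule integral_le)
    show "(\<lambda>r. (2 * (A / h)) * norm (f r)) integrable_on {a..b}" "(\<lambda>r. (norm (f r))\<^sup>2 + (A / h)\<^sup>2) integrable_on {a..b}"
      by (intro integrable_continuous_real continuous_intros f)+
    show "(2 * (A / h)) * norm (f r) \<le> (norm (f r))\<^sup>2 + (A / h)\<^sup>2" for r
      using sum_squares_bound[of "norm (f r)" "A / h"] by (simp add: mult.commute mult.left_commute)
  qed
  also have "\<dots> = S + h * (A / h)\<^sup>2"
    unfolding S_def using assms(1) by (subst Henstock_Kurzweil_Integration.integral_add[OF i2]) (simp_all add: h_def integrable_const_ivl)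
  also have "integral {a..b} (\<lambda>r. (2 * (A / h)) * norm (f r)) = 2 * (A / h) * A"
    by (simp add: A_def)
  finally have "2 * (A\<^sup>2 / h) \<le> S + A\<^sup>2 / h"
    using h by (simp add: power2_eq_square)
  then have "A\<^sup>2 \<le> h * S"
    using h by (simp add: field_simps)
  with 1 show ?thesis by (simp add: h_def S_def)
qed simp

lemma ennreal_norm_integral_sq_le:
  fixes f :: "real \<Rightarrow> 'b::euclidean_space"
  assumes "a \<le> b" and f: "continuous_on {a..b} f"
  shows "ennreal ((norm (integral {a..b} f))\<^sup>2) \<le> ennreal (b - a) * (\<integral>\<^sup>+r. indicator {a..b} r * ennreal ((norm (f r))\<^sup>2) \<partial>lborel)"
proof -
  have c: "continuous_on {a..b} (\<lambda>r. (norm (f r))\<^sup>2)" by (intro continuous_intros f)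
  have "0 \<le> integral {a..b} (\<lambda>r. (norm (f r))\<^sup>2)"
    by (rule integral_nonneg[OF integrable_continuous_real[OF c]]) simp
  moreover have "ennreal ((norm (integral {a..b} f))\<^sup>2) \<le> ennreal ((b - a) * integral {a..b} (\<lambda>r. (norm (f r))\<^sup>2))"
    by (rule ennreal_leI[OF norm_integral_sq_le[OF assms]])
  ultimately show ?thesis
    using assms(1) by (subst nn_integral_indicator_continuous[OF c]) (simp_all add: ennreal_mult)
qed

lemma norm_integral_fourth_le:
  fixes f :: "real \<Rightarrow> 'b::euclidean_space"
  assumes "a \<le> b" and f: "continuous_on {a..b} f"
  shows "norm (integral {a..b} f) ^ 4 \<le> (b - a) ^ 3 * integral {a..b} (\<lambda>r. norm (f r) ^ 4)"
proof -
  let ?S = "integral {a..b} (\<lambda>r. (norm (f r))\<^sup>2)"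
  have "norm (integral {a..b} f) ^ 4 = ((norm (integral {a..b} f))\<^sup>2)\<^sup>2"
    by (simp add: power_mult[symmetric])
  also have "\<dots> \<le> ((b - a) * ?S)\<^sup>2"
    by (intro power_mono norm_integral_sq_le assms) simp
  \<comment> \<open>The quadratic inequality is used a second time, for the real function
    |f|^2.\<close>
  also have "\<dots> = (b - a)\<^sup>2 * (norm ?S)\<^sup>2" by (simp add: power_mult_distrib)
  also have "\<dots> \<le> (b - a)\<^sup>2 * ((b - a) * integral {a..b} (\<lambda>r. (norm ((norm (f r))\<^sup>2))\<^sup>2))"
    by (intro mult_left_mono norm_integral_sq_le assms(1) continuous_intros f) simp
  also have "(\<lambda>r. (norm ((norm (f r))\<^sup>2))\<^sup>2) = (\<lambda>r. norm (f r) ^ 4)"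
    by (simp add: power_mult[symmetric])
  also have "(b - a)\<^sup>2 * ((b - a) * integral {a..b} (\<lambda>r. norm (f r) ^ 4)) = (b - a) ^ 3 * integral {a..b} (\<lambda>r. norm (f r) ^ 4)"
    by (simp add: power2_eq_square power3_eq_cube)
  finally show ?thesis .
qed

lemma ennreal_linear_combination:
  fixes a b c p1 p2 q r :: real
  assumes "0 \<le> a" "0 \<le> b" "0 \<le> c" "0 \<le> p1" "0 \<le> p2" "0 \<le> q" "0 \<le> r"
  shows "ennreal (a * (p1 + p2) + (b * q + c * r)) =
    ennreal a * (ennreal p1 + ennreal p2) + (ennreal b * ennreal q + ennreal c * ennreal r)"
  using assms by (simp add: ennreal_mult)

context sde_setting
begin

lemma noise_version:
  assumes sol: "sde_solution M F B U V x X" and ab: "0 \<le> a" "a \<le> b"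
  obtains Y where "Y \<in> borel_measurable M" "AE \<omega> in M. Y \<omega> = noise X a b \<omega>"
proof -
  obtain Y where Y: "jmeas Y" "AE \<omega> in M. \<forall>r\<in>{a..b}. Y r \<omega> = noise X a r \<omega>"
    by (rule noise_jointly_measurable[OF assms])
  have Yj: "(\<lambda>p. Y (snd p) (fst p)) \<in> borel_measurable (M \<Otimes>\<^sub>M lborel)"
    using Y(1) by (simp add: jmeas_def case_prod_beta')
  have "Y b \<in> borel_measurable M"
    using measurable_compose[OF _ Yj, of "\<lambda>\<omega>. (\<omega>, b)" M] by simp
  moreover have "AE \<omega> in M. Y b \<omega> = noise X a b \<omega>"
    using Y(2) by eventually_elim (use ab in simp)
  ultimately show ?thesis by (rule that)
qed

text \<open>Fubini's theorem for functions of the solution along an interval. The second argument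
  admits a frozen value such as \<open>X s\<close> or \<open>X t\<close>, which the remainder
  estimates subtract.\<close>

lemma solution_time_integral:
  fixes g :: "'b \<Rightarrow> 'b \<Rightarrow> real"
  assumes sol: "sde_solution M F B U V x X" and ab: "0 \<le> a" "a \<le> b"
    and g: "(\<lambda>(y, z). g y z) \<in> borel_measurable (borel \<Otimes>\<^sub>M borel)" and Z [measurable]: "Z \<in> borel_measurable M"
    and bd: "\<And>r. r \<in> {a..b} \<Longrightarrow> (\<integral>\<^sup>+\<omega>. ennreal (g (X r \<omega>) (Z \<omega>)) \<partial>M) \<le> ennreal C" and "0 \<le> C"
  shows "(\<integral>\<^sup>+\<omega>. (\<integral>\<^sup>+r. indicator {a..b} r * ennreal (g (X r \<omega>) (Z \<omega>)) \<partial>lborel) \<partial>M) \<le> ennreal (C * (b - a))"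
    and "(\<lambda>\<omega>. \<integral>\<^sup>+r. indicator {a..b} r * ennreal (g (X r \<omega>) (Z \<omega>)) \<partial>lborel) \<in> borel_measurable M"
proof -
  let ?N = "M \<Otimes>\<^sub>M (lborel :: real measure)"
  have "0 \<le> b" using ab by simp
  define W where "W p = (if snd p \<in> {0..b} then X (snd p) (fst p) else 0)" for p
  have W [measurable]: "W \<in> borel_measurable ?N"
    using progressive_measurable[OF solution_progressive[OF sol] \<open>0 \<le> b\<close>] unfolding W_def[abs_def]
    by (simp add: case_prod_beta')
  define f where "f \<omega> r = indicator {a..b} r * ennreal (g (W (\<omega>, r)) (Z \<omega>))" for \<omega> r
  have eq: "indicator {a..b} r * ennreal (g (X r \<omega>) (Z \<omega>)) = f \<omega> r" for \<omega> r
    using ab by (auto simp: f_def W_def indicator_def)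
  have gW: "(\<lambda>p. g (W (fst p, snd p)) (Z (fst p))) \<in> borel_measurable ?N"
  proof -
    have "(\<lambda>p. (W (fst p, snd p), Z (fst p))) \<in> measurable ?N (borel \<Otimes>\<^sub>M borel)" by measurable
    from measurable_compose[OF this g] show ?thesis by simp
  qed
  have jf: "(\<lambda>(\<omega>, r). f \<omega> r) \<in> borel_measurable ?N"
    unfolding case_prod_beta' f_def using gW by measurable
  show "(\<lambda>\<omega>. \<integral>\<^sup>+r. indicator {a..b} r * ennreal (g (X r \<omega>) (Z \<omega>)) \<partial>lborel) \<in> borel_measurable M"
    unfolding eq using jf by (intro lborel.borel_measurable_nn_integral) simp
  have Xr: "X r \<in> borel_measurable M" if "r \<in> {a..b}" for r
    using solution_measurable[OF sol, of r] that ab by simp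
  have "(\<integral>\<^sup>+\<omega>. (\<integral>\<^sup>+r. f \<omega> r \<partial>lborel) \<partial>M) = (\<integral>\<^sup>+r. (\<integral>\<^sup>+\<omega>. f \<omega> r \<partial>M) \<partial>lborel)"
    by (rule nn_integral_swap[OF jf])
  also have "\<dots> = (\<integral>\<^sup>+r. indicator {a..b} r * (\<integral>\<^sup>+\<omega>. ennreal (g (X r \<omega>) (Z \<omega>)) \<partial>M) \<partial>lborel)"
  proof (rule nn_integral_cong)
    fix r
    show "(\<integral>\<^sup>+\<omega>. f \<omega> r \<partial>M) = indicator {a..b} r * (\<integral>\<^sup>+\<omega>. ennreal (g (X r \<omega>) (Z \<omega>)) \<partial>M)"
      unfolding eq[symmetric] by (cases "r \<in> {a..b}") simp_all
  qed
  also have "\<dots> \<le> ennreal (C * (b - a))"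
    by (rule nn_integral_interval_le[OF bd ab(2) \<open>0 \<le> C\<close>])
  finally show "(\<integral>\<^sup>+\<omega>. (\<integral>\<^sup>+r. indicator {a..b} r * ennreal (g (X r \<omega>) (Z \<omega>)) \<partial>lborel) \<partial>M) \<le> ennreal (C * (b - a))"
    unfolding eq .
qed

lemma U_power_le: "norm (U y) ^ n \<le> c ^ n * (1 + norm y) powr ((q + 1) * real n)"
proof -
  have n0: "0 < 1 + norm y" using norm_ge_zero[of y] by linarith
  have "norm (U y) ^ n \<le> (c * (1 + norm y) powr (q + 1)) ^ n"
    by (intro power_mono U_growth) simp
  also have "\<dots> = c ^ n * ((1 + norm y) powr (q + 1)) ^ n" by (rule power_mult_distrib)
  also have "((1 + norm y) powr (q + 1)) ^ n = ((1 + norm y) powr (q + 1)) powr (real n)"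
    by (rule powr_realpow[symmetric]) (use n0 in simp)
  also have "\<dots> = (1 + norm y) powr ((q + 1) * real n)" by (rule powr_powr)
  finally show ?thesis .
qed

lemma U_moment_bound:
  "\<exists>C>0. \<forall>x X t. sde_solution M F B U V x X \<and> 0 \<le> t \<longrightarrow>
    (\<integral>\<^sup>+\<omega>. ennreal (norm (U (X t \<omega>)) ^ n) \<partial>M) \<le> ennreal (C * (1 + norm x) powr ((q + 1) * real n))"
proof -
  obtain C where C: "C > 0" and bd: "\<And>x X t. sde_solution M F B U V x X \<Longrightarrow> 0 \<le> t \<Longrightarrow>
    (\<integral>\<^sup>+\<omega>. ennreal ((1 + norm (X t \<omega>)) powr ((q + 1) * real n)) \<partial>M) \<le> ennreal (C * (1 + norm x) powr ((q + 1) * real n))"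
    using moment_bound[of "(q + 1) * real n"] pos by (auto simp: mult_nonneg_nonneg)
  have C': "c ^ n * C > 0" using C pos by simp
  show ?thesis
  proof (intro exI[of _ "c ^ n * C"] conjI allI impI C', goal_cases)
    case (1 x X t)
    then have sol: "sde_solution M F B U V x X" and t: "0 \<le> t" by auto
    have [measurable]: "X t \<in> borel_measurable M" by (rule solution_measurable[OF sol t])
    have "(\<integral>\<^sup>+\<omega>. ennreal (norm (U (X t \<omega>)) ^ n) \<partial>M) \<le> (\<integral>\<^sup>+\<omega>. ennreal (c ^ n) * ennreal ((1 + norm (X t \<omega>)) powr ((q + 1) * real n)) \<partial>M)"
      using pos by (intro nn_integral_mono) (simp add: ennreal_mult[symmetric] U_power_le ennreal_leI)
    also have "\<dots> = ennreal (c ^ n) * (\<integral>\<^sup>+\<omega>. ennreal ((1 + norm (X t \<omega>)) powr ((q + 1) * real n)) \<partial>M)"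
      by (rule nn_integral_cmult) measurable
    also have "\<dots> \<le> ennreal (c ^ n) * ennreal (C * (1 + norm x) powr ((q + 1) * real n))"
      by (intro mult_left_mono bd[OF sol t]) simp
    also have "\<dots> = ennreal (c ^ n * C * (1 + norm x) powr ((q + 1) * real n))"
      using pos C by (simp add: ennreal_mult[symmetric] mult.assoc)
    finally show ?case .
  qed
qed

lemma solution_increment_eq: "X t \<omega> - X s \<omega> = integral {s..t} (\<lambda>u. U (X u \<omega>)) + noise X s t \<omega>"
  by (simp add: noise_def)

text \<open>For short times the noise dominates: its mean square has order \<open>t - s\<close>,
  while the drift contributes only the order (t - s)^2.\<close>

lemma solution_increment_sq:
  "\<exists>C>0. \<forall>x X s t. sde_solution M F B U V x X \<and> 0 \<le> s \<and> s \<le> t \<and> t \<le> s + 1 \<longrightarrow>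
    (\<integral>\<^sup>+\<omega>. ennreal ((norm (X t \<omega> - X s \<omega>))\<^sup>2) \<partial>M) \<le> ennreal (C * (1 + norm x) powr (2 * q + 2) * (t - s))"
proof -
  obtain Cu where Cu: "Cu > 0" and bdU: "\<And>x X t. sde_solution M F B U V x X \<Longrightarrow> 0 \<le> t \<Longrightarrow>
    (\<integral>\<^sup>+\<omega>. ennreal ((norm (U (X t \<omega>)))\<^sup>2) \<partial>M) \<le> ennreal (Cu * (1 + norm x) powr (2 * q + 2))"
    using U_moment_bound[of 2] by (auto simp: algebra_simps)
  obtain Cn where Cn: "Cn > 0" and bdN: "\<And>x X s t. sde_solution M F B U V x X \<Longrightarrow> 0 \<le> s \<Longrightarrow> s \<le> t \<Longrightarrow>
    (\<integral>\<^sup>+\<omega>. ennreal ((norm (noise X s t \<omega>))\<^sup>2) \<partial>M) \<le> ennreal (Cn * (t - s))"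
    using noise_moment[of 1] by auto
  define C where "C = 2 * Cu + 2 * Cn"
  have C: "C > 0" using Cu Cn by (simp add: C_def)
  show ?thesis
  proof (intro exI[of _ C] conjI allI impI C, goal_cases)
    case (1 x X s t)
    then have sol: "sde_solution M F B U V x X" and st: "0 \<le> s" "s \<le> t" "t \<le> s + 1" by auto
    define h where "h = t - s"
    have h: "0 \<le> h" "h \<le> 1" using st by (auto simp: h_def)
    define Q where "Q = (1 + norm x) powr (2 * q + 2)"
    have Q: "1 \<le> Q" unfolding Q_def using pos by (intro ge_one_powr_ge_zero) auto
    obtain Y where [measurable]: "Y \<in> borel_measurable M" and Y: "AE \<omega> in M. Y \<omega> = noise X s t \<omega>"
      by (rule noise_version[OF sol st(1,2)])
    define I where "I \<omega> = (\<integral>\<^sup>+r. indicator {s..t} r * ennreal ((norm (U (X r \<omega>)))\<^sup>2) \<partial>lborel)" for \<omega>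
    have Iti: "(\<integral>\<^sup>+\<omega>. I \<omega> \<partial>M) \<le> ennreal (Cu * Q * h)" "I \<in> borel_measurable M"
      unfolding I_def[abs_def] h_def
      by (rule solution_time_integral[OF sol st(1,2), of "\<lambda>y z. (norm (U y))\<^sup>2" "\<lambda>_. 0" "Cu * Q"];
          use bdU[OF sol] st Cu Q in \<open>simp add: Q_def\<close>)+
    note [measurable] = Iti(2)
    have "(\<integral>\<^sup>+\<omega>. ennreal ((norm (X t \<omega> - X s \<omega>))\<^sup>2) \<partial>M) \<le> (\<integral>\<^sup>+\<omega>. 2 * (ennreal h * I \<omega>) + 2 * ennreal ((norm (Y \<omega>))\<^sup>2) \<partial>M)"
    proof (rule nn_integral_mono_AE)
      show "AE \<omega> in M. ennreal ((norm (X t \<omega> - X s \<omega>))\<^sup>2) \<le> 2 * (ennreal h * I \<omega>) + 2 * ennreal ((norm (Y \<omega>))\<^sup>2)"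
        using Y solution_continuous[OF sol]
      proof eventually_elim
        case (elim \<omega>)
        have "ennreal ((norm (X t \<omega> - X s \<omega>))\<^sup>2) \<le> 2 * ennreal ((norm (integral {s..t} (\<lambda>u. U (X u \<omega>))))\<^sup>2) + 2 * ennreal ((norm (Y \<omega>))\<^sup>2)"
          unfolding solution_increment_eq elim(1) by (rule ennreal_norm_add_sq_le)
        also have "ennreal ((norm (integral {s..t} (\<lambda>u. U (X u \<omega>))))\<^sup>2) \<le> ennreal h * I \<omega>"
          unfolding I_def h_def
          by (rule ennreal_norm_integral_sq_le[OF st(2) continuous_drift_path[where X = X and \<omega> = \<omega>, OF elim(2) st(1)]])
        finally show ?case by (simp add: add_mono mult_left_mono)
      qed
    qed
    also have "\<dots> = 2 * (ennreal h * (\<integral>\<^sup>+\<omega>. I \<omega> \<partial>M)) + 2 * (\<integral>\<^sup>+\<omega>. ennreal ((norm (Y \<omega>))\<^sup>2) \<partial>M)"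
      by (subst nn_integral_add) (simp_all add: nn_integral_cmult)
    also have "(\<integral>\<^sup>+\<omega>. ennreal ((norm (Y \<omega>))\<^sup>2) \<partial>M) = (\<integral>\<^sup>+\<omega>. ennreal ((norm (noise X s t \<omega>))\<^sup>2) \<partial>M)"
      using Y by (intro nn_integral_cong_AE) auto
    also have "2 * (ennreal h * (\<integral>\<^sup>+\<omega>. I \<omega> \<partial>M)) + 2 * \<dots> \<le> 2 * (ennreal h * ennreal (Cu * Q * h)) + 2 * ennreal (Cn * h)"
      unfolding h_def by (intro add_mono mult_left_mono Iti(1)[unfolded h_def] bdN[OF sol st(1,2)]) simp_all
    also have "\<dots> = ennreal (2 * (h * (Cu * Q * h)) + 2 * (Cn * h))"
      using h Cu Cn Q by (simp add: ennreal_mult[symmetric] ennreal_plus[symmetric] ennreal_numeral[symmetric] del: ennreal_plus ennreal_numeral)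
    also have "\<dots> \<le> ennreal (C * Q * h)"
    proof (rule ennreal_leI)
      have "h * (Cu * Q * h) \<le> 1 * (Cu * Q * h)"
        using h Cu Q by (intro mult_right_mono) auto
      moreover have "Cn * h * 1 \<le> Cn * h * Q"
        using h Cn Q by (intro mult_left_mono) auto
      ultimately show "2 * (h * (Cu * Q * h)) + 2 * (Cn * h) \<le> C * Q * h"
        by (simp add: C_def algebra_simps)
    qed
    finally show ?case by (simp add: Q_def h_def)
  qed
qed

text \<open>Young's inequality with weight \<open>h\<close> separates the local Lipschitz factor
  from the squared increment. With \<open>h\<close> the time step, \<open>u\<close> the drift part
  and \<open>w\<close> the noise, every term has a mean of order at most \<open>h\<close>, since the
  fourth moment of the noise has order h^2.\<close>

lemma drift_increment_pointwise:
  assumes h: "h > 0" and that: "y - z = u + w"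
  shows "(norm (U y - U z))\<^sup>2 \<le> 4 * c * h * ((1 + norm y) powr (4 * q) + (1 + norm z) powr (4 * q)) + c / h * norm u ^ 4 + c / h * norm w ^ 4"
proof -
  define a where "a = (1 + norm y) powr (2 * q)"
  define b where "b = (1 + norm z) powr (2 * q)"
  have sq: "a\<^sup>2 = (1 + norm y) powr (4 * q)" "b\<^sup>2 = (1 + norm z) powr (4 * q)"
    by (simp_all add: a_def b_def power2_eq_square powr_add[symmetric])
  have ab: "0 \<le> a" "0 \<le> b" by (simp_all add: a_def b_def)
  have two: "2 * (a + b) * v\<^sup>2 \<le> h * (a + b)\<^sup>2 + v ^ 4 / h" for v
  proof -
    have "2 * (sqrt h * (a + b)) * (v\<^sup>2 / sqrt h) \<le> (sqrt h * (a + b))\<^sup>2 + (v\<^sup>2 / sqrt h)\<^sup>2"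
      by (rule sum_squares_bound)
    then have "2 * ((a + b) * v\<^sup>2) \<le> h * (a + b)\<^sup>2 + v ^ 4 / h"
      using h by (simp add: power_mult_distrib power_divide power_mult[symmetric])
    then show ?thesis by (simp only: mult.assoc)
  qed
  have "(a + b)\<^sup>2 \<le> 2 * (a\<^sup>2 + b\<^sup>2)"
    using sum_squares_bound[of a b] by (simp add: power2_sum)
  have "(norm (U y - U z))\<^sup>2 \<le> c * (a + b) * (norm (y - z))\<^sup>2"
    unfolding a_def b_def by (rule U_loc)
  also have "\<dots> \<le> c * (a + b) * (2 * (norm u)\<^sup>2 + 2 * (norm w)\<^sup>2)"
    unfolding that using pos ab by (intro mult_left_mono norm_add_sq_le) simp
  also have "\<dots> = c * (2 * (a + b) * (norm u)\<^sup>2 + 2 * (a + b) * (norm w)\<^sup>2)"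
    by (simp add: algebra_simps)
  also have "\<dots> \<le> c * ((h * (a + b)\<^sup>2 + norm u ^ 4 / h) + (h * (a + b)\<^sup>2 + norm w ^ 4 / h))"
    using pos by (intro mult_left_mono add_mono two) simp
  also have "\<dots> \<le> c * ((h * (2 * (a\<^sup>2 + b\<^sup>2)) + norm u ^ 4 / h) + (h * (2 * (a\<^sup>2 + b\<^sup>2)) + norm w ^ 4 / h))"
    using pos h \<open>(a + b)\<^sup>2 \<le> _\<close> by (intro mult_left_mono add_mono order_refl) simp_all
  also have "\<dots> = 4 * c * h * (a\<^sup>2 + b\<^sup>2) + c / h * norm u ^ 4 + c / h * norm w ^ 4"
    by (simp add: algebra_simps)
  finally show ?thesis by (simp only: sq)
qed

text \<open>The power 4q + 4 is dictated by the fourth moment of \<open>U\<close>, which grows like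
  the power q + 1; the weights from the local Lipschitz bound give only 4q.\<close>

lemma drift_increment_sq:
  "\<exists>C>0. \<forall>x X s t. sde_solution M F B U V x X \<and> 0 \<le> s \<and> s \<le> t \<and> t \<le> s + 1 \<longrightarrow>
    (\<integral>\<^sup>+\<omega>. ennreal ((norm (U (X s \<omega>) - U (X t \<omega>)))\<^sup>2) \<partial>M) \<le> ennreal (C * (1 + norm x) powr (4 * q + 4) * (t - s))"
proof -
  obtain Cu where Cu: "Cu > 0" and bdU: "\<And>x X t. sde_solution M F B U V x X \<Longrightarrow> 0 \<le> t \<Longrightarrow>
    (\<integral>\<^sup>+\<omega>. ennreal (norm (U (X t \<omega>)) ^ 4) \<partial>M) \<le> ennreal (Cu * (1 + norm x) powr (4 * q + 4))"
    using U_moment_bound[of 4] by (auto simp: algebra_simps)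
  obtain Cq where Cq: "Cq > 0" and bdq: "\<And>x X t. sde_solution M F B U V x X \<Longrightarrow> 0 \<le> t \<Longrightarrow>
    (\<integral>\<^sup>+\<omega>. ennreal ((1 + norm (X t \<omega>)) powr (4 * q)) \<partial>M) \<le> ennreal (Cq * (1 + norm x) powr (4 * q))"
    using moment_bound[of "4 * q"] pos by auto
  obtain Cn where Cn: "Cn > 0" and bdN: "\<And>x X s t. sde_solution M F B U V x X \<Longrightarrow> 0 \<le> s \<Longrightarrow> s \<le> t \<Longrightarrow>
    (\<integral>\<^sup>+\<omega>. ennreal (norm (noise X s t \<omega>) ^ 4) \<partial>M) \<le> ennreal (Cn * (t - s)\<^sup>2)"
    using noise_moment[of 2] by auto
  define C where "C = 8 * c * Cq + c * Cu + c * Cn"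
  have C: "C > 0" using Cu Cq Cn pos by (simp add: C_def add_pos_pos)
  show ?thesis
  proof (intro exI[of _ C] conjI allI impI C, goal_cases)
    case (1 x X s t)
    then have sol: "sde_solution M F B U V x X" and st: "0 \<le> s" "s \<le> t" "t \<le> s + 1" by auto
    have t0: "0 \<le> t" using st by simp
    define h where "h = t - s"
    define Q where "Q = (1 + norm x) powr (4 * q + 4)"
    have Q: "1 \<le> Q" unfolding Q_def using pos by (intro ge_one_powr_ge_zero) auto
    have Qq: "(1 + norm x) powr (4 * q) \<le> Q" unfolding Q_def by (intro powr_mono) auto
    show ?case
    proof (cases "s = t")
      case False
      then have h: "0 < h" "h \<le> 1" using st by (auto simp: h_def)
      obtain Y where [measurable]: "Y \<in> borel_measurable M" and Y: "AE \<omega> in M. Y \<omega> = noise X s t \<omega>"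
        by (rule noise_version[OF sol st(1,2)])
      have [measurable]: "X s \<in> borel_measurable M" "X t \<in> borel_measurable M"
        using solution_measurable[OF sol] st t0 by auto
      define I where "I \<omega> = (\<integral>\<^sup>+r. indicator {s..t} r * ennreal (norm (U (X r \<omega>)) ^ 4) \<partial>lborel)" for \<omega>
      have Iti: "(\<integral>\<^sup>+\<omega>. I \<omega> \<partial>M) \<le> ennreal (Cu * Q * h)" "I \<in> borel_measurable M"
        unfolding I_def[abs_def] h_def
        by (rule solution_time_integral[OF sol st(1,2), of "\<lambda>y z. norm (U y) ^ 4" "\<lambda>_. 0" "Cu * Q"];
            use bdU[OF sol] st Cu Q in \<open>simp add: Q_def\<close>)+
      note [measurable] = Iti(2)
      let ?P = "\<lambda>r \<omega>. (1 + norm (X r \<omega>)) powr (4 * q)"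
      have "(\<integral>\<^sup>+\<omega>. ennreal ((norm (U (X s \<omega>) - U (X t \<omega>)))\<^sup>2) \<partial>M)
        \<le> (\<integral>\<^sup>+\<omega>. ennreal (4 * c * h) * (ennreal (?P s \<omega>) + ennreal (?P t \<omega>)) + (ennreal (c * h\<^sup>2) * I \<omega> + ennreal (c / h) * ennreal (norm (Y \<omega>) ^ 4)) \<partial>M)"
      proof (rule nn_integral_mono_AE)
        show "AE \<omega> in M. ennreal ((norm (U (X s \<omega>) - U (X t \<omega>)))\<^sup>2)
          \<le> ennreal (4 * c * h) * (ennreal (?P s \<omega>) + ennreal (?P t \<omega>)) + (ennreal (c * h\<^sup>2) * I \<omega> + ennreal (c / h) * ennreal (norm (Y \<omega>) ^ 4))"
          using Y solution_continuous[OF sol]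
        proof eventually_elim
          case (elim \<omega>)
          note cU = continuous_drift_path[where X = X and \<omega> = \<omega>, OF elim(2) st(1), of t]
          let ?D = "integral {s..t} (\<lambda>u. U (X u \<omega>))"
          let ?J = "integral {s..t} (\<lambda>u. norm (U (X u \<omega>)) ^ 4)"
          have cU4: "continuous_on {s..t} (\<lambda>u. norm (U (X u \<omega>)) ^ 4)" by (intro continuous_intros cU)
          have IJ: "I \<omega> = ennreal ?J"
            unfolding I_def by (rule nn_integral_indicator_continuous[OF cU4]) simp
          have J0: "0 \<le> ?J" by (rule integral_nonneg[OF integrable_continuous_real[OF cU4]]) simp
          have "X t \<omega> - X s \<omega> = ?D + Y \<omega>" by (simp add: noise_def elim(1))
          then have "(norm (U (X t \<omega>) - U (X s \<omega>)))\<^sup>2 \<le> 4 * c * h * (?P t \<omega> + ?P s \<omega>) + c / h * norm ?D ^ 4 + c / h * norm (Y \<omega>) ^ 4"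
            by (rule drift_increment_pointwise[OF h(1)])
          also have "c / h * norm ?D ^ 4 \<le> c / h * (h ^ 3 * ?J)"
            using pos h unfolding h_def by (intro mult_left_mono norm_integral_fourth_le st(2) cU) auto
          also have "c / h * (h ^ 3 * ?J) = c * h\<^sup>2 * ?J"
            using h by (simp add: power3_eq_cube power2_eq_square)
          finally have *: "(norm (U (X s \<omega>) - U (X t \<omega>)))\<^sup>2 \<le> 4 * c * h * (?P s \<omega> + ?P t \<omega>) + (c * h\<^sup>2 * ?J + c / h * norm (Y \<omega>) ^ 4)"
            by (simp add: norm_minus_commute add.commute add.assoc)
          have nn: "0 \<le> 4 * c * h" "0 \<le> c * h\<^sup>2" "0 \<le> c / h" "0 \<le> norm (Y \<omega>) ^ 4" using pos h by auto
          show ?case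
            using ennreal_leI[OF *] unfolding IJ
            by (subst (asm) ennreal_linear_combination) (use nn J0 in simp_all)
        qed
      qed
      also have "\<dots> = ennreal (4 * c * h) * ((\<integral>\<^sup>+\<omega>. ennreal (?P s \<omega>) \<partial>M) + (\<integral>\<^sup>+\<omega>. ennreal (?P t \<omega>) \<partial>M))
         + (ennreal (c * h\<^sup>2) * (\<integral>\<^sup>+\<omega>. I \<omega> \<partial>M) + ennreal (c / h) * (\<integral>\<^sup>+\<omega>. ennreal (norm (Y \<omega>) ^ 4) \<partial>M))"
        by (simp add: nn_integral_add nn_integral_cmult)
      also have "(\<integral>\<^sup>+\<omega>. ennreal (norm (Y \<omega>) ^ 4) \<partial>M) = (\<integral>\<^sup>+\<omega>. ennreal (norm (noise X s t \<omega>) ^ 4) \<partial>M)"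
        using Y by (intro nn_integral_cong_AE) auto
      also have "ennreal (4 * c * h) * ((\<integral>\<^sup>+\<omega>. ennreal (?P s \<omega>) \<partial>M) + (\<integral>\<^sup>+\<omega>. ennreal (?P t \<omega>) \<partial>M))
         + (ennreal (c * h\<^sup>2) * (\<integral>\<^sup>+\<omega>. I \<omega> \<partial>M) + ennreal (c / h) * \<dots>)
        \<le> ennreal (4 * c * h) * (ennreal (Cq * Q) + ennreal (Cq * Q)) + (ennreal (c * h\<^sup>2) * ennreal (Cu * Q * h) + ennreal (c / h) * ennreal (Cn * h\<^sup>2))"
      proof (intro add_mono mult_left_mono Iti(1))
        have le: "ennreal (Cq * (1 + norm x) powr (4 * q)) \<le> ennreal (Cq * Q)"
          using Cq Qq by (intro ennreal_leI mult_left_mono) auto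
        show "(\<integral>\<^sup>+\<omega>. ennreal (?P s \<omega>) \<partial>M) \<le> ennreal (Cq * Q)" "(\<integral>\<^sup>+\<omega>. ennreal (?P t \<omega>) \<partial>M) \<le> ennreal (Cq * Q)"
          using order_trans[OF bdq[OF sol st(1)] le] order_trans[OF bdq[OF sol t0] le] .
        show "(\<integral>\<^sup>+\<omega>. ennreal (norm (noise X s t \<omega>) ^ 4) \<partial>M) \<le> ennreal (Cn * h\<^sup>2)"
          unfolding h_def by (rule bdN[OF sol st(1,2)])
      qed simp_all
      also have "\<dots> = ennreal (4 * c * h * (Cq * Q + Cq * Q) + (c * h\<^sup>2 * (Cu * Q * h) + c / h * (Cn * h\<^sup>2)))"
        using h Cu Cn Cq Q pos by (simp add: ennreal_mult[symmetric] ennreal_plus[symmetric] del: ennreal_plus)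
      also have "\<dots> \<le> ennreal (C * Q * h)"
      proof (rule ennreal_leI)
        have h2: "h\<^sup>2 \<le> 1" using h by (simp add: power_le_one)
        have "h\<^sup>2 * (c * Cu * Q * h) \<le> 1 * (c * Cu * Q * h)"
          using h h2 Cu Q pos by (intro mult_right_mono) auto
        moreover have "c / h * (Cn * h\<^sup>2) = c * Cn * h" using h by (simp add: power2_eq_square)
        moreover have "c * Cn * h * 1 \<le> c * Cn * h * Q"
          using h Cn Q pos by (intro mult_left_mono) auto
        ultimately show "4 * c * h * (Cq * Q + Cq * Q) + (c * h\<^sup>2 * (Cu * Q * h) + c / h * (Cn * h\<^sup>2)) \<le> C * Q * h"
          by (simp add: C_def algebra_simps)
      qed
      finally show ?thesis by (simp add: Q_def h_def)
    qed simp
  qed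
qed

text \<open>The drift is frozen at the right endpoint, because the transformed variable at the new
  time is \<open>X t - \<delta> U (X t)\<close>. One factor \<open>t - s\<close> comes from
  Cauchy-Schwarz in time, one from the remaining time integral and one from the mean square
  increment of \<open>U\<close>.\<close>

lemma drift_remainder_sq:
  "\<exists>C>0. \<forall>x X s t. sde_solution M F B U V x X \<and> 0 \<le> s \<and> s \<le> t \<and> t \<le> s + 1 \<longrightarrow>
    (\<integral>\<^sup>+\<omega>. ennreal ((norm (integral {s..t} (\<lambda>r. U (X r \<omega>) - U (X t \<omega>))))\<^sup>2) \<partial>M)
    \<le> ennreal (C * (1 + norm x) powr (4 * q + 4) * (t - s) ^ 3)"
proof -
  obtain C where C: "C > 0" and bd: "\<And>x X s t. sde_solution M F B U V x X \<Longrightarrow> 0 \<le> s \<Longrightarrow> s \<le> t \<Longrightarrow> t \<le> s + 1 \<Longrightarrow>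
    (\<integral>\<^sup>+\<omega>. ennreal ((norm (U (X s \<omega>) - U (X t \<omega>)))\<^sup>2) \<partial>M) \<le> ennreal (C * (1 + norm x) powr (4 * q + 4) * (t - s))"
    using drift_increment_sq by blast
  show ?thesis
  proof (intro exI[of _ C] conjI allI impI C, goal_cases)
    case (1 x X s t)
    then have sol: "sde_solution M F B U V x X" and st: "0 \<le> s" "s \<le> t" "t \<le> s + 1" by auto
    define h where "h = t - s"
    have h: "0 \<le> h" using st by (simp add: h_def)
    define D where "D = C * (1 + norm x) powr (4 * q + 4) * h"
    have D: "0 \<le> D" using C h by (simp add: D_def)
    have Xt: "X t \<in> borel_measurable M" using solution_measurable[OF sol] st by simp
    define I where "I \<omega> = (\<integral>\<^sup>+r. indicator {s..t} r * ennreal ((norm (U (X r \<omega>) - U (X t \<omega>)))\<^sup>2) \<partial>lborel)" for \<omega>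
    have bdr: "(\<integral>\<^sup>+\<omega>. ennreal ((norm (U (X r \<omega>) - U (X t \<omega>)))\<^sup>2) \<partial>M) \<le> ennreal D" if "r \<in> {s..t}" for r
    proof -
      have "(\<integral>\<^sup>+\<omega>. ennreal ((norm (U (X r \<omega>) - U (X t \<omega>)))\<^sup>2) \<partial>M) \<le> ennreal (C * (1 + norm x) powr (4 * q + 4) * (t - r))"
        using bd[OF sol, of r t] that st by simp
      also have "\<dots> \<le> ennreal D"
        unfolding D_def h_def using that C by (intro ennreal_leI mult_left_mono) auto
      finally show ?thesis .
    qed
    have "(\<lambda>(y, z). (norm (U y - U z))\<^sup>2) \<in> borel_measurable (borel \<Otimes>\<^sub>M borel)"
      unfolding case_prod_beta' by measurable
    note ti = solution_time_integral[OF sol st(1,2) this Xt bdr D, folded I_def h_def]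
    have "(\<integral>\<^sup>+\<omega>. ennreal ((norm (integral {s..t} (\<lambda>r. U (X r \<omega>) - U (X t \<omega>))))\<^sup>2) \<partial>M) \<le> (\<integral>\<^sup>+\<omega>. ennreal h * I \<omega> \<partial>M)"
    proof (rule nn_integral_mono_AE)
      show "AE \<omega> in M. ennreal ((norm (integral {s..t} (\<lambda>r. U (X r \<omega>) - U (X t \<omega>))))\<^sup>2) \<le> ennreal h * I \<omega>"
        using solution_continuous[OF sol]
      proof eventually_elim
        case (elim \<omega>)
        show ?case
          unfolding I_def h_def
          by (intro ennreal_norm_integral_sq_le[OF st(2)] continuous_on_diff continuous_on_const
              continuous_drift_path[where X = X and \<omega> = \<omega>, OF elim st(1)])
      qed
    qed
    also have "\<dots> = ennreal h * (\<integral>\<^sup>+\<omega>. I \<omega> \<partial>M)" by (rule nn_integral_cmult[OF ti(2)])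
    also have "\<dots> \<le> ennreal h * ennreal (D * h)" by (intro mult_left_mono ti(1)) simp_all
    also have "\<dots> = ennreal (h * (D * h))" using h D by (simp add: ennreal_mult)
    also have "h * (D * h) = C * (1 + norm x) powr (4 * q + 4) * h ^ 3"
      by (simp add: D_def power3_eq_cube)
    finally show ?case by (simp add: h_def)
  qed
qed

text \<open>The diffusion is frozen at the left endpoint, as in an Euler step; the Lipschitz bound
  leaves order (t - s)^2, one power less than for the drift. The growth power 2q + 2 is enlarged to
  4q + 4 to match the drift error.\<close>

lemma martingale_remainder_sq:
  "\<exists>C>0. \<forall>x X s t N. sde_solution M F B U V x X \<and> 0 \<le> s \<and> s < t \<and> t \<le> s + 1 \<and> martingale_increment X s t N \<longrightarrow>
    (\<integral>\<^sup>+\<omega>. ennreal ((norm (sqrt 2 *\<^sub>R (\<Sum>k\<in>UNIV. N k \<omega> - dB k s t \<omega> *\<^sub>R V k (X s \<omega>))))\<^sup>2) \<partial>M)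
    \<le> ennreal (C * (1 + norm x) powr (4 * q + 4) * (t - s)\<^sup>2)"
proof -
  obtain C1 where C1: "C1 > 0" and bd: "\<And>x X s t. sde_solution M F B U V x X \<Longrightarrow> 0 \<le> s \<Longrightarrow> s \<le> t \<Longrightarrow> t \<le> s + 1 \<Longrightarrow>
    (\<integral>\<^sup>+\<omega>. ennreal ((norm (X t \<omega> - X s \<omega>))\<^sup>2) \<partial>M) \<le> ennreal (C1 * (1 + norm x) powr (2 * q + 2) * (t - s))"
    using solution_increment_sq by blast
  define d where "d = real CARD('d)"
  have d: "d > 0" by (simp add: d_def)
  define C where "C = 2 * d * (d * (4 * (c\<^sup>2 * C1)))"
  have C: "C > 0" using C1 d pos by (simp add: C_def)
  show ?thesis
  proof (intro exI[of _ C] conjI allI impI C, goal_cases)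
    case (1 x X s t N)
    then have sol: "sde_solution M F B U V x X" and st: "0 \<le> s" "s < t" "t \<le> s + 1"
      and mi: "martingale_increment X s t N" by auto
    have st2: "s \<le> t" using st by simp
    define h where "h = t - s"
    have h: "0 \<le> h" using st by (simp add: h_def)
    define Q where "Q = (1 + norm x) powr (4 * q + 4)"
    define D where "D = c\<^sup>2 * (C1 * Q * h)"
    have D: "0 \<le> D" using C1 h by (simp add: D_def Q_def)
    have Xs [measurable]: "X s \<in> borel_measurable M" using solution_measurable[OF sol] st by simp
    have N [measurable]: "N k \<in> borel_measurable M" for k
      using mi by (simp add: martingale_increment_def)
    have dBm [measurable]: "dB k s t \<in> borel_measurable M" for k
      using st by (intro dB_measurable) auto
    define E where "E k \<omega> = N k \<omega> - dB k s t \<omega> *\<^sub>R V k (X s \<omega>)" for k \<omega>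
    have Em [measurable]: "E k \<in> borel_measurable M" for k unfolding E_def by measurable
    have EE: "(\<integral>\<^sup>+\<omega>. ennreal ((norm (E k \<omega>))\<^sup>2) \<partial>M) \<le> ennreal (4 * (D * h))" for k
    proof -
      have bdr: "(\<integral>\<^sup>+\<omega>. ennreal ((norm (V k (X r \<omega>) - V k (X s \<omega>)))\<^sup>2) \<partial>M) \<le> ennreal D" if r: "r \<in> {s..t}" for r
      proof -
        have [measurable]: "X r \<in> borel_measurable M" using solution_measurable[OF sol] st r by simp
        have "(\<integral>\<^sup>+\<omega>. ennreal ((norm (V k (X r \<omega>) - V k (X s \<omega>)))\<^sup>2) \<partial>M) \<le> (\<integral>\<^sup>+\<omega>. ennreal (c\<^sup>2) * ennreal ((norm (X r \<omega> - X s \<omega>))\<^sup>2) \<partial>M)"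
        proof (rule nn_integral_mono)
          fix \<omega>
          have "(norm (V k (X r \<omega>) - V k (X s \<omega>)))\<^sup>2 \<le> (c * norm (X r \<omega> - X s \<omega>))\<^sup>2"
            by (intro power_mono V_lip) simp
          then show "ennreal ((norm (V k (X r \<omega>) - V k (X s \<omega>)))\<^sup>2) \<le> ennreal (c\<^sup>2) * ennreal ((norm (X r \<omega> - X s \<omega>))\<^sup>2)"
            by (simp add: ennreal_mult[symmetric] power_mult_distrib ennreal_leI)
        qed
        also have "\<dots> = ennreal (c\<^sup>2) * (\<integral>\<^sup>+\<omega>. ennreal ((norm (X r \<omega> - X s \<omega>))\<^sup>2) \<partial>M)"
          by (rule nn_integral_cmult) measurable
        also have "\<dots> \<le> ennreal (c\<^sup>2) * ennreal (C1 * (1 + norm x) powr (2 * q + 2) * (r - s))"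
          using r st by (intro mult_left_mono bd[OF sol]) auto
        also have "\<dots> \<le> ennreal (c\<^sup>2) * ennreal (C1 * Q * h)"
          unfolding Q_def h_def using r C1 pos by (intro mult_left_mono ennreal_leI mult_mono powr_mono) auto
        also have "\<dots> = ennreal D" using C1 h by (simp add: D_def Q_def ennreal_mult)
        finally show ?thesis .
      qed
      have "(\<lambda>(y, z). (norm (V k y - V k z))\<^sup>2) \<in> borel_measurable (borel \<Otimes>\<^sub>M borel)"
        unfolding case_prod_beta' by measurable
      note ti = solution_time_integral[OF sol st(1) st2 this Xs bdr D, folded h_def]
      have "(\<integral>\<^sup>+\<omega>. ennreal ((norm (E k \<omega>))\<^sup>2) \<partial>M)
        \<le> 4 * (\<integral>\<^sup>+\<omega>. (\<integral>\<^sup>+r. indicator {s..t} r * ennreal ((norm (V k (X r \<omega>) - V k (X s \<omega>)))\<^sup>2) \<partial>lborel) \<partial>M)"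
        using mi by (simp add: martingale_increment_def E_def)
      also have "\<dots> \<le> 4 * ennreal (D * h)" by (intro mult_left_mono ti(1)) simp_all
      also have "\<dots> = ennreal (4 * (D * h))" using D h by (simp add: ennreal_mult)
      finally show ?thesis .
    qed
    have "(\<integral>\<^sup>+\<omega>. ennreal ((norm (sqrt 2 *\<^sub>R (\<Sum>k\<in>UNIV. E k \<omega>)))\<^sup>2) \<partial>M)
      \<le> (\<integral>\<^sup>+\<omega>. ennreal (2 * d) * (\<Sum>k\<in>UNIV. ennreal ((norm (E k \<omega>))\<^sup>2)) \<partial>M)"
    proof (rule nn_integral_mono)
      fix \<omega>
      have "(norm (sqrt 2 *\<^sub>R (\<Sum>k\<in>UNIV. E k \<omega>)))\<^sup>2 = 2 * (norm (\<Sum>k\<in>UNIV. E k \<omega>))\<^sup>2"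
        by (simp add: power_mult_distrib)
      also have "\<dots> \<le> 2 * (d * (\<Sum>k\<in>UNIV. (norm (E k \<omega>))\<^sup>2))"
        unfolding d_def by (intro mult_left_mono norm_sum_sq_le) simp_all
      finally have "ennreal ((norm (sqrt 2 *\<^sub>R (\<Sum>k\<in>UNIV. E k \<omega>)))\<^sup>2) \<le> ennreal (2 * d * (\<Sum>k\<in>UNIV. (norm (E k \<omega>))\<^sup>2))"
        by (intro ennreal_leI) (simp add: mult.assoc)
      also have "\<dots> = ennreal (2 * d) * (\<Sum>k\<in>UNIV. ennreal ((norm (E k \<omega>))\<^sup>2))"
        using d by (subst ennreal_mult) (auto simp: sum_nonneg sum_ennreal)
      finally show "ennreal ((norm (sqrt 2 *\<^sub>R (\<Sum>k\<in>UNIV. E k \<omega>)))\<^sup>2) \<le> \<dots>" .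
    qed
    also have "\<dots> = ennreal (2 * d) * (\<Sum>k\<in>UNIV. (\<integral>\<^sup>+\<omega>. ennreal ((norm (E k \<omega>))\<^sup>2) \<partial>M))"
      by (subst nn_integral_cmult, measurable, subst nn_integral_sum) simp_all
    also have "\<dots> \<le> ennreal (2 * d) * (\<Sum>k\<in>(UNIV::'d set). ennreal (4 * (D * h)))"
      by (intro mult_left_mono sum_mono EE) simp
    also have "(\<Sum>k\<in>(UNIV::'d set). ennreal (4 * (D * h))) = ennreal (d * (4 * (D * h)))"
      using D h by (subst sum_ennreal) (simp_all add: d_def)
    also have "ennreal (2 * d) * ennreal (d * (4 * (D * h))) = ennreal (2 * d * (d * (4 * (D * h))))"
      using D h d by (intro ennreal_mult[symmetric]) auto
    also have "2 * d * (d * (4 * (D * h))) = C * Q * h\<^sup>2"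
      by (simp add: C_def D_def power2_eq_square)
    finally show ?case unfolding E_def Q_def h_def .
  qed
qed

end

section \<open>Strong error\<close>

text \<open>In its use \<open>E\<close> is the mean squared error, \<open>p\<close> is \<delta>
  times the mean dissipation and \<open>h\<close> is l \<delta> / 4. The gap between 2 p and (4/5)
  p, which is (6/5) p, has to pay for 2 h E and (14/5) h p, that is for (1/2) p and (7/10) p: the
  constants fit exactly.\<close>

lemma contraction_arithmetic:
  fixes h E p :: real
  assumes "2 * (h * E) \<le> 1 / 2 * p" "h * p \<le> 1 / 4 * p"
  shows "(1 + h) * (E + 4 / 5 * p) \<le> (1 - h) * (E + 2 * p)"
proof -
  have aux: "E + 4 / 5 * p + a + 4 / 5 * b \<le> E + 2 * p - a - 2 * b"
    if "2 * a \<le> 1 / 2 * p" "b \<le> 1 / 4 * p" for a b :: real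
    using that by simp
  have "(1 + h) * (E + 4 / 5 * p) = E + 4 / 5 * p + h * E + 4 / 5 * (h * p)"
    by (simp add: algebra_simps)
  also have "\<dots> \<le> E + 2 * p - h * E - 2 * (h * p)"
    by (rule aux[OF assms])
  also have "\<dots> = (1 - h) * (E + 2 * p)"
    by (simp add: algebra_simps)
  finally show ?thesis .
qed

context brownian_setting
begin

lemma L2_dB_bounded:
  assumes "0 \<le> s" "s \<le> t" and v: "v \<in> borel_measurable M" "\<And>\<omega>. \<omega> \<in> space M \<Longrightarrow> norm (v \<omega>) \<le> K"
  shows "L2 (\<lambda>\<omega>. dB k s t \<omega> *\<^sub>R v \<omega>)"
proof (rule L2_dominated)
  show "integrable M (\<lambda>\<omega>. (dB k s t \<omega>)\<^sup>2 * K\<^sup>2)"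
    using dB_integrable_power[OF assms(1,2), of k 2] by simp
  show "(\<lambda>\<omega>. dB k s t \<omega> *\<^sub>R v \<omega>) \<in> borel_measurable M"
    using assms by (intro borel_measurable_scaleR dB_measurable) auto
  fix \<omega> assume "\<omega> \<in> space M"
  then have "(norm (v \<omega>))\<^sup>2 \<le> K\<^sup>2" using v(2) by (intro power_mono) auto
  then show "(norm (dB k s t \<omega> *\<^sub>R v \<omega>))\<^sup>2 \<le> (dB k s t \<omega>)\<^sup>2 * K\<^sup>2"
    by (simp add: power_mult_distrib mult_left_mono)
qed

text \<open>The coefficients are constant over the step, so the covariance rule for one step
  suffices and the cross terms between different Brownian motions vanish.\<close>

lemma dB_sum_isometry:
  fixes v :: "'d \<Rightarrow> 'a \<Rightarrow> 'c::euclidean_space"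
  assumes "0 \<le> s" "s \<le> t" and v: "\<And>k. v k \<in> borel_measurable (F s)" "\<And>k \<omega>. norm (v k \<omega>) \<le> K"
  shows "expectation (\<lambda>\<omega>. (norm (\<Sum>k\<in>UNIV. dB k s t \<omega> *\<^sub>R v k \<omega>))\<^sup>2) = (t - s) * expectation (\<lambda>\<omega>. \<Sum>k\<in>UNIV. (norm (v k \<omega>))\<^sup>2)"
proof -
  have vM: "v k \<in> borel_measurable M" for k by (rule measurable_F_M[OF v(1)])
  have Lv: "L2 (v k)" for k
    by (rule L2_dominated[of _ "\<lambda>_. K\<^sup>2"]) (use vM v(2) in \<open>auto intro: power_mono\<close>)
  have m: "(\<lambda>\<omega>. v k \<omega> \<bullet> v k' \<omega>) \<in> borel_measurable (F s)" for k k'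
    by (intro borel_measurable_inner v)
  note Lvv = L2_inner_integrable[OF Lv Lv]
  note i = past_times_dB_dB_integrable[OF assms(1,2) m Lvv]
  have "expectation (\<lambda>\<omega>. (norm (\<Sum>k\<in>UNIV. dB k s t \<omega> *\<^sub>R v k \<omega>))\<^sup>2)
    = expectation (\<lambda>\<omega>. \<Sum>k\<in>UNIV. \<Sum>k'\<in>UNIV. (v k' \<omega> \<bullet> v k \<omega>) * (dB k' s t \<omega> * dB k s t \<omega>))"
    by (intro Bochner_Integration.integral_cong refl)
      (simp add: power2_norm_eq_inner inner_sum_left inner_sum_right sum_distrib_left mult_ac)
  also have "\<dots> = (\<Sum>k\<in>UNIV. \<Sum>k'\<in>UNIV. expectation (\<lambda>\<omega>. (v k' \<omega> \<bullet> v k \<omega>) * (dB k' s t \<omega> * dB k s t \<omega>)))"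
    using i by (simp add: Bochner_Integration.integral_sum)
  also have "\<dots> = (\<Sum>k\<in>UNIV. \<Sum>k'\<in>UNIV. if k' = k then (t - s) * expectation (\<lambda>\<omega>. v k' \<omega> \<bullet> v k \<omega>) else 0)"
    by (intro sum.cong refl past_times_dB_dB_mean[OF assms(1,2) m Lvv])
  also have "\<dots> = (\<Sum>k\<in>UNIV. (t - s) * expectation (\<lambda>\<omega>. (norm (v k \<omega>))\<^sup>2))"
    by (simp add: power2_norm_eq_inner)
  also have "\<dots> = (t - s) * expectation (\<lambda>\<omega>. \<Sum>k\<in>UNIV. (norm (v k \<omega>))\<^sup>2)"
    using L2D(2)[OF Lv] by (simp add: Bochner_Integration.integral_sum sum_distrib_left)
  finally show ?thesis .
qed

lemma past_inner_dB_mean: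
  assumes "0 \<le> s" "s \<le> t" and Y: "Y \<in> borel_measurable (F s)" "L2 Y"
    and v: "v \<in> borel_measurable (F s)" "L2 v"
  shows "expectation (\<lambda>\<omega>. Y \<omega> \<bullet> (dB k s t \<omega> *\<^sub>R v \<omega>)) = 0"
proof -
  have "(\<lambda>\<omega>. Y \<omega> \<bullet> v \<omega>) \<in> borel_measurable (F s)"
    by (intro borel_measurable_inner Y v)
  from past_times_dB_mean[OF assms(1,2) this L2_inner_integrable[OF Y(2) v(2)], of k]
  show ?thesis by (simp add: mult.commute)
qed

end

section \<open>The scheme and its error recursion\<close>

context sde_setting
begin

lemmas implicit_eq = implicit_step_eq[OF U_cont U_mono0]

lemma implicit_measurable: "\<delta> > 0 \<Longrightarrow> implicit_step U \<delta> \<in> borel_measurable borel"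
proof -
  assume "\<delta> > 0"
  then have "1-lipschitz_on UNIV (implicit_step U \<delta>)"
    using implicit_step_nonexpansive[OF U_cont U_mono0] by (auto simp: lipschitz_on_def dist_norm)
  then show ?thesis
    by (intro borel_measurable_continuous_onI lipschitz_on_continuous_on)
qed

lemma split_step_Suc:
  "split_step_euler U V B \<delta> x (Suc n) \<omega> = implicit_step U \<delta> (split_step_euler U V B \<delta> x n \<omega>) +
     sqrt 2 *\<^sub>R (\<Sum>k\<in>UNIV. dB k (real n * \<delta>) (real (Suc n) * \<delta>) \<omega> *\<^sub>R V k (implicit_step U \<delta> (split_step_euler U V B \<delta> x n \<omega>)))"
  by (simp add: Let_def dB_def)

text \<open>Nonexpansiveness, compared with the image of 0, gives linear growth of the implicit step
  however fast \<open>U\<close> grows.\<close>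

lemma implicit_L2:
  assumes "\<delta> > 0" "L2 f"
  shows "L2 (\<lambda>\<omega>. implicit_step U \<delta> (f \<omega>))"
proof (rule L2_dominated)
  show "integrable M (\<lambda>\<omega>. 2 * (norm (f \<omega>))\<^sup>2 + 2 * (norm (implicit_step U \<delta> 0))\<^sup>2)"
    using assms(2) by (simp add: L2_def)
  show "(\<lambda>\<omega>. implicit_step U \<delta> (f \<omega>)) \<in> borel_measurable M"
    by (rule measurable_compose[OF L2D(1)[OF assms(2)] implicit_measurable[OF assms(1)]])
  fix \<omega>
  have "norm (implicit_step U \<delta> (f \<omega>) - implicit_step U \<delta> 0) \<le> norm (f \<omega> - 0)"
    using assms(1) by (intro implicit_step_nonexpansive[OF U_cont U_mono0]) simp
  then have "(norm (implicit_step U \<delta> (f \<omega>) - implicit_step U \<delta> 0))\<^sup>2 \<le> (norm (f \<omega>))\<^sup>2"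
    by (intro power_mono) simp_all
  moreover have "(norm (implicit_step U \<delta> (f \<omega>)))\<^sup>2
      \<le> 2 * (norm (implicit_step U \<delta> (f \<omega>) - implicit_step U \<delta> 0))\<^sup>2 + 2 * (norm (implicit_step U \<delta> 0))\<^sup>2"
    using norm_add_sq_le[of "implicit_step U \<delta> (f \<omega>) - implicit_step U \<delta> 0" "implicit_step U \<delta> 0"]
    by (simp only: diff_add_cancel)
  ultimately show "(norm (implicit_step U \<delta> (f \<omega>)))\<^sup>2 \<le> 2 * (norm (f \<omega>))\<^sup>2 + 2 * (norm (implicit_step U \<delta> 0))\<^sup>2"
    by linarith
qed

lemma split_step_L2:
  assumes \<delta>: "\<delta> > 0"
  shows "split_step_euler U V B \<delta> x n \<in> borel_measurable (F (real n * \<delta>)) \<and> L2 (split_step_euler U V B \<delta> x n)"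
proof (induction n)
  case 0
  then show ?case by (simp add: L2_const[of x, unfolded L2_def] L2_def)
next
  case (Suc n)
  let ?Z = "split_step_euler U V B \<delta> x"
  let ?s = "real n * \<delta>" and ?t = "real (Suc n) * \<delta>"
  define S where "S \<omega> = implicit_step U \<delta> (?Z n \<omega>)" for \<omega>
  have st: "0 \<le> ?s" "?s \<le> ?t" using \<delta> by (auto simp: algebra_simps)
  have SF: "S \<in> borel_measurable (F ?s)"
    unfolding S_def[abs_def] using Suc measurable_compose[OF _ implicit_measurable[OF \<delta>]] by blast
  have eq: "?Z (Suc n) = (\<lambda>\<omega>. S \<omega> + sqrt 2 *\<^sub>R (\<Sum>k\<in>UNIV. dB k ?s ?t \<omega> *\<^sub>R V k (S \<omega>)))"
    by (simp only: fun_eq_iff split_step_Suc S_def) simp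
  have "?Z (Suc n) \<in> borel_measurable (F ?t)"
    unfolding eq using st
    by (intro borel_measurable_add borel_measurable_scaleR borel_measurable_const borel_measurable_sum dB_measurable_F
        measurable_F_mono[OF SF] measurable_F_mono[OF measurable_compose[OF SF V_measurable]]) auto
  moreover have "L2 (?Z (Suc n))"
    unfolding eq using implicit_L2[OF \<delta>, of "?Z n"] Suc
    by (intro L2_add L2_scaleR L2_sum L2_dB_bounded[OF st measurable_compose[OF measurable_F_M[OF SF] V_measurable] V_bd])
      (auto simp: S_def[abs_def])
  ultimately show ?case by (rule conjI)
qed

lemma solution_L2:
  assumes sol: "sde_solution M F B U V x X" and t: "0 \<le> t"
  shows "L2 (X t)" "L2 (\<lambda>\<omega>. U (X t \<omega>))"
proof -
  have m: "X t \<in> borel_measurable M" by (rule solution_measurable[OF sol t])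
  obtain C where "C > 0" "(\<integral>\<^sup>+\<omega>. ennreal (norm (X t \<omega>) ^ (2 * 1)) \<partial>M) \<le> ennreal (C * (1 + norm x) ^ (2 * 1))"
    using even_moment_bound[of 1] sol t by auto
  then show "L2 (X t)" by (intro L2_bound(1)[OF m]) auto
  obtain C' where "C' > 0" "(\<integral>\<^sup>+\<omega>. ennreal (norm (U (X t \<omega>)) ^ 2) \<partial>M) \<le> ennreal (C' * (1 + norm x) powr ((q + 1) * real 2))"
    using U_moment_bound[of 2] sol t by blast
  then show "L2 (\<lambda>\<omega>. U (X t \<omega>))"
    by (intro L2_bound(1)[OF measurable_compose[OF m U_measurable]]) auto
qed

text \<open>The scheme is compared with the solution in the variable \<open>y - \<delta> U y\<close>, in which the
  implicit step becomes explicit: monotonicity of \<open>U\<close> makes its norm dominate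
  \<open>\<bar>e\<bar>\<^sup>2 + 2 \<delta> D\<close> below.\<close>

definition transformed_error :: "real \<Rightarrow> (real \<Rightarrow> 'a \<Rightarrow> 'b) \<Rightarrow> 'b \<Rightarrow> nat \<Rightarrow> 'a \<Rightarrow> 'b" where
  "transformed_error \<delta> X x n \<omega> =
     X (real n * \<delta>) \<omega> - \<delta> *\<^sub>R U (X (real n * \<delta>) \<omega>) - split_step_euler U V B \<delta> x n \<omega>"

lemma transformed_error_L2:
  assumes "sde_solution M F B U V x X" "\<delta> > 0"
  shows "L2 (transformed_error \<delta> X x n)"
  unfolding transformed_error_def[abs_def]
  using assms by (intro L2_diff L2_scaleR solution_L2[OF assms(1)] split_step_L2[THEN conjunct2]) auto

text \<open>The new transformed error is e + P + Rm + Rd: the difference \<open>e\<close> between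
  the solution and the implicit intermediate value, the difference \<open>P\<close> of the coupled
  noises, and the errors of freezing the diffusion and the drift along the exact solution.
  \<open>P + Rm\<close> is orthogonal to \<open>e\<close>, and \<open>P\<close> is paid for by the
  dissipation \<open>D\<close>.\<close>

lemma error_recursion:
  "\<exists>G>0. \<forall>x X \<delta> n. sde_solution M F B U V x X \<and> 0 < \<delta> \<and> \<delta> \<le> 1 \<and> \<delta> \<le> 1 / l \<longrightarrow>
    expectation (\<lambda>\<omega>. (norm (transformed_error \<delta> X x (Suc n) \<omega>))\<^sup>2)
    \<le> (1 - l / 4 * \<delta>) * expectation (\<lambda>\<omega>. (norm (transformed_error \<delta> X x n \<omega>))\<^sup>2)
       + G * (1 + norm x) powr (4 * q + 4) * \<delta>\<^sup>2"
proof -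
  obtain Cd where Cd: "Cd > 0" and bdd: "\<And>x X s t. sde_solution M F B U V x X \<Longrightarrow> 0 \<le> s \<Longrightarrow> s \<le> t \<Longrightarrow> t \<le> s + 1 \<Longrightarrow>
    (\<integral>\<^sup>+\<omega>. ennreal ((norm (integral {s..t} (\<lambda>r. U (X r \<omega>) - U (X t \<omega>))))\<^sup>2) \<partial>M)
    \<le> ennreal (Cd * (1 + norm x) powr (4 * q + 4) * (t - s) ^ 3)"
    using drift_remainder_sq by blast
  obtain Cm where Cm: "Cm > 0" and bdm: "\<And>x X s t N. sde_solution M F B U V x X \<Longrightarrow> 0 \<le> s \<Longrightarrow> s < t \<Longrightarrow> t \<le> s + 1 \<Longrightarrow> martingale_increment X s t N \<Longrightarrow>
    (\<integral>\<^sup>+\<omega>. ennreal ((norm (sqrt 2 *\<^sub>R (\<Sum>k\<in>UNIV. N k \<omega> - dB k s t \<omega> *\<^sub>R V k (X s \<omega>))))\<^sup>2) \<partial>M)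
    \<le> ennreal (Cm * (1 + norm x) powr (4 * q + 4) * (t - s)\<^sup>2)"
    using martingale_remainder_sq by blast
  \<comment> \<open>The 4 is a 2 from separating \<open>P\<close> and \<open>Rm\<close> times a 2
    from \<open>1 + \<eta> * \<delta> \<le> 2\<close>; \<open>4 / l\<close> is
    \<open>1 / \<eta>\<close>, from the weight on the drift error.\<close>
  define G where "G = 4 * Cm + Cd * (1 + 4 / l)"
  have G: "G > 0" using Cd Cm pos by (simp add: G_def add_pos_pos)
  show ?thesis
  proof (intro exI[of _ G] conjI allI impI G, goal_cases)
    case (1 x X \<delta> n)
    then have sol: "sde_solution M F B U V x X" and \<delta>: "0 < \<delta>" "\<delta> \<le> 1" "\<delta> \<le> 1 / l" by auto
    define s where "s = real n * \<delta>"
    define t where "t = real (Suc n) * \<delta>"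
    have ts: "t - s = \<delta>" by (simp add: s_def t_def algebra_simps)
    have st: "0 \<le> s" "s < t" "s \<le> t" "t \<le> s + 1" "0 \<le> t" proof -
      show "0 \<le> s" using \<delta> by (simp add: s_def)
      then show "s < t" "s \<le> t" "t \<le> s + 1" "0 \<le> t" using \<delta> ts by linarith+
    qed
    define Q where "Q = (1 + norm x) powr (4 * q + 4)"
    have Q: "0 \<le> Q" by (simp add: Q_def)
    let ?Z = "split_step_euler U V B \<delta> x"
    define S where "S \<omega> = implicit_step U \<delta> (?Z n \<omega>)" for \<omega>
    \<comment> \<open>The implicit step read backwards: \<open>?Z n\<close> is the transformed
      variable of \<open>S\<close>, so the transformed error compares
      \<open>y - \<delta> *\<^sub>R U y\<close> at the two points \<open>X s\<close> and
      \<open>S\<close>.\<close>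
    have Seq: "?Z n \<omega> = S \<omega> - \<delta> *\<^sub>R U (S \<omega>)" for \<omega>
      using implicit_eq[of \<delta> "?Z n \<omega>"] \<delta>(1) unfolding S_def by (metis add_diff_cancel_right' less_imp_le)
    have ZF: "?Z n \<in> borel_measurable (F s)" and ZL: "L2 (?Z n)"
      using split_step_L2[OF \<delta>(1), of x n] by (auto simp: s_def)
    have SF: "S \<in> borel_measurable (F s)"
      unfolding S_def[abs_def] by (rule measurable_compose[OF ZF implicit_measurable[OF \<delta>(1)]])
    have SL: "L2 S" unfolding S_def[abs_def] by (rule implicit_L2[OF \<delta>(1) ZL])
    have XF: "X s \<in> borel_measurable (F s)" by (rule solution_adapted[OF sol st(1)])
    note XL = solution_L2[OF sol st(1)]
    \<comment> \<open>Only second moments of \<open>S\<close> are known, while \<open>U\<close> may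
      grow faster than linearly; the implicit equation expresses \<open>U (S \<omega>)\<close> by
      square-integrable terms.\<close>
    have USL: "L2 (\<lambda>\<omega>. U (S \<omega>))"
    proof -
      have "U (S \<omega>) = (1 / \<delta>) *\<^sub>R (S \<omega> - ?Z n \<omega>)" for \<omega>
        unfolding Seq using \<delta>(1) by simp
      then show ?thesis using L2_scaleR[OF L2_diff[OF SL ZL], of "1 / \<delta>"] by simp
    qed
    define e where "e \<omega> = X s \<omega> - S \<omega>" for \<omega>
    define D where "D \<omega> = - ((U (X s \<omega>) - U (S \<omega>)) \<bullet> e \<omega>)" for \<omega>
    have eF: "e \<in> borel_measurable (F s)" unfolding e_def[abs_def] by (intro borel_measurable_diff XF SF)
    have eL: "L2 e" unfolding e_def[abs_def] by (rule L2_diff[OF XL(1) SL])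
    have Dint: "integrable M D"
      unfolding D_def[abs_def] by (intro Bochner_Integration.integrable_minus L2_inner_integrable L2_diff XL(2) USL eL)
    have De: "l * (norm (e \<omega>))\<^sup>2 \<le> D \<omega>" for \<omega>
      using U_mono[of "X s \<omega>" "S \<omega>"] by (simp add: D_def e_def)
    let ?A = "expectation (\<lambda>\<omega>. (norm (transformed_error \<delta> X x n \<omega>))\<^sup>2)"
    let ?E = "expectation (\<lambda>\<omega>. (norm (e \<omega>))\<^sup>2)"
    let ?D = "expectation D"
    have aL: "L2 (transformed_error \<delta> X x n)" "L2 (transformed_error \<delta> X x (Suc n))"
      by (rule transformed_error_L2[OF sol \<delta>(1)])+
    \<comment> \<open>The expansion of the square has the cross term
      \<open>2 * \<delta> * D\<close>; the nonnegative term with \<open>\<delta>\<^sup>2\<close> is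
      dropped.\<close>
    have A_ge: "?E + 2 * \<delta> * ?D \<le> ?A"
    proof -
      have "?E + 2 * \<delta> * ?D = expectation (\<lambda>\<omega>. (norm (e \<omega>))\<^sup>2 + 2 * \<delta> * D \<omega>)"
        using L2D(2)[OF eL] Dint by simp
      also have "\<dots> \<le> ?A"
      proof (rule integral_mono)
        show "integrable M (\<lambda>\<omega>. (norm (e \<omega>))\<^sup>2 + 2 * \<delta> * D \<omega>)" using L2D(2)[OF eL] Dint by simp
        show "integrable M (\<lambda>\<omega>. (norm (transformed_error \<delta> X x n \<omega>))\<^sup>2)" by (rule L2D(2)[OF aL(1)])
        fix \<omega>
        have "transformed_error \<delta> X x n \<omega> = e \<omega> - \<delta> *\<^sub>R (U (X s \<omega>) - U (S \<omega>))"
          by (simp add: transformed_error_def e_def Seq s_def[symmetric] scaleR_diff_right)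
        then have "(norm (transformed_error \<delta> X x n \<omega>))\<^sup>2 = (norm (e \<omega>))\<^sup>2 + 2 * \<delta> * D \<omega> + \<delta>\<^sup>2 * (norm (U (X s \<omega>) - U (S \<omega>)))\<^sup>2"
          by (simp only: power2_norm_eq_inner D_def inner_diff_left[of "e \<omega>"] inner_diff_right[of _ "e \<omega>"] inner_scaleR_left inner_scaleR_right
              inner_commute[of "e \<omega>" "U _ - U _"]) (simp add: power2_eq_square algebra_simps)
        then show "(norm (e \<omega>))\<^sup>2 + 2 * \<delta> * D \<omega> \<le> (norm (transformed_error \<delta> X x n \<omega>))\<^sup>2" by simp
      qed
      finally show ?thesis .
    qed
    have ED: "l * ?E \<le> ?D"
    proof -
      have "l * ?E = expectation (\<lambda>\<omega>. l * (norm (e \<omega>))\<^sup>2)" by simp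
      also have "\<dots> \<le> ?D" by (intro integral_mono De Dint integrable_mult_right L2D(2) eL)
      finally show ?thesis .
    qed
    obtain N where mi: "martingale_increment X s t N"
      using martingale_increment_exists[OF sol st(1,2)] by (rule exE)
    have NM: "N k \<in> borel_measurable M" for k using mi by (simp add: martingale_increment_def)
    have Nmean: "expectation (\<lambda>\<omega>. e \<omega> \<bullet> N k \<omega>) = 0" for k
      using mi eF eL unfolding martingale_increment_def by blast
    have NL: "L2 (N k)" for k
    proof (rule L2_bound(1)[OF NM])
      have "(\<integral>\<^sup>+\<omega>. ennreal (norm (N k \<omega>) ^ (2 * 1)) \<partial>M) \<le> ennreal (moment_const 1 * (t - s) ^ 1)"
        using mi unfolding martingale_increment_def by blast
      then show "(\<integral>\<^sup>+\<omega>. ennreal ((norm (N k \<omega>))\<^sup>2) \<partial>M) \<le> ennreal (moment_const 1 * \<delta>)" by (simp add: ts)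
    qed (use \<delta> in \<open>simp add: moment_const_def\<close>)
    have VX: "(\<lambda>\<omega>. V k (X s \<omega>)) \<in> borel_measurable (F s)" and VS: "(\<lambda>\<omega>. V k (S \<omega>)) \<in> borel_measurable (F s)" for k
      by (rule measurable_compose[OF XF V_measurable], rule measurable_compose[OF SF V_measurable])
    have dBVX: "L2 (\<lambda>\<omega>. dB k s t \<omega> *\<^sub>R V k (X s \<omega>))" and dBVS: "L2 (\<lambda>\<omega>. dB k s t \<omega> *\<^sub>R V k (S \<omega>))" for k
      by (rule L2_dB_bounded[OF st(1,3) measurable_F_M[OF VX] V_bd], rule L2_dB_bounded[OF st(1,3) measurable_F_M[OF VS] V_bd])
    have VSL: "L2 (\<lambda>\<omega>. V k (S \<omega>))" for k
      by (rule L2_dominated[of _ "\<lambda>_. K\<^sup>2"]) (use measurable_F_M[OF VS] V_bd in \<open>auto intro: power_mono\<close>)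
    define v where "v k \<omega> = V k (X s \<omega>) - V k (S \<omega>)" for k \<omega>
    have vF: "v k \<in> borel_measurable (F s)" for k
      unfolding v_def[abs_def] by (intro borel_measurable_diff VX VS)
    have vK: "norm (v k \<omega>) \<le> K + K" for k \<omega>
      unfolding v_def by (rule order_trans[OF norm_triangle_ineq4 add_mono[OF V_bd V_bd]])
    define P where "P \<omega> = sqrt 2 *\<^sub>R (\<Sum>k\<in>UNIV. dB k s t \<omega> *\<^sub>R v k \<omega>)" for \<omega>
    define Rm where "Rm \<omega> = sqrt 2 *\<^sub>R (\<Sum>k\<in>UNIV. N k \<omega> - dB k s t \<omega> *\<^sub>R V k (X s \<omega>))" for \<omega>
    have PL: "L2 P"
      unfolding P_def[abs_def] by (intro L2_scaleR L2_sum L2_dB_bounded[OF st(1,3) measurable_F_M[OF vF] vK]) simp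
    have RmL: "L2 Rm"
      unfolding Rm_def[abs_def] by (intro L2_scaleR L2_sum L2_diff NL dBVX) simp
    have mL: "L2 (\<lambda>\<omega>. P \<omega> + Rm \<omega>)" by (rule L2_add[OF PL RmL])
    have PRm: "P \<omega> + Rm \<omega> = sqrt 2 *\<^sub>R (\<Sum>k\<in>UNIV. N k \<omega> - dB k s t \<omega> *\<^sub>R V k (S \<omega>))" for \<omega>
      unfolding P_def Rm_def scaleR_add_right[symmetric] sum.distrib[symmetric] v_def
      by (simp add: algebra_simps)
    have orth: "expectation (\<lambda>\<omega>. e \<omega> \<bullet> (P \<omega> + Rm \<omega>)) = 0"
    proof -
      have i1: "integrable M (\<lambda>\<omega>. e \<omega> \<bullet> N k \<omega>)" and i2: "integrable M (\<lambda>\<omega>. e \<omega> \<bullet> (dB k s t \<omega> *\<^sub>R V k (S \<omega>)))" for k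
        by (rule L2_inner_integrable[OF eL NL], rule L2_inner_integrable[OF eL dBVS])
      have "expectation (\<lambda>\<omega>. e \<omega> \<bullet> (P \<omega> + Rm \<omega>)) = expectation (\<lambda>\<omega>. sqrt 2 * (\<Sum>k\<in>UNIV. e \<omega> \<bullet> N k \<omega> - e \<omega> \<bullet> (dB k s t \<omega> *\<^sub>R V k (S \<omega>))))"
        unfolding PRm by (simp only: inner_scaleR_right inner_sum_right inner_diff_right)
      also have "\<dots> = sqrt 2 * (\<Sum>k\<in>UNIV. expectation (\<lambda>\<omega>. e \<omega> \<bullet> N k \<omega>) - expectation (\<lambda>\<omega>. e \<omega> \<bullet> (dB k s t \<omega> *\<^sub>R V k (S \<omega>))))"
        by (subst integral_mult_right_zero, subst Bochner_Integration.integral_sum[OF Bochner_Integration.integrable_diff[OF i1 i2]])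
          (simp only: Bochner_Integration.integral_diff[OF i1 i2])
      also have "\<dots> = 0"
        by (simp only: Nmean past_inner_dB_mean[OF st(1,3) eF eL VS VSL]) simp
      finally show ?thesis .
    qed
    \<comment> \<open>The 2 comes from \<open>sqrt 2\<close>, the 1/5 from \<open>V_le_U\<close>,
      and \<delta> from the isometry.\<close>
    have EP: "expectation (\<lambda>\<omega>. (norm (P \<omega>))\<^sup>2) \<le> 2 / 5 * \<delta> * ?D"
    proof -
      have vv: "integrable M (\<lambda>\<omega>. \<Sum>k\<in>UNIV. (norm (v k \<omega>))\<^sup>2)"
      proof (rule Bochner_Integration.integrable_sum)
        show "integrable M (\<lambda>\<omega>. (norm (v k \<omega>))\<^sup>2)" for k
          by (rule L2D(2), rule L2_dominated[of _ "\<lambda>_. (K + K)\<^sup>2"], rule measurable_F_M[OF vF], simp,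
              rule power_mono[OF vK norm_ge_zero])
      qed
      have "expectation (\<lambda>\<omega>. (norm (P \<omega>))\<^sup>2) = 2 * expectation (\<lambda>\<omega>. (norm (\<Sum>k\<in>UNIV. dB k s t \<omega> *\<^sub>R v k \<omega>))\<^sup>2)"
        by (simp add: P_def power_mult_distrib)
      also have "\<dots> = 2 * (\<delta> * expectation (\<lambda>\<omega>. \<Sum>k\<in>UNIV. (norm (v k \<omega>))\<^sup>2))"
        by (simp only: dB_sum_isometry[OF st(1,3) vF vK] ts)
      also have "\<dots> \<le> 2 * (\<delta> * expectation (\<lambda>\<omega>. 1 / 5 * D \<omega>))"
      proof (intro mult_left_mono integral_mono vv)
        show "(\<Sum>k\<in>UNIV. (norm (v k \<omega>))\<^sup>2) \<le> 1 / 5 * D \<omega>" for \<omega>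
          using V_le_U[of "X s \<omega>" "S \<omega>"] by (simp add: v_def D_def e_def)
      qed (use Dint \<delta> in auto)
      finally show ?thesis by simp
    qed
    have ERm: "expectation (\<lambda>\<omega>. (norm (Rm \<omega>))\<^sup>2) \<le> Cm * Q * \<delta>\<^sup>2"
      using bdm[OF sol st(1,2,4) mi, folded Rm_def] L2D(1)[OF RmL] Cm Q
      by (intro L2_bound(2)) (simp_all add: Q_def ts)
    \<comment> \<open>Defined by subtraction, \<open>Rd\<close> is square-integrable at once; its
      identification with the drift remainder holds only almost surely, on continuous paths.\<close>
    define Rd where "Rd \<omega> = transformed_error \<delta> X x (Suc n) \<omega> - (e \<omega> + (P \<omega> + Rm \<omega>))" for \<omega>
    have RdL: "L2 Rd" unfolding Rd_def[abs_def] by (intro L2_diff L2_add eL mL aL(2) PL RmL)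
    have Rd_eq: "AE \<omega> in M. Rd \<omega> = integral {s..t} (\<lambda>r. U (X r \<omega>) - U (X t \<omega>))"
    proof -
      have "AE \<omega> in M. noise X s t \<omega> = sqrt 2 *\<^sub>R (\<Sum>k\<in>UNIV. N k \<omega>)"
        using mi by (simp add: martingale_increment_def)
      then show ?thesis using solution_continuous[OF sol]
      proof eventually_elim
        case (elim \<omega>)
        have "integral {s..t} (\<lambda>r. U (X r \<omega>) - U (X t \<omega>)) = integral {s..t} (\<lambda>r. U (X r \<omega>)) - \<delta> *\<^sub>R U (X t \<omega>)"
          using continuous_drift_path[where X = X and \<omega> = \<omega>, OF elim(2) st(1), of t] st ts
          by (subst Henstock_Kurzweil_Integration.integral_diff) (auto intro: integrable_continuous_real integrable_const_ivl)
        moreover have "X t \<omega> = X s \<omega> + integral {s..t} (\<lambda>r. U (X r \<omega>)) + sqrt 2 *\<^sub>R (\<Sum>k\<in>UNIV. N k \<omega>)"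
          using elim(1) by (simp add: noise_def algebra_simps)
        moreover have "transformed_error \<delta> X x (Suc n) \<omega> = X t \<omega> - \<delta> *\<^sub>R U (X t \<omega>) - (S \<omega> + sqrt 2 *\<^sub>R (\<Sum>k\<in>UNIV. dB k s t \<omega> *\<^sub>R V k (S \<omega>)))"
          unfolding transformed_error_def split_step_Suc S_def s_def t_def ..
        moreover have "P \<omega> + Rm \<omega> = sqrt 2 *\<^sub>R (\<Sum>k\<in>UNIV. N k \<omega>) - sqrt 2 *\<^sub>R (\<Sum>k\<in>UNIV. dB k s t \<omega> *\<^sub>R V k (S \<omega>))"
          unfolding PRm sum_subtractf scaleR_diff_right ..
        ultimately show ?case by (simp add: Rd_def e_def)
      qed
    qed
    have ERd: "expectation (\<lambda>\<omega>. (norm (Rd \<omega>))\<^sup>2) \<le> Cd * Q * \<delta> ^ 3"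
    proof (rule L2_bound(2)[OF L2D(1)[OF RdL]])
      have "(\<integral>\<^sup>+\<omega>. ennreal ((norm (Rd \<omega>))\<^sup>2) \<partial>M) = (\<integral>\<^sup>+\<omega>. ennreal ((norm (integral {s..t} (\<lambda>r. U (X r \<omega>) - U (X t \<omega>))))\<^sup>2) \<partial>M)"
        using Rd_eq by (intro nn_integral_cong_AE) auto
      also have "\<dots> \<le> ennreal (Cd * Q * \<delta> ^ 3)"
        using bdd[OF sol st(1,3,4)] by (simp add: Q_def ts)
      finally show "(\<integral>\<^sup>+\<omega>. ennreal ((norm (Rd \<omega>))\<^sup>2) \<partial>M) \<le> ennreal (Cd * Q * \<delta> ^ 3)" .
    qed (use Cd Q \<delta> in simp)
    let ?M = "expectation (\<lambda>\<omega>. (norm (e \<omega> + (P \<omega> + Rm \<omega>)))\<^sup>2)"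
    \<comment> \<open>With this rate \<open>2 * \<eta> * ?E\<close> is at most half of
      \<open>?D\<close>, and \<open>\<delta> \<le> 1 / l\<close> gives
      \<open>\<eta> * \<delta> \<le> 1 / 4\<close>; these are the two hypotheses of
      \<open>contraction_arithmetic\<close>.\<close>
    define \<eta> where "\<eta> = l / 4"
    have \<eta>: "\<eta> > 0" "\<eta> * \<delta> \<le> 1 / 4" "0 < \<eta> * \<delta>"
      using pos \<delta> by (auto simp: \<eta>_def field_simps)
    have EM: "?M \<le> ?E + 4 / 5 * \<delta> * ?D + 2 * (Cm * Q * \<delta>\<^sup>2)"
    proof -
      have "?M = ?E + expectation (\<lambda>\<omega>. (norm (P \<omega> + Rm \<omega>))\<^sup>2)"
        by (rule expectation_norm_sq_orthogonal[OF eL mL orth])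
      also have "expectation (\<lambda>\<omega>. (norm (P \<omega> + Rm \<omega>))\<^sup>2) \<le> (1 + 1) * expectation (\<lambda>\<omega>. (norm (P \<omega>))\<^sup>2) + (1 + 1 / 1) * expectation (\<lambda>\<omega>. (norm (Rm \<omega>))\<^sup>2)"
        by (rule expectation_norm_sq_add_le[OF PL RmL]) simp
      finally show ?thesis using EP ERm by simp
    qed
    have "expectation (\<lambda>\<omega>. (norm (transformed_error \<delta> X x (Suc n) \<omega>))\<^sup>2) = expectation (\<lambda>\<omega>. (norm ((e \<omega> + (P \<omega> + Rm \<omega>)) + Rd \<omega>))\<^sup>2)"
      by (simp add: Rd_def)
    \<comment> \<open>No orthogonality is available for \<open>Rd\<close>. The surplus of
      dissipation tolerates the factor \<open>1 + \<eta> * \<delta>\<close> on the main part, and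
      the weight \<open>1 / (\<eta> * \<delta>)\<close> lowers \<open>\<delta> ^ 3\<close> to
      \<open>\<delta>\<^sup>2\<close>.\<close>
    also have "\<dots> \<le> (1 + \<eta> * \<delta>) * ?M + (1 + 1 / (\<eta> * \<delta>)) * expectation (\<lambda>\<omega>. (norm (Rd \<omega>))\<^sup>2)"
      by (rule expectation_norm_sq_add_le[OF L2_add[OF eL mL] RdL \<eta>(3)])
    also have "\<dots> \<le> (1 + \<eta> * \<delta>) * (?E + 4 / 5 * \<delta> * ?D + 2 * (Cm * Q * \<delta>\<^sup>2)) + (1 + 1 / (\<eta> * \<delta>)) * (Cd * Q * \<delta> ^ 3)"
      using \<eta> by (intro add_mono mult_left_mono EM ERd) auto
    also have "\<dots> \<le> (1 - \<eta> * \<delta>) * ?A + G * Q * \<delta>\<^sup>2"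
    proof -
      have E0: "0 \<le> ?E" by simp
      have D0: "0 \<le> ?D" using ED E0 pos by (meson mult_nonneg_nonneg less_imp_le order_trans)
      have 1: "(1 + \<eta> * \<delta>) * (?E + 4 / 5 * \<delta> * ?D) \<le> (1 - \<eta> * \<delta>) * (?E + 2 * \<delta> * ?D)"
      proof -
        have "2 * (\<eta> * \<delta> * ?E) \<le> 1 / 2 * (\<delta> * ?D)"
          using mult_left_mono[OF ED, of "\<delta> / 2"] \<delta> by (simp add: \<eta>_def mult_ac)
        moreover have "\<eta> * \<delta> * (\<delta> * ?D) \<le> 1 / 4 * (\<delta> * ?D)"
          using \<eta> \<delta> D0 by (intro mult_right_mono) auto
        ultimately show ?thesis
          using contraction_arithmetic[of "\<eta> * \<delta>" ?E "\<delta> * ?D"] by (simp only: mult.assoc)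
      qed
      have 2: "(1 - \<eta> * \<delta>) * (?E + 2 * \<delta> * ?D) \<le> (1 - \<eta> * \<delta>) * ?A"
        using \<eta> A_ge by (intro mult_left_mono) auto
      have 3: "(1 + \<eta> * \<delta>) * (2 * (Cm * Q * \<delta>\<^sup>2)) \<le> 2 * (2 * (Cm * Q * \<delta>\<^sup>2))"
        using \<eta> Cm Q by (intro mult_right_mono) auto
      have 4: "(1 + 1 / (\<eta> * \<delta>)) * (Cd * Q * \<delta> ^ 3) \<le> Cd * (1 + 4 / l) * Q * \<delta>\<^sup>2"
      proof -
        have "(1 + 1 / (\<eta> * \<delta>)) * (Cd * Q * \<delta> ^ 3) = \<delta> * (Cd * Q * \<delta>\<^sup>2) + (1 / \<eta>) * (Cd * Q * \<delta>\<^sup>2)"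
          using \<delta> \<eta> by (simp add: field_simps power2_eq_square power3_eq_cube)
        also have "\<dots> \<le> 1 * (Cd * Q * \<delta>\<^sup>2) + (1 / \<eta>) * (Cd * Q * \<delta>\<^sup>2)"
          using \<delta> Cd Q by (intro add_mono mult_right_mono) auto
        also have "\<dots> = Cd * (1 + 4 / l) * Q * \<delta>\<^sup>2" by (simp add: \<eta>_def algebra_simps)
        finally show ?thesis .
      qed
      have "(1 + \<eta> * \<delta>) * (?E + 4 / 5 * \<delta> * ?D + 2 * (Cm * Q * \<delta>\<^sup>2)) = (1 + \<eta> * \<delta>) * (?E + 4 / 5 * \<delta> * ?D) + (1 + \<eta> * \<delta>) * (2 * (Cm * Q * \<delta>\<^sup>2))"
        by (rule distrib_left)
      moreover have "G * Q * \<delta>\<^sup>2 = 2 * (2 * (Cm * Q * \<delta>\<^sup>2)) + Cd * (1 + 4 / l) * Q * \<delta>\<^sup>2"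
        by (simp add: G_def distrib_right)
      ultimately show ?thesis using 1 2 3 4 by linarith
    qed
    finally show ?case by (simp add: Q_def \<eta>_def)
  qed
qed

text \<open>In the recursion the local error of order \<delta>^2 is divided by the rate l \<delta> /
  4, so the resulting bound of order \<delta> does not depend on \<open>n\<close>.\<close>

lemma strong_error:
  "\<exists>C>0. \<exists>\<delta>\<^sub>0>0. \<forall>x X \<delta> n. sde_solution M F B U V x X \<and> 0 < \<delta> \<and> \<delta> < \<delta>\<^sub>0 \<longrightarrow>
    expectation (\<lambda>\<omega>. (norm (X (real n * \<delta>) \<omega> - split_step_euler U V B \<delta> x n \<omega>))\<^sup>2)
    \<le> C * (1 + norm x) powr (4 * q + 4) * \<delta>"
proof -
  obtain G where G: "G > 0" and rec: "\<And>x X \<delta> n. sde_solution M F B U V x X \<Longrightarrow> 0 < \<delta> \<Longrightarrow> \<delta> \<le> 1 \<Longrightarrow> \<delta> \<le> 1 / l \<Longrightarrow>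
    expectation (\<lambda>\<omega>. (norm (transformed_error \<delta> X x (Suc n) \<omega>))\<^sup>2)
    \<le> (1 - l / 4 * \<delta>) * expectation (\<lambda>\<omega>. (norm (transformed_error \<delta> X x n \<omega>))\<^sup>2)
       + G * (1 + norm x) powr (4 * q + 4) * \<delta>\<^sup>2"
    using error_recursion by blast
  obtain Cu where Cu: "Cu > 0" and bdU: "\<And>x X t. sde_solution M F B U V x X \<Longrightarrow> 0 \<le> t \<Longrightarrow>
    (\<integral>\<^sup>+\<omega>. ennreal ((norm (U (X t \<omega>)))\<^sup>2) \<partial>M) \<le> ennreal (Cu * (1 + norm x) powr ((q + 1) * real 2))"
    using U_moment_bound[of 2] by blast
  \<comment> \<open>In units of \<open>Q * \<delta>\<close>, \<open>4 * G / l\<close> is the fixed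
    point of the recursion; \<open>Cu\<close> covers the initial value, which is
    \<open>- \<delta> *\<^sub>R U x\<close> and not zero in the transformed variable.\<close>
  define A where "A = Cu + 4 * G / l"
  have A: "A > 0" using G Cu pos by (simp add: A_def add_pos_pos)
  define C where "C = 2 * A + 2 * Cu"
  have C: "C > 0" using A Cu by (simp add: C_def)
  \<comment> \<open>The bound 1 keeps the steps within the range of the local estimates;
    \<open>1 / l\<close> is what the contraction requires.\<close>
  have \<delta>0: "min 1 (1 / l) > 0" using pos by simp
  show ?thesis
  proof (rule exI[of _ C], intro conjI C, rule exI[of _ "min 1 (1 / l)"], intro conjI allI impI \<delta>0, goal_cases)
    case (1 x X \<delta> n)
    then have sol: "sde_solution M F B U V x X" and \<delta>: "0 < \<delta>" "\<delta> \<le> 1" "\<delta> \<le> 1 / l" by auto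
    define Q where "Q = (1 + norm x) powr (4 * q + 4)"
    have Q: "1 \<le> Q" unfolding Q_def using pos by (intro ge_one_powr_ge_zero) auto
    have EU: "expectation (\<lambda>\<omega>. (norm (\<delta> *\<^sub>R U (X t \<omega>)))\<^sup>2) \<le> Cu * Q * \<delta>" if "0 \<le> t" for t
    proof -
      have "expectation (\<lambda>\<omega>. (norm (U (X t \<omega>)))\<^sup>2) \<le> Cu * (1 + norm x) powr ((q + 1) * real 2)"
        using Cu by (intro L2_bound(2)[OF L2D(1)[OF solution_L2(2)[OF sol that]] bdU[OF sol that]]) simp
      also have "\<dots> \<le> Cu * Q"
        unfolding Q_def using Cu pos by (intro mult_left_mono powr_mono) auto
      finally have u: "expectation (\<lambda>\<omega>. (norm (U (X t \<omega>)))\<^sup>2) \<le> Cu * Q" .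
      have "expectation (\<lambda>\<omega>. (norm (\<delta> *\<^sub>R U (X t \<omega>)))\<^sup>2) = \<delta>\<^sup>2 * expectation (\<lambda>\<omega>. (norm (U (X t \<omega>)))\<^sup>2)"
        by (simp add: power_mult_distrib)
      also have "\<dots> \<le> \<delta>\<^sup>2 * (Cu * Q)" by (intro mult_left_mono u) simp
      also have "\<dots> \<le> \<delta> * (Cu * Q)"
        using \<delta> Cu Q by (intro mult_right_mono) (auto simp: power2_eq_square mult_left_le)
      finally show ?thesis by (simp add: mult_ac)
    qed
    have a: "expectation (\<lambda>\<omega>. (norm (transformed_error \<delta> X x m \<omega>))\<^sup>2) \<le> A * Q * \<delta>" for m
    proof (induction m)
      case 0
      have "expectation (\<lambda>\<omega>. (norm (transformed_error \<delta> X x 0 \<omega>))\<^sup>2) = expectation (\<lambda>\<omega>. (norm (\<delta> *\<^sub>R U (X 0 \<omega>)))\<^sup>2)"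
      proof (rule integral_cong_AE)
        show "AE \<omega> in M. (norm (transformed_error \<delta> X x 0 \<omega>))\<^sup>2 = (norm (\<delta> *\<^sub>R U (X 0 \<omega>)))\<^sup>2"
          using solution_start[OF sol] by eventually_elim (simp add: transformed_error_def)
        show "(\<lambda>\<omega>. (norm (transformed_error \<delta> X x 0 \<omega>))\<^sup>2) \<in> borel_measurable M"
          using L2D(1)[OF transformed_error_L2[OF sol \<delta>(1)]] by measurable
        show "(\<lambda>\<omega>. (norm (\<delta> *\<^sub>R U (X 0 \<omega>)))\<^sup>2) \<in> borel_measurable M"
          using L2D(1)[OF solution_L2(2)[OF sol order_refl]] by measurable
      qed
      also have "\<dots> \<le> Cu * Q * \<delta>" by (rule EU) simp
      also have "\<dots> \<le> A * Q * \<delta>"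
        using G pos Q \<delta> by (intro mult_right_mono) (auto simp: A_def)
      finally show ?case .
    next
      case (Suc m)
      have l4: "0 \<le> 1 - l / 4 * \<delta>" using \<delta> pos by (simp add: field_simps)
      have "expectation (\<lambda>\<omega>. (norm (transformed_error \<delta> X x (Suc m) \<omega>))\<^sup>2)
        \<le> (1 - l / 4 * \<delta>) * expectation (\<lambda>\<omega>. (norm (transformed_error \<delta> X x m \<omega>))\<^sup>2) + G * Q * \<delta>\<^sup>2"
        unfolding Q_def by (rule rec[OF sol \<delta>])
      also have "\<dots> \<le> (1 - l / 4 * \<delta>) * (A * Q * \<delta>) + G * Q * \<delta>\<^sup>2"
        by (intro add_right_mono mult_left_mono Suc.IH l4)
      also have "\<dots> = A * Q * \<delta> - (l / 4 * A - G) * (Q * \<delta>\<^sup>2)"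
        by (simp add: algebra_simps power2_eq_square)
      also have "\<dots> \<le> A * Q * \<delta>"
      proof -
        have "l / 4 * A - G = l / 4 * Cu" using pos by (simp add: A_def field_simps)
        then have "0 \<le> (l / 4 * A - G) * (Q * \<delta>\<^sup>2)"
          using pos Cu Q by (simp only:) simp
        then show ?thesis by linarith
      qed
      finally show ?case .
    qed
    have t0: "0 \<le> real n * \<delta>" using \<delta> by simp
    \<comment> \<open>Returning to the original variable costs \<delta> times the drift at the
      solution, whose mean square is bounded by order \<delta> in \<open>EU\<close>.\<close>
    have "expectation (\<lambda>\<omega>. (norm (X (real n * \<delta>) \<omega> - split_step_euler U V B \<delta> x n \<omega>))\<^sup>2)
      = expectation (\<lambda>\<omega>. (norm (transformed_error \<delta> X x n \<omega> + \<delta> *\<^sub>R U (X (real n * \<delta>) \<omega>)))\<^sup>2)"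
      by (simp add: transformed_error_def)
    also have "\<dots> \<le> (1 + 1) * expectation (\<lambda>\<omega>. (norm (transformed_error \<delta> X x n \<omega>))\<^sup>2)
        + (1 + 1 / 1) * expectation (\<lambda>\<omega>. (norm (\<delta> *\<^sub>R U (X (real n * \<delta>) \<omega>)))\<^sup>2)"
      by (rule expectation_norm_sq_add_le[OF transformed_error_L2[OF sol \<delta>(1)] L2_scaleR[OF solution_L2(2)[OF sol t0]]]) simp
    also have "\<dots> \<le> (1 + 1) * (A * Q * \<delta>) + (1 + 1 / 1) * (Cu * Q * \<delta>)"
      by (intro add_mono mult_left_mono a EU t0) simp_all
    also have "\<dots> = C * Q * \<delta>" by (simp add: C_def algebra_simps)
    finally show ?case by (simp add: Q_def)
  qed
qed

end

section \<open>Weak error\<close>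

lemma one_add_powr_le:
  fixes a p :: real
  assumes "0 \<le> a" "0 \<le> p"
  shows "(1 + a) powr p \<le> 2 powr p * (1 + a powr p)"
proof -
  have "(1 + a) powr p \<le> (2 * max 1 a) powr p"
    using assms by (intro powr_mono2) auto
  also have "\<dots> = 2 powr p * (max 1 a) powr p"
    using assms by (simp add: powr_mult)
  also have "(max 1 a) powr p \<le> 1 + a powr p"
    by (cases "a \<le> 1") (auto simp: max_def)
  finally show ?thesis by (simp add: mult_left_mono)
qed

section \<open>Test functions with bounded derivatives\<close>

lemma C2b_has_derivative:
  assumes "f \<in> C2b"
  shows "(f has_derivative (\<lambda>h. gradient f x \<bullet> h)) (at x)"
proof -
  have "C_k (Suc (Suc 0)) f"
    using assms by (simp add: C2b_def numeral_2_eq_2)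
  then have d: "f differentiable (at x)"
    by (simp add: differentiable_on_def)
  then have fd: "(f has_derivative frechet_derivative f (at x)) (at x)"
    by (simp add: frechet_derivative_works)
  have "frechet_derivative f (at x) h = gradient f x \<bullet> h" for h
  proof -
    interpret linear "frechet_derivative f (at x)"
      by (rule linear_frechet_derivative[OF d])
    have "frechet_derivative f (at x) h = frechet_derivative f (at x) (\<Sum>i\<in>UNIV. h $ i *\<^sub>R axis i 1)"
      using basis_expansion[of h] by (simp add: scalar_mult_eq_scaleR)
    also have "\<dots> = (\<Sum>i\<in>UNIV. h $ i * partial_der i f x)"
      by (simp add: sum scale partial_der_def)
    also have "\<dots> = gradient f x \<bullet> h"
      by (simp add: inner_vec_def gradient_def mult.commute)
    finally show ?thesis .
  qed
  then have "frechet_derivative f (at x) = (\<lambda>h. gradient f x \<bullet> h)" by (rule ext)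
  with fd show ?thesis by simp
qed

lemma gradient_le_C2b_seminorm:
  assumes "f \<in> C2b"
  shows "norm (gradient f x) \<le> C2b_seminorm f"
proof -
  obtain a b where a: "\<And>x. norm (gradient f x) \<le> a" and b: "\<And>x. norm (hessian f x) \<le> b"
    using assms by (auto simp: C2b_def bounded_iff)
  have "norm (gradient f x) \<le> norm (gradient f x) + norm (hessian f x)" by simp
  also have "\<dots> \<le> C2b_seminorm f"
    unfolding C2b_seminorm_def
  proof (rule cSUP_upper)
    show "bdd_above (range (\<lambda>x. norm (gradient f x) + norm (hessian f x)))"
      using add_mono[OF a b] by (intro bdd_aboveI[of _ "a + b"]) auto
  qed simp
  finally show ?thesis .
qed

lemma C2b_lipschitz:
  fixes f :: "real^'n \<Rightarrow> real"
  assumes "f \<in> C2b"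
  shows "\<bar>f y - f z\<bar> \<le> C2b_seminorm f * norm (y - z)"
proof -
  have "norm (f y - f z) \<le> C2b_seminorm f * norm (y - z)"
  proof (rule differentiable_bound[OF convex_UNIV])
    show "(f has_derivative (\<lambda>h. gradient f x \<bullet> h)) (at x within UNIV)" for x
      using C2b_has_derivative[OF assms] by simp
    show "onorm (\<lambda>h. gradient f x \<bullet> h) \<le> C2b_seminorm f" for x
    proof (rule onorm_le)
      fix h
      have "norm (gradient f x \<bullet> h) \<le> norm (gradient f x) * norm h"
        using Cauchy_Schwarz_ineq2 by simp
      also have "\<dots> \<le> C2b_seminorm f * norm h"
        by (intro mult_right_mono gradient_le_C2b_seminorm assms) simp
      finally show "norm (gradient f x \<bullet> h) \<le> C2b_seminorm f * norm h" .
    qed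
  qed simp_all
  then show ?thesis by simp
qed

lemma C2b_measurable:
  fixes f :: "real^'n \<Rightarrow> real"
  assumes "f \<in> C2b"
  shows "f \<in> borel_measurable borel"
proof -
  have "(C2b_seminorm f)-lipschitz_on UNIV f"
    using C2b_lipschitz[OF assms] gradient_le_C2b_seminorm[OF assms, of 0]
    by (intro lipschitz_onI) (auto simp: dist_norm intro: order_trans[OF norm_ge_zero])
  then show ?thesis
    by (intro borel_measurable_continuous_onI lipschitz_on_continuous_on)
qed

text \<open>The weights are changed into powers of \<open>1 + norm x\<close>, the quantity whose
  moments are controlled. Growth of \<open>U\<close> follows by comparison with the point 0: half of
  the exponent 2q, plus one for the distance.\<close>

lemma coefficients_growth:
  fixes U :: "'b::real_normed_vector \<Rightarrow> 'b"
  assumes "c\<^sub>2 > 0" "q > 0"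
    and loc: "\<And>x y. (norm (U x - U y))\<^sup>2 \<le> c\<^sub>2 * (1 + norm x powr (2 * q) + norm y powr (2 * q)) * (norm (x - y))\<^sup>2"
  shows "(norm (U x - U y))\<^sup>2 \<le> (2 * c\<^sub>2) * ((1 + norm x) powr (2 * q) + (1 + norm y) powr (2 * q)) * (norm (x - y))\<^sup>2"
    and "norm (U x) \<le> (norm (U 0) + 2 * sqrt c\<^sub>2) * (1 + norm x) powr (q + 1)"
proof -
  have le: "norm x powr (2 * q) \<le> (1 + norm x) powr (2 * q)" for x :: 'b
    using assms(2) by (intro powr_mono2) auto
  have ge1: "1 \<le> (1 + norm x) powr (2 * q)" for x :: 'b
    using assms(2) by (intro ge_one_powr_ge_zero) auto
  show loc': "(norm (U x - U y))\<^sup>2 \<le> (2 * c\<^sub>2) * ((1 + norm x) powr (2 * q) + (1 + norm y) powr (2 * q)) * (norm (x - y))\<^sup>2" for x y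
  proof -
    have "1 + norm x powr (2 * q) + norm y powr (2 * q) \<le> 2 * ((1 + norm x) powr (2 * q) + (1 + norm y) powr (2 * q))"
      using le[of x] le[of y] ge1[of x] ge1[of y] by simp
    then have "c\<^sub>2 * (1 + norm x powr (2 * q) + norm y powr (2 * q)) * (norm (x - y))\<^sup>2
      \<le> c\<^sub>2 * (2 * ((1 + norm x) powr (2 * q) + (1 + norm y) powr (2 * q))) * (norm (x - y))\<^sup>2"
      using assms(1) by (intro mult_right_mono mult_left_mono) auto
    with loc[of x y] show ?thesis by (simp add: mult_ac)
  qed
  have n0: "0 < 1 + norm x" using norm_ge_zero[of x] by linarith
  define T where "T = (1 + norm x) powr (q + 1)"
  have T: "0 \<le> T" "(1 + norm x) powr (2 * q) * (1 + norm x)\<^sup>2 = T\<^sup>2"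
  proof -
    have "(1 + norm x)\<^sup>2 = (1 + norm x) powr 2" using n0 by simp
    then have "(1 + norm x) powr (2 * q) * (1 + norm x)\<^sup>2 = (1 + norm x) powr (2 * q + 2)"
      by (simp only: powr_add)
    also have "2 * q + 2 = (q + 1) + (q + 1)" by simp
    also have "(1 + norm x) powr \<dots> = T\<^sup>2"
      unfolding T_def power2_eq_square by (rule powr_add)
    finally show "(1 + norm x) powr (2 * q) * (1 + norm x)\<^sup>2 = T\<^sup>2" .
  qed (simp add: T_def)
  have "(norm (U x - U 0))\<^sup>2 \<le> (2 * sqrt c\<^sub>2 * T)\<^sup>2"
  proof (rule order_trans)
    show "(norm (U x - U 0))\<^sup>2 \<le> (2 * c\<^sub>2) * (2 * (1 + norm x) powr (2 * q)) * (norm x)\<^sup>2"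
      by (rule order_trans[OF loc'[of x 0]]) (use ge1[of x] assms(1) in \<open>simp add: mult_right_mono\<close>)
    have "((2 * c\<^sub>2) * (2 * (1 + norm x) powr (2 * q))) * (norm x)\<^sup>2 \<le> ((2 * c\<^sub>2) * (2 * (1 + norm x) powr (2 * q))) * (1 + norm x)\<^sup>2"
      using assms(1) by (intro mult_left_mono power_mono) auto
    also have "\<dots> = 4 * c\<^sub>2 * ((1 + norm x) powr (2 * q) * (1 + norm x)\<^sup>2)" by simp
    also have "\<dots> = 4 * c\<^sub>2 * T\<^sup>2" unfolding T(2) ..
    also have "\<dots> = (2 * sqrt c\<^sub>2 * T)\<^sup>2" using assms(1) by (simp add: power_mult_distrib)
    finally show "(2 * c\<^sub>2) * (2 * (1 + norm x) powr (2 * q)) * (norm x)\<^sup>2 \<le> (2 * sqrt c\<^sub>2 * T)\<^sup>2" .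
  qed
  then have "norm (U x - U 0) \<le> 2 * sqrt c\<^sub>2 * (1 + norm x) powr (q + 1)"
    unfolding T_def[symmetric] by (rule power2_le_imp_le) (use assms(1) T(1) in simp)
  moreover have "norm (U x) \<le> norm (U 0) + norm (U x - U 0)"
    using norm_triangle_sub[of "U x" "U 0"] by simp
  moreover have "norm (U 0) * 1 \<le> norm (U 0) * (1 + norm x) powr (q + 1)"
    using assms(2) by (intro mult_left_mono ge_one_powr_ge_zero) auto
  ultimately show "norm (U x) \<le> (norm (U 0) + 2 * sqrt c\<^sub>2) * (1 + norm x) powr (q + 1)"
    by (simp add: distrib_right)
qed

text \<open>The fifth argument \<open>c\<close> of the locale is a sum of the Lipschitz, local
  Lipschitz and growth constants, so that one constant serves for all three. The 1/5 in
  \<open>V_le_U\<close> comes from \<rho> < 1/5 together with N \<beta>^2 >= 1.\<close>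

lemma contractive_coefficients_of_conditions:
  fixes U :: "real^'n \<Rightarrow> real^'n" and V :: "'d::finite \<Rightarrow> real^'n \<Rightarrow> real^'n"
  assumes sm: "smooth U" "\<And>k. smooth (V k)"
    and A: "condition_A U V c\<^sub>0 c\<^sub>1 c\<^sub>2 q K b\<^sub>0 b\<^sub>1" and B: "condition_B U V \<beta> lam \<alpha> \<rho> K'"
  shows "contractive_coefficients U V (INF x. lam x) (c\<^sub>1 + 2 * c\<^sub>2 + (norm (U 0) + 2 * sqrt c\<^sub>2)) q K'"
proof -
  let ?l = "INF x. lam x"
  let ?c = "c\<^sub>1 + 2 * c\<^sub>2 + (norm (U 0) + 2 * sqrt c\<^sub>2)"
  let ?r = "\<rho> / (real CARD('n) * \<beta>\<^sup>2)"
  have p: "c\<^sub>1 > 0" "c\<^sub>2 > 0" "q > 0" "\<beta> \<ge> 1" "?l > 0" "0 < \<rho>" "\<rho> < 1 / 5" "K' > 0"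
    and lampos: "\<And>x. lam x > 0"
    and Vl: "\<And>x y. (\<Sum>k\<in>UNIV. norm (V k x - V k y)) \<le> c\<^sub>1 * norm (x - y)"
    and Ul: "\<And>x y. (norm (U x - U y))\<^sup>2 \<le> c\<^sub>2 * (1 + norm x powr (2 * q) + norm y powr (2 * q)) * (norm (x - y))\<^sup>2"
    and Vb: "\<And>x k. norm (V k x) \<le> K'"
    and JU: "\<And>x v. v \<bullet> (jacobian U (at x) *v v) \<le> - lam x * (norm v)\<^sup>2"
    and JV: "\<And>x. (\<Sum>k\<in>UNIV. (norm (jacobian (V k) (at x)))\<^sup>2) \<le> ?r * lam x"
    using A B unfolding condition_A_def condition_B_def by simp_all
  have laml: "lam x \<ge> ?l" for x
    by (rule cINF_lower) (use lampos in \<open>auto intro!: bdd_belowI[of _ 0] less_imp_le\<close>)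
  have r0: "0 \<le> ?r" using p by simp
  have r5: "?r \<le> 1 / 5"
  proof -
    have "1 \<le> real CARD('n) * \<beta>\<^sup>2"
      using p(4) mult_mono[of 1 "real CARD('n)" 1 "\<beta>\<^sup>2"] by (simp add: Suc_leI one_le_power)
    then have "?r \<le> \<rho> / 1" using p by (intro divide_left_mono) auto
    then show ?thesis by (rule order_trans) (use p(7) in simp)
  qed
  note JVd = smooth_has_derivative_jacobian[OF sm(2)] and JUd = smooth_has_derivative_jacobian[OF sm(1)]
  note mono = monotone_of_jacobian[where V = V and U = U, OF JUd JVd JU JV laml r0]
  note gr = coefficients_growth[OF p(2,3) Ul]
  show ?thesis
  proof
    show "?l > 0" "q \<ge> 0" "K' > 0" using p by auto
    show c0: "?c > 0" using p by (simp add: add_pos_nonneg)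
    show "continuous_on UNIV U"
      by (intro continuous_at_imp_continuous_on ballI has_derivative_continuous[OF JUd])
    show "(U x - U y) \<bullet> (x - y) \<le> - ?l * (norm (x - y))\<^sup>2" for x y by (rule mono(1))
    have neg: "0 \<le> - ((U x - U y) \<bullet> (x - y))" for x y
    proof -
      have "0 \<le> ?l * (norm (x - y))\<^sup>2" using p(5) by simp
      then show ?thesis using mono(1)[of x y] by simp
    qed
    show "(\<Sum>k\<in>UNIV. (norm (V k x - V k y))\<^sup>2) \<le> - (1 / 5) * ((U x - U y) \<bullet> (x - y))" for x y
      using mono(2)[of x y] mult_right_mono[OF r5 neg[of x y]] by simp
    show "norm (V k x - V k y) \<le> ?c * norm (x - y)" for k x y
    proof -
      have "norm (V k x - V k y) \<le> (\<Sum>k\<in>UNIV. norm (V k x - V k y))"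
        by (rule member_le_sum) auto
      also have "\<dots> \<le> c\<^sub>1 * norm (x - y)" by (rule Vl)
      also have "\<dots> \<le> ?c * norm (x - y)" using p by (intro mult_right_mono) auto
      finally show ?thesis .
    qed
    show "norm (V k x) \<le> K'" for k x by (rule Vb)
    show "norm (U x) \<le> ?c * (1 + norm x) powr (q + 1)" for x
      by (rule order_trans[OF gr(2)]) (use p in \<open>auto intro!: mult_right_mono\<close>)
    show "(norm (U x - U y))\<^sup>2 \<le> ?c * ((1 + norm x) powr (2 * q) + (1 + norm y) powr (2 * q)) * (norm (x - y))\<^sup>2" for x y
      by (rule order_trans[OF gr(1)]) (use p in \<open>auto intro!: mult_right_mono add_nonneg_nonneg\<close>)
  qed
qed

context brownian_setting
begin

text \<open>Jensen's inequality for the square, read off from the nonnegative variance of the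
  norm.\<close>

lemma expectation_norm_le_sqrt:
  assumes "L2 f" "expectation (\<lambda>\<omega>. (norm (f \<omega>))\<^sup>2) \<le> C"
  shows "expectation (\<lambda>\<omega>. norm (f \<omega>)) \<le> sqrt C"
proof -
  have i: "integrable M (\<lambda>\<omega>. norm (f \<omega>))"
    using L2_integrable[OF assms(1)] by (rule integrable_norm)
  have "0 \<le> variance (\<lambda>\<omega>. norm (f \<omega>))" by (rule variance_positive)
  also have "\<dots> = expectation (\<lambda>\<omega>. (norm (f \<omega>))\<^sup>2) - (expectation (\<lambda>\<omega>. norm (f \<omega>)))\<^sup>2"
    by (rule variance_eq[OF i L2D(2)[OF assms(1)]])
  finally have "(expectation (\<lambda>\<omega>. norm (f \<omega>)))\<^sup>2 \<le> C" using assms(2) by simp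
  then show ?thesis by (rule real_le_rsqrt)
qed

lemma C2b_integrable:
  fixes f :: "real^'n \<Rightarrow> real"
  assumes f: "f \<in> C2b" and Y: "L2 Y"
  shows "integrable M (\<lambda>\<omega>. f (Y \<omega>))"
proof (rule Bochner_Integration.integrable_bound[of M "\<lambda>\<omega>. \<bar>f 0\<bar> + C2b_seminorm f * norm (Y \<omega>)"])
  show "integrable M (\<lambda>\<omega>. \<bar>f 0\<bar> + C2b_seminorm f * norm (Y \<omega>))"
    using L2_integrable[OF Y] by simp
  show "(\<lambda>\<omega>. f (Y \<omega>)) \<in> borel_measurable M"
    by (rule measurable_compose[OF L2D(1)[OF Y] C2b_measurable[OF f]])
  show "AE \<omega> in M. norm (f (Y \<omega>)) \<le> norm (\<bar>f 0\<bar> + C2b_seminorm f * norm (Y \<omega>))"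
  proof (rule AE_I2)
    fix \<omega>
    show "norm (f (Y \<omega>)) \<le> norm (\<bar>f 0\<bar> + C2b_seminorm f * norm (Y \<omega>))"
      using C2b_lipschitz[OF f, of "Y \<omega>" 0] by simp
  qed
qed

end

theorem theorem4p10:
  fixes M :: "'a measure" and F :: "real \<Rightarrow> 'a measure"
    and B :: "'d::finite \<Rightarrow> real \<Rightarrow> 'a \<Rightarrow> real"
    and U\<^sub>0 :: "real^'n \<Rightarrow> real^'n"
    and V :: "'d \<Rightarrow> real^'n \<Rightarrow> real^'n"
    and c\<^sub>0 c\<^sub>1 c\<^sub>2 q K b\<^sub>0 b\<^sub>1 \<beta> \<alpha> \<rho> K' :: real
    and lam :: "real^'n \<Rightarrow> real"
  assumes "filtered_prob_space M F"
    and "brownian_motions M F B"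
    and "smooth U\<^sub>0" and "\<And>k. smooth (V k)"
    and "condition_A U\<^sub>0 V c\<^sub>0 c\<^sub>1 c\<^sub>2 q K b\<^sub>0 b\<^sub>1"
    and "condition_B U\<^sub>0 V \<beta> lam \<alpha> \<rho> K'"
  shows "\<exists>C>0. \<exists>\<delta>\<^sub>0>0. \<forall>x f \<delta> X.
           f \<in> C2b \<and> 0 < \<delta> \<and> \<delta> < \<delta>\<^sub>0 \<and> sde_solution M F B U\<^sub>0 V x X \<longrightarrow>
           (\<forall>n::nat.
              integrable M (\<lambda>\<omega>. f (X (real n * \<delta>) \<omega>)) \<and>
              integrable M (\<lambda>\<omega>. f (split_step_euler U\<^sub>0 V B \<delta> x n \<omega>)) \<and>
              \<bar>prob_space.expectation M (\<lambda>\<omega>. f (X (real n * \<delta>) \<omega>))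
                - prob_space.expectation M (\<lambda>\<omega>. f (split_step_euler U\<^sub>0 V B \<delta> x n \<omega>))\<bar>
              \<le> C * C2b_seminorm f * \<delta> powr (1 / 2) * (1 + norm x powr (2 * q + 2)))"
proof -
  define l where "l = (INF x. lam x)"
  define c where "c = c\<^sub>1 + 2 * c\<^sub>2 + (norm (U\<^sub>0 0) + 2 * sqrt c\<^sub>2)"
  interpret prob_space M
    using assms(1) by (simp add: filtered_prob_space_def)
  interpret contractive_coefficients U\<^sub>0 V l c q K'
    unfolding l_def c_def using assms(3-6) by (rule contractive_coefficients_of_conditions)
  interpret sde_setting M F B U\<^sub>0 V l c q K'
    by unfold_locales (use assms(1,2) in auto)
  obtain A \<delta>\<^sub>0 where A: "A > 0" and \<delta>\<^sub>0: "\<delta>\<^sub>0 > 0"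
    and strong: "\<And>x X \<delta> n. sde_solution M F B U\<^sub>0 V x X \<Longrightarrow> 0 < \<delta> \<Longrightarrow> \<delta> < \<delta>\<^sub>0 \<Longrightarrow>
      expectation (\<lambda>\<omega>. (norm (X (real n * \<delta>) \<omega> - split_step_euler U\<^sub>0 V B \<delta> x n \<omega>))\<^sup>2)
      \<le> A * (1 + norm x) powr (4 * q + 4) * \<delta>"
    using strong_error by blast
  \<comment> \<open>The power of 2 comes from replacing \<open>(1 + norm x) powr (2 * q + 2)\<close>
    by \<open>1 + norm x powr (2 * q + 2)\<close>.\<close>
  define C where "C = sqrt A * 2 powr (2 * q + 2)"
  have C: "C > 0" using A by (simp add: C_def)
  show ?thesis
  proof (rule exI[of _ C], intro conjI C, rule exI[of _ \<delta>\<^sub>0], intro conjI \<delta>\<^sub>0 allI impI, goal_cases)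
    case (1 x f \<delta> X n)
    then have f: "f \<in> C2b" and \<delta>: "0 < \<delta>" and sol: "sde_solution M F B U\<^sub>0 V x X" by auto
    show ?case
      by (rule C2b_integrable[OF f solution_L2(1)[OF sol]]) (use \<delta> in simp)
  next
    case (2 x f \<delta> X n)
    then have "0 < \<delta>" by simp
    with 2 show ?case by (intro C2b_integrable split_step_L2[THEN conjunct2]) auto
  next
    case (3 x f \<delta> X n)
    then have f: "f \<in> C2b" and \<delta>: "0 < \<delta>" "\<delta> < \<delta>\<^sub>0" and sol: "sde_solution M F B U\<^sub>0 V x X" by auto
    let ?X = "X (real n * \<delta>)" and ?Z = "split_step_euler U\<^sub>0 V B \<delta> x n"
    have XL: "L2 ?X" by (rule solution_L2(1)[OF sol]) (use \<delta> in simp)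
    have ZL: "L2 ?Z" using split_step_L2[OF \<delta>(1)] by blast
    have dL: "L2 (\<lambda>\<omega>. ?X \<omega> - ?Z \<omega>)" by (rule L2_diff[OF XL ZL])
    note fi = C2b_integrable[OF f XL] C2b_integrable[OF f ZL]
    have s0: "0 \<le> C2b_seminorm f"
      using gradient_le_C2b_seminorm[OF f, of 0] norm_ge_zero[of "gradient f 0"] by linarith
    have "\<bar>expectation (\<lambda>\<omega>. f (?X \<omega>)) - expectation (\<lambda>\<omega>. f (?Z \<omega>))\<bar> = \<bar>expectation (\<lambda>\<omega>. f (?X \<omega>) - f (?Z \<omega>))\<bar>"
      using fi by simp
    also have "\<dots> \<le> expectation (\<lambda>\<omega>. \<bar>f (?X \<omega>) - f (?Z \<omega>)\<bar>)"
      by (rule integral_abs_bound)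
    also have "\<dots> \<le> expectation (\<lambda>\<omega>. C2b_seminorm f * norm (?X \<omega> - ?Z \<omega>))"
      using fi L2_integrable[OF dL] by (intro integral_mono C2b_lipschitz[OF f]) auto
    also have "\<dots> = C2b_seminorm f * expectation (\<lambda>\<omega>. norm (?X \<omega> - ?Z \<omega>))" by simp
    also have "\<dots> \<le> C2b_seminorm f * sqrt (A * (1 + norm x) powr (4 * q + 4) * \<delta>)"
      by (intro mult_left_mono expectation_norm_le_sqrt dL strong sol \<delta> s0)
    \<comment> \<open>The square root halves both exponents: 4q + 4 becomes 2q + 2, and \<delta>
      becomes its square root.\<close>
    also have "sqrt (A * (1 + norm x) powr (4 * q + 4) * \<delta>) = sqrt A * (1 + norm x) powr (2 * q + 2) * \<delta> powr (1 / 2)"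
    proof -
      have "(1 + norm x) powr (4 * q + 4) = ((1 + norm x) powr (2 * q + 2))\<^sup>2"
        by (simp add: power2_eq_square powr_add[symmetric])
      then show ?thesis using \<delta> by (simp add: real_sqrt_mult powr_half_sqrt)
    qed
    also have "C2b_seminorm f * (sqrt A * (1 + norm x) powr (2 * q + 2) * \<delta> powr (1 / 2))
      \<le> C2b_seminorm f * (sqrt A * (2 powr (2 * q + 2) * (1 + norm x powr (2 * q + 2))) * \<delta> powr (1 / 2))"
      using s0 A pos(3) by (intro mult_left_mono mult_right_mono one_add_powr_le) auto
    also have "\<dots> = C * C2b_seminorm f * \<delta> powr (1 / 2) * (1 + norm x powr (2 * q + 2))"
      by (simp add: C_def mult_ac)
    finally show ?case .
  qed
qed

end
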